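(* Let $\mu>0$ and let $B^{(\mu)}_t=B_t+\mu t$, $t\ge 0$, where $B$ is a standard Brownian motion started from $0$. Let $f:\mathbb{R}\to\mathbb{R}$ be a monotone, twice continuously differentiable function such that $r:=\lim_{x\to\infty}f(x)$ exists. Assume further that $f'(x)\neq 0$ for all $x$ and that $\int^\infty (f'(x))^2\,dx<\infty$. Put $$I_s:=\int_0^s (f'(B^{(\mu)}_u))^2\,du,\qquad \alpha_t:=\inf\{s:\ I_s>t\},$$ and let $Z$ be the process $$Z_t:=f(B^{(\mu)}_{\alpha_t})$$ for $t\ge 0$ such that $\alpha_t<\infty$. Then, almost surely, $$\int_0^\infty (f'(B^{(\mu)}_s))^2\,ds=\inf\{t:\ Z_t=r\}.$$ Moreover, $Z$ is a solution of the stochastic differential equation $$dZ_t=d\beta_t+G\circ f^{-1}(Z_t)\,dt,\qquad Z_0=f(0),$$ where $\beta$ is a Brownian motion and $$G(x):=\frac{1}{(f'(x))^2}\Bigl(\frac12 f''(x)+\mu f'(x)\Bigr).$$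
   Context: The notation $\int^\infty h(x)\,dx<\infty$ means that $h$ is integrable on a neighbourhood of $+\infty$. Under these assumptions $I_\infty:=\lim_{s\to\infty}I_s<\infty$ a.s., and $\alpha_t<\infty$ exactly for $t<I_\infty$; the process $Z$ and the stochastic differential equation (with its driving Brownian motion $\beta$, constructed on the same probability space) are considered on the time interval $[0,I_\infty)$. For the hitting time $\inf\{t: Z_t=r\}$, $Z$ is extended by its left limit at $t=I_\infty$, i.e. $Z_{I_\infty}:=\lim_{t\uparrow I_\infty}Z_t$. *)

theory Defs
  imports "HOL-Probability.Probability"
begin

section \<open>Brownian motion\<close>

text \<open>Processes are indexed by real times, of which only \<open>t \<ge> 0\<close> matters. As usual for
  Brownian motion, all paths (not just almost all) are continuous.\<close>

definition standard_brownian_motion :: "'a measure \<Rightarrow> (real \<Rightarrow> 'a \<Rightarrow> real) \<Rightarrow> bool" where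
  "standard_brownian_motion M W \<longleftrightarrow>
     prob_space M \<and>
     (\<forall>\<omega>\<in>space M. W 0 \<omega> = 0) \<and>
     (\<forall>\<omega>\<in>space M. continuous_on {0..} (\<lambda>t. W t \<omega>)) \<and>
     (\<forall>t\<ge>0. W t \<in> borel_measurable M) \<and>
     (\<forall>s t. 0 \<le> s \<and> s < t \<longrightarrow>
        distributed M lborel (\<lambda>\<omega>. W t \<omega> - W s \<omega>) (normal_density 0 (sqrt (t - s)))) \<and>
     (\<forall>(n::nat) (t::nat \<Rightarrow> real). 0 \<le> t 0 \<and> (\<forall>i<n. t i \<le> t (Suc i)) \<longrightarrow>
        prob_space.indep_vars M (\<lambda>_. borel) (\<lambda>i \<omega>. W (t (Suc i)) \<omega> - W (t i) \<omega>) {..<n})"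

text \<open>Filtrations and stopping times are indexed by \<^typ>\<open>ennreal\<close>, i.e. by \<open>[0, \<infinity>]\<close>, so that
  stopping times may take the value \<open>\<infinity>\<close>.\<close>

definition filtration_on :: "'a measure \<Rightarrow> (ennreal \<Rightarrow> 'a measure) \<Rightarrow> bool" where
  "filtration_on M F \<longleftrightarrow> filtration (space M) F \<and> (\<forall>t. subalgebra M (F t))"

definition brownian_motion_wrt ::
  "'a measure \<Rightarrow> (ennreal \<Rightarrow> 'a measure) \<Rightarrow> (real \<Rightarrow> 'a \<Rightarrow> real) \<Rightarrow> bool" where
  "brownian_motion_wrt M F W \<longleftrightarrow>
     filtration_on M F \<and>
     standard_brownian_motion M W \<and>
     (\<forall>t\<ge>0. W t \<in> borel_measurable (F (ennreal t))) \<and>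
     (\<forall>s t. 0 \<le> s \<and> s < t \<longrightarrow>
        prob_space.indep_set M (sets (F (ennreal s)))
          (sets (vimage_algebra (space M) (\<lambda>\<omega>. W t \<omega> - W s \<omega>) borel)))"

text \<open>A process living on the random interval \<open>[0, \<tau>)\<close> is represented by a total function whose
  values at times \<open>t \<ge> \<tau>\<close> are irrelevant.\<close>

definition adapted_until ::
  "(ennreal \<Rightarrow> 'a measure) \<Rightarrow> ('a \<Rightarrow> ennreal) \<Rightarrow> (real \<Rightarrow> 'a \<Rightarrow> real) \<Rightarrow> bool" where
  "adapted_until F \<tau> X \<longleftrightarrow>
     (\<forall>t\<ge>0. X t \<in> borel_measurable
        (restrict_space (F (ennreal t)) {\<omega> \<in> space (F (ennreal t)). ennreal t < \<tau> \<omega>}))"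

text \<open>A Brownian motion on \<open>[0, \<tau>)\<close>, for a stopping time \<open>\<tau>\<close>, is the restriction to \<open>[0, \<tau>)\<close> of
  a Brownian motion defined on an extension \<open>M \<Otimes> N\<close> of the filtered probability space. The process
  on \<open>[0, \<tau>)\<close> itself lives on \<open>M\<close>; the extension is unavoidable, since \<open>M\<close> need not carry
  the randomness required to continue it beyond \<open>\<tau>\<close>. The type of \<open>N\<close> is that of path space,
  which can carry a further independent Brownian motion.\<close>

definition brownian_motion_until ::
  "'a measure \<Rightarrow> (ennreal \<Rightarrow> 'a measure) \<Rightarrow> ('a \<Rightarrow> ennreal) \<Rightarrow> (real \<Rightarrow> 'a \<Rightarrow> real) \<Rightarrow> bool" where
  "brownian_motion_until M F \<tau> \<beta> \<longleftrightarrow>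
     filtration_on M F \<and> stopping_time F \<tau> \<and> adapted_until F \<tau> \<beta> \<and>
     (\<exists>(N :: (real \<Rightarrow> real) measure) H W.
        prob_space N \<and>
        brownian_motion_wrt (M \<Otimes>\<^sub>M N) H W \<and>
        (\<forall>t. fst \<in> measurable (H t) (F t)) \<and>
        (AE p in M \<Otimes>\<^sub>M N. \<forall>t\<ge>0. ennreal t < \<tau> (fst p) \<longrightarrow> W t p = \<beta> t (fst p)))"

section \<open>Stochastic differential equations with unit diffusion coefficient\<close>

text \<open>The equation \<open>dZ\<^sub>t = d\<beta>\<^sub>t + b(Z\<^sub>t) dt\<close>, \<open>Z\<^sub>0 = z\<close>, on \<open>[0, \<tau>)\<close>. Since the diffusion coefficient
  is 1, its integral form involves no stochastic integral.\<close>

definition solves_sde_until ::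
  "'a measure \<Rightarrow> (ennreal \<Rightarrow> 'a measure) \<Rightarrow> ('a \<Rightarrow> ennreal) \<Rightarrow> (real \<Rightarrow> 'a \<Rightarrow> real) \<Rightarrow>
   (real \<Rightarrow> real) \<Rightarrow> real \<Rightarrow> (real \<Rightarrow> 'a \<Rightarrow> real) \<Rightarrow> bool" where
  "solves_sde_until M F \<tau> \<beta> b z Z \<longleftrightarrow>
     brownian_motion_until M F \<tau> \<beta> \<and>
     adapted_until F \<tau> Z \<and>
     (AE \<omega> in M. 0 < \<tau> \<omega> \<and> Z 0 \<omega> = z \<and>
        continuous_on {t. 0 \<le> t \<and> ennreal t < \<tau> \<omega>} (\<lambda>t. Z t \<omega>) \<and>
        (\<forall>t\<ge>0. ennreal t < \<tau> \<omega> \<longrightarrow>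
           set_integrable lborel {0..t} (\<lambda>s. b (Z s \<omega>)) \<and>
           Z t \<omega> = Z 0 \<omega> + \<beta> t \<omega> + (LINT s:{0..t}|lborel. b (Z s \<omega>))))"

section \<open>The time-changed process\<close>

text \<open>Below, \<open>g\<close> is to be read as \<open>f'\<close> and \<open>X\<close> as the Brownian motion with drift.\<close>

definition clock :: "(real \<Rightarrow> real) \<Rightarrow> (real \<Rightarrow> 'a \<Rightarrow> real) \<Rightarrow> real \<Rightarrow> 'a \<Rightarrow> ennreal" where
  "clock g X s \<omega> = (\<integral>\<^sup>+u\<in>{0..s}. ennreal ((g (X u \<omega>))\<^sup>2) \<partial>lborel)"

definition total_clock :: "(real \<Rightarrow> real) \<Rightarrow> (real \<Rightarrow> 'a \<Rightarrow> real) \<Rightarrow> 'a \<Rightarrow> ennreal" where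
  "total_clock g X \<omega> = (\<integral>\<^sup>+u\<in>{0..}. ennreal ((g (X u \<omega>))\<^sup>2) \<partial>lborel)"

text \<open>The infimum is taken in \<open>[0, \<infinity>]\<close>; it is \<open>\<infinity>\<close> if the clock never exceeds \<open>t\<close>.\<close>

definition inverse_clock :: "(real \<Rightarrow> real) \<Rightarrow> (real \<Rightarrow> 'a \<Rightarrow> real) \<Rightarrow> real \<Rightarrow> 'a \<Rightarrow> ennreal" where
  "inverse_clock g X t \<omega> = Inf {ennreal s | s. 0 \<le> s \<and> ennreal t < clock g X s \<omega>}"

text \<open>Meaningful only where \<open>inverse_clock g X t \<omega> < \<infinity>\<close>.\<close>

definition time_changed ::
  "(real \<Rightarrow> real) \<Rightarrow> (real \<Rightarrow> real) \<Rightarrow> (real \<Rightarrow> 'a \<Rightarrow> real) \<Rightarrow> real \<Rightarrow> 'a \<Rightarrow> real" where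
  "time_changed f g X t \<omega> = f (X (enn2real (inverse_clock g X t \<omega>)) \<omega>)"

text \<open>The extension of the time-changed process by its left limit at \<open>t = total_clock g X \<omega>\<close>.\<close>

definition time_changed_ext ::
  "(real \<Rightarrow> real) \<Rightarrow> (real \<Rightarrow> real) \<Rightarrow> (real \<Rightarrow> 'a \<Rightarrow> real) \<Rightarrow> real \<Rightarrow> 'a \<Rightarrow> real" where
  "time_changed_ext f g X t \<omega> =
     (if inverse_clock g X t \<omega> < \<infinity> then time_changed f g X t \<omega>
      else Lim (at_left t) (\<lambda>u. time_changed f g X u \<omega>))"

definition hitting_time ::
  "(real \<Rightarrow> real) \<Rightarrow> (real \<Rightarrow> real) \<Rightarrow> (real \<Rightarrow> 'a \<Rightarrow> real) \<Rightarrow> real \<Rightarrow> 'a \<Rightarrow> ennreal" where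
  "hitting_time f g X r \<omega> =
     Inf {ennreal t | t. 0 \<le> t \<and> ennreal t \<le> total_clock g X \<omega> \<and> time_changed_ext f g X t \<omega> = r}"

end

theory Submission
  imports Defs
begin

text \<open>Stochastic integration is avoided altogether. Let
  \<open>m\<^sub>s = f(X\<^sub>s) - f(0) - \<integral>\<^sub>0\<^sup>s (f''/2 + \<mu> f')(X\<^sub>u) du\<close> and \<open>q\<^sub>s = \<integral>\<^sub>0\<^sup>s f'(X\<^sub>u)\<^sup>2 du\<close>. A second order Taylor
  expansion over small time steps shows that \<open>exp (i m + q / 2)\<close> is a martingale as long as \<open>X\<close> stays
  bounded. Optional stopping turns this into a maximal inequality for \<open>m\<close> in terms of the growth of \<open>q\<close>;
  hence \<open>X\<^sub>s \<rightarrow> \<infinity>\<close>, and \<open>m\<close> converges wherever \<open>q\<close> is bounded. For \<open>x > 0\<close> the Green density of \<open>X\<close>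
  at \<open>x\<close> is bounded by \<open>2 / \<mu>\<close>, so that the total clock \<open>q\<^sub>\<infinity>\<close> is finite. As \<open>q\<close> is inverted by
  \<open>\<alpha>\<close>, stopping at \<open>\<alpha>\<^sub>t\<close> gives conditional characteristic functions for the increments of
  \<open>\<beta>\<^sub>t = m(\<alpha>\<^sub>t)\<close>, and continuing \<open>\<beta>\<close> after time \<open>q\<^sub>\<infinity>\<close> by an independent Brownian path makes them
  Gaussian, which identifies \<open>\<beta>\<close>.\<close>

section \<open>Continuous processes at random times\<close>

text \<open>The exponential \<open>exp (\<i> * m + q / 2)\<close> is bounded wherever
  \<open>q\<close> is, so \<open>f\<close> needs no growth condition; its defect is that
  \<open>q\<close> is random and cannot be pulled out of an expectation. The time change makes the
  growth of \<open>q\<close> between \<alpha>_s and \<alpha>_t equal to min t T - min s T, T being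
  the total clock: deterministic as long as t < T, but still random when T falls below t. Given the
  original path, the increment of the independent path from the later of s and T up to t has
  variance (t - s) - (min t T - min s T), so the random exponents cancel and exp (- \<theta>^2 (t -
  s) / 2) remains. Applying this to \<theta> f gives all frequencies, and Levy uniqueness yields the
  Gaussian law and the independence of the past together. Two difficulties shape the details:
  \<alpha>_t can be infinite, so every stopping is done at bounded times that approximate it; and m
  converges only almost surely, while Brownian paths must all be continuous, so exceptional paths
  have to be recognisable at time 0. The hitting time is a matter of monotonicity: a strictly
  monotone \<open>f\<close> never attains r, so Z meets r only through its left limit at T.\<close>

lemma borel_measurable_at_random_time:
  fixes Y :: "real \<Rightarrow> 'a \<Rightarrow> 'b::metric_space" and a b :: real
  assumes ab: "a \<le> b"
    and Y: "\<And>u. a \<le> u \<Longrightarrow> u \<le> b \<Longrightarrow> Y u \<in> borel_measurable H"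
    and cont: "\<And>\<omega>. \<omega> \<in> space H \<Longrightarrow> continuous_on {a..b} (\<lambda>u. Y u \<omega>)"
    and R: "R \<in> borel_measurable H" "\<And>\<omega>. \<omega> \<in> space H \<Longrightarrow> R \<omega> \<in> {a..b}"
  shows "(\<lambda>\<omega>. Y (R \<omega>) \<omega>) \<in> borel_measurable H"
proof -
  \<comment> \<open>Grid points are projected into [a, b], since \<open>Y\<close> is controlled only
    there. The random index takes countably many values, which reduces measurability to that of
    single times.\<close>
  define c where "c n k = min b (max a (real_of_int k / real (Suc n)))" for n :: nat and k :: int
  have c: "c n k \<in> {a..b}" for n k
    using ab by (auto simp: c_def)
  have R': "(\<lambda>\<omega>. \<lfloor>real (Suc n) * R \<omega>\<rfloor>) \<in> measurable H (count_space UNIV)" for n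
    using R(1) by measurable
  show ?thesis
  proof (rule borel_measurable_LIMSEQ_metric)
    show "(\<lambda>\<omega>. Y (c n \<lfloor>real (Suc n) * R \<omega>\<rfloor>) \<omega>) \<in> borel_measurable H" for n
      by (rule measurable_compose_countable[where f="\<lambda>k. Y (c n k)", OF _ R'])
         (use c Y in auto)
  next
    fix \<omega> assume \<omega>: "\<omega> \<in> space H"
    note Rw = R(2)[OF \<omega>]
    have "(\<lambda>n. c n \<lfloor>real (Suc n) * R \<omega>\<rfloor>) \<longlonglongrightarrow> min b (max a (R \<omega>))"
      unfolding c_def
    proof (intro tendsto_intros)
      have "(\<lambda>n. R \<omega> - 1 / real (Suc n)) \<longlonglongrightarrow> R \<omega> - 0"
        by (intro tendsto_intros LIMSEQ_Suc[OF lim_1_over_n])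
      then have l: "(\<lambda>n. R \<omega> - 1 / real (Suc n)) \<longlonglongrightarrow> R \<omega>" by simp
      show "(\<lambda>n. real_of_int \<lfloor>real (Suc n) * R \<omega>\<rfloor> / real (Suc n)) \<longlonglongrightarrow> R \<omega>"
      proof (rule tendsto_sandwich[OF _ _ l tendsto_const])
        show "\<forall>\<^sub>F n in sequentially. real_of_int \<lfloor>real (Suc n) * R \<omega>\<rfloor> / real (Suc n) \<le> R \<omega>"
          by (intro always_eventually allI)
             (simp add: pos_divide_le_eq mult.commute del: of_nat_Suc)
        show "\<forall>\<^sub>F n in sequentially. R \<omega> - 1 / real (Suc n) \<le> real_of_int \<lfloor>real (Suc n) * R \<omega>\<rfloor> / real (Suc n)"
        proof (intro always_eventually allI)
          fix n
          have "real (Suc n) * R \<omega> - 1 \<le> real_of_int \<lfloor>real (Suc n) * R \<omega>\<rfloor>" by linarith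
          then have "(real (Suc n) * R \<omega> - 1) / real (Suc n) \<le> real_of_int \<lfloor>real (Suc n) * R \<omega>\<rfloor> / real (Suc n)"
            by (intro divide_right_mono) auto
          then show "R \<omega> - 1 / real (Suc n) \<le> real_of_int \<lfloor>real (Suc n) * R \<omega>\<rfloor> / real (Suc n)"
            by (simp add: diff_divide_distrib del: of_nat_Suc)
        qed
      qed
    qed
    also have "min b (max a (R \<omega>)) = R \<omega>" using Rw by auto
    finally have lim: "(\<lambda>n. c n \<lfloor>real (Suc n) * R \<omega>\<rfloor>) \<longlonglongrightarrow> R \<omega>" .
    show "(\<lambda>n. Y (c n \<lfloor>real (Suc n) * R \<omega>\<rfloor>) \<omega>) \<longlonglongrightarrow> Y (R \<omega>) \<omega>"
      by (rule continuous_on_tendsto_compose[OF cont[OF \<omega>] lim Rw]) (intro always_eventually allI c)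
  qed
qed

text \<open>The second coordinate of the product is itself a random time, and clamping it to [a, b]
  makes the map total. This joint measurability is what Fubini arguments require.\<close>

lemma borel_measurable_pair_continuous:
  fixes Y :: "real \<Rightarrow> 'a \<Rightarrow> 'b::metric_space" and a b :: real
  assumes ab: "a \<le> b"
    and Y: "\<And>u. a \<le> u \<Longrightarrow> u \<le> b \<Longrightarrow> Y u \<in> borel_measurable H"
    and cont: "\<And>\<omega>. \<omega> \<in> space H \<Longrightarrow> continuous_on {a..b} (\<lambda>u. Y u \<omega>)"
  shows "(\<lambda>(\<omega>, u). Y (min b (max a u)) \<omega>) \<in> borel_measurable (H \<Otimes>\<^sub>M lborel)"
proof -
  have "(\<lambda>p. (\<lambda>u p. Y u (fst p)) (min b (max a (snd p))) p) \<in> borel_measurable (H \<Otimes>\<^sub>M lborel)"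
  proof (rule borel_measurable_at_random_time[OF ab])
    show "(\<lambda>p. Y u (fst p)) \<in> borel_measurable (H \<Otimes>\<^sub>M lborel)" if "a \<le> u" "u \<le> b" for u
      using Y[OF that] by measurable
    show "continuous_on {a..b} (\<lambda>u. Y u (fst \<omega>))" if "\<omega> \<in> space (H \<Otimes>\<^sub>M lborel)" for \<omega>
      using that by (auto simp: space_pair_measure intro: cont)
  qed (use ab in auto)
  then show ?thesis by (simp add: case_prod_beta')
qed

text \<open>For continuous paths the gauge integral is a Lebesgue integral, whose dependence on the
  parameter is measurable once the integrand is jointly measurable.\<close>

lemma borel_measurable_integral_continuous:
  fixes Y :: "real \<Rightarrow> 'a \<Rightarrow> 'b::euclidean_space" and a b :: real
  assumes Y: "\<And>u. a \<le> u \<Longrightarrow> u \<le> b \<Longrightarrow> Y u \<in> borel_measurable H"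
    and cont: "\<And>\<omega>. \<omega> \<in> space H \<Longrightarrow> continuous_on {a..b} (\<lambda>u. Y u \<omega>)"
  shows "(\<lambda>\<omega>. integral {a..b} (\<lambda>u. Y u \<omega>)) \<in> borel_measurable H"
proof (cases "a \<le> b")
  case True
  have m[measurable]: "(\<lambda>(\<omega>, u). Y (min b (max a u)) \<omega>) \<in> borel_measurable (H \<Otimes>\<^sub>M lborel)"
    using borel_measurable_pair_continuous[OF True Y cont] .
  have "(\<lambda>\<omega>. \<integral>u. indicator {a..b} u *\<^sub>R Y (min b (max a u)) \<omega> \<partial>lborel) \<in> borel_measurable H"
    by measurable
  also have "?this \<longleftrightarrow> ?thesis"
  proof (rule measurable_cong)
    fix \<omega> assume \<omega>: "\<omega> \<in> space H"
    have "integral {a..b} (\<lambda>u. Y u \<omega>) = (LINT u:{a..b}|lborel. Y u \<omega>)"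
      by (rule set_borel_integral_eq_integral(2)[symmetric])
         (unfold set_integrable_def, intro borel_integrable_compact cont[OF \<omega>], simp)
    also have "\<dots> = (\<integral>u. indicator {a..b} u *\<^sub>R Y (min b (max a u)) \<omega> \<partial>lborel)"
      unfolding set_lebesgue_integral_def
      by (intro Bochner_Integration.integral_cong) (auto simp: indicator_def min_def max_def)
    finally show "(\<integral>u. indicator {a..b} u *\<^sub>R Y (min b (max a u)) \<omega> \<partial>lborel) = integral {a..b} (\<lambda>u. Y u \<omega>)"
      by simp
  qed
  finally show ?thesis .
qed simp

section \<open>Stopping times\<close>

text \<open>Real times suffice for the Brownian past; the filtration indexed by
  \<open>ennreal\<close> is built from this one later, by looking at it at the inverse
  clock.\<close>

locale real_filtration = prob_space M for M :: "'a measure" +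
  fixes \<G> :: "real \<Rightarrow> 'a measure"
  assumes space_G: "space (\<G> t) = space M"
    and sets_G: "sets (\<G> t) \<subseteq> sets M"
    and sets_G_mono: "s \<le> t \<Longrightarrow> sets (\<G> s) \<subseteq> sets (\<G> t)"
begin

lemma measurable_G_mono: "f \<in> measurable (\<G> s) N \<Longrightarrow> s \<le> t \<Longrightarrow> f \<in> measurable (\<G> t) N"
  using sets_G_mono[of s t] by (auto simp: measurable_def space_G)

lemma measurable_G_M: "f \<in> measurable (\<G> s) N \<Longrightarrow> f \<in> measurable M N"
  using sets_G[of s] by (auto simp: measurable_def space_G)

text \<open>Real values mean finite stopping times. Infinite ones occur only as limits of sequences
  of these.\<close>

definition stopping :: "('a \<Rightarrow> real) \<Rightarrow> bool" where
  "stopping T \<longleftrightarrow> (\<forall>\<omega>\<in>space M. 0 \<le> T \<omega>) \<and> (\<forall>s\<ge>0. {\<omega>\<in>space M. T \<omega> \<le> s} \<in> sets (\<G> s))"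

lemma stopping_nonneg: "stopping T \<Longrightarrow> \<omega> \<in> space M \<Longrightarrow> 0 \<le> T \<omega>"
  by (auto simp: stopping_def)

lemma stopping_le_sets:
  assumes "stopping T" "s \<le> t" shows "{\<omega>\<in>space M. T \<omega> \<le> s} \<in> sets (\<G> t)"
proof (cases "0 \<le> s")
  case True
  then show ?thesis using assms sets_G_mono[OF assms(2)] by (auto simp: stopping_def)
next
  case False
  then have "{\<omega>\<in>space M. T \<omega> \<le> s} = {}" using stopping_nonneg[OF assms(1)] by force
  then show ?thesis by (metis sets.empty_sets)
qed

lemma stopping_measurable: "stopping T \<Longrightarrow> T \<in> borel_measurable M"
  using stopping_le_sets sets_G by (intro borel_measurableI_le) blast

lemma stopping_const: "0 \<le> c \<Longrightarrow> stopping (\<lambda>_. c)"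
proof -
  have "{\<omega> \<in> space M. c \<le> s} = (if c \<le> s then space (\<G> s) else {})" for s by (simp add: space_G)
  then have "{\<omega> \<in> space M. c \<le> s} \<in> sets (\<G> s)" for s
    by (metis sets.empty_sets sets.top)
  then show "0 \<le> c \<Longrightarrow> stopping (\<lambda>_. c)" unfolding stopping_def by blast
qed

lemma stopping_min:
  assumes "stopping S" "stopping T" shows "stopping (\<lambda>\<omega>. min (S \<omega>) (T \<omega>))"
proof -
  have "{\<omega>\<in>space M. min (S \<omega>) (T \<omega>) \<le> s} = {\<omega>\<in>space M. S \<omega> \<le> s} \<union> {\<omega>\<in>space M. T \<omega> \<le> s}" for s
    by (auto simp: min_le_iff_disj)
  moreover have "{\<omega>\<in>space M. S \<omega> \<le> s} \<union> {\<omega>\<in>space M. T \<omega> \<le> s} \<in> sets (\<G> s)" for s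
    by (intro sets.Un stopping_le_sets assms order_refl)
  moreover have "0 \<le> min (S \<omega>) (T \<omega>)" if "\<omega> \<in> space M" for \<omega>
    using stopping_nonneg[OF assms(1) that] stopping_nonneg[OF assms(2) that] by simp
  ultimately show ?thesis unfolding stopping_def by (simp only: ball_simps) blast
qed

lemma stopping_min_measurable:
  assumes "stopping T" shows "(\<lambda>\<omega>. min (T \<omega>) s) \<in> borel_measurable (\<G> s)"
proof (rule borel_measurableI_le)
  fix q
  have "{\<omega> \<in> space (\<G> s). min (T \<omega>) s \<le> q} =
    (if s \<le> q then space (\<G> s) else {\<omega>\<in>space M. T \<omega> \<le> q})"
    by (auto simp: space_G min_le_iff_disj)
  then show "{\<omega> \<in> space (\<G> s). min (T \<omega>) s \<le> q} \<in> sets (\<G> s)"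
    using stopping_le_sets[OF assms, of q s] by (cases "s \<le> q") auto
qed

text \<open>Several exit conditions are combined into one by taking \<open>N\<close> to be a
  maximum. Including the summand u - K in that maximum forces the hitting time to be at most K, so
  the set in the infimum is never empty.\<close>

definition hit :: "(real \<Rightarrow> 'a \<Rightarrow> real) \<Rightarrow> 'a \<Rightarrow> real" where
  "hit N \<omega> = Inf {u. 0 \<le> u \<and> 0 \<le> N u \<omega>}"

context
  fixes N :: "real \<Rightarrow> 'a \<Rightarrow> real" and K :: real
  assumes N_cont: "\<And>\<omega>. \<omega> \<in> space M \<Longrightarrow> continuous_on {0..} (\<lambda>t. N t \<omega>)"
    and N_K: "0 \<le> K" "\<And>\<omega>. \<omega> \<in> space M \<Longrightarrow> 0 \<le> N K \<omega>"
begin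

lemma hit_bounds: assumes "\<omega> \<in> space M" shows "0 \<le> hit N \<omega>" "hit N \<omega> \<le> K" "0 \<le> N (hit N \<omega>) \<omega>"
proof -
  let ?S = "{u. 0 \<le> u \<and> 0 \<le> N u \<omega>}"
  have K: "K \<in> ?S" using N_K assms by auto
  have bdd: "bdd_below ?S" by (auto intro!: bdd_belowI[of _ 0])
  show "hit N \<omega> \<le> K" unfolding hit_def using K bdd by (rule cInf_lower)
  have "?S = {0..} \<inter> (\<lambda>t. N t \<omega>) -` {0..}" by auto
  then have "closed ?S"
    using continuous_closed_preimage[OF N_cont[OF assms], of "{0..}"] by simp
  then have "Inf ?S \<in> ?S"
    using K bdd by (intro closed_contains_Inf) auto
  then show "0 \<le> hit N \<omega>" "0 \<le> N (hit N \<omega>) \<omega>" by (auto simp: hit_def)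
qed

lemma hit_le_iff:
  assumes "\<omega> \<in> space M" "0 \<le> s" shows "hit N \<omega> \<le> s \<longleftrightarrow> (\<exists>u. 0 \<le> u \<and> u \<le> s \<and> 0 \<le> N u \<omega>)"
proof
  assume "hit N \<omega> \<le> s" then show "\<exists>u. 0 \<le> u \<and> u \<le> s \<and> 0 \<le> N u \<omega>"
    using hit_bounds[OF assms(1)] by blast
next
  assume "\<exists>u. 0 \<le> u \<and> u \<le> s \<and> 0 \<le> N u \<omega>"
  then obtain u where "0 \<le> u" "u \<le> s" "0 \<le> N u \<omega>" by blast
  moreover have "bdd_below {u. 0 \<le> u \<and> 0 \<le> N u \<omega>}" by (auto intro!: bdd_belowI[of _ 0])
  ultimately show "hit N \<omega> \<le> s" unfolding hit_def by (intro cInf_lower2[of u]) auto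
qed

text \<open>Reaching 0 before s is a condition on uncountably many times. By continuity on the
  compact interval [0, s] it is equivalent to exceeding every -1 / (n + 1) on a countable dense set
  of times.\<close>

lemma stopping_hit:
  assumes adapted: "\<And>s. 0 \<le> s \<Longrightarrow> N s \<in> borel_measurable (\<G> s)"
  shows "stopping (hit N)"
  unfolding stopping_def
proof (intro conjI ballI allI impI)
  fix s :: real assume s: "0 \<le> s"
  \<comment> \<open>Fractions of s rather than rational times: the resulting countable set is dense
    in [0, s], contains s itself, and the formula still makes sense for s = 0.\<close>
  define c where "c q = s * min 1 (max 0 (real_of_rat q))" for q
  have c: "0 \<le> c q" "c q \<le> s" for q
  proof -
    show "0 \<le> c q" using s by (auto simp: c_def)
    have "s * min 1 (max 0 (real_of_rat q)) \<le> s * 1" using s by (intro mult_left_mono) auto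
    then show "c q \<le> s" by (simp add: c_def)
  qed
  have clamp: "\<bar>min 1 (max 0 x) - y\<bar> \<le> \<bar>x - y\<bar>" if "0 \<le> y" "y \<le> 1" for x y :: real
    using that by (simp add: min_def max_def abs_if)
  have "{\<omega>\<in>space M. hit N \<omega> \<le> s} = {\<omega>\<in>space (\<G> s). \<forall>n::nat. \<exists>q. - 1 / real (Suc n) < N (c q) \<omega>}"
    unfolding space_G
  proof (intro Collect_cong conj_cong refl)
    fix \<omega> assume \<omega>: "\<omega> \<in> space M"
    have cont: "continuous_on {0..s} (\<lambda>t. N t \<omega>)"
      using N_cont[OF \<omega>] by (rule continuous_on_subset) auto
    show "hit N \<omega> \<le> s \<longleftrightarrow> (\<forall>n::nat. \<exists>q. - 1 / real (Suc n) < N (c q) \<omega>)"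
    proof
      assume "hit N \<omega> \<le> s"
      then obtain u where u: "0 \<le> u" "u \<le> s" "0 \<le> N u \<omega>"
        using hit_le_iff[OF \<omega> s] by auto
      show "\<forall>n::nat. \<exists>q. - 1 / real (Suc n) < N (c q) \<omega>"
      proof
        fix n :: nat
        have "\<exists>d>0. \<forall>x\<in>{0..s}. dist x u < d \<longrightarrow> dist (N x \<omega>) (N u \<omega>) < 1 / real (Suc n)"
          using cont u by (auto simp: continuous_on_iff)
        then obtain d where d: "d > 0" "\<And>x. x\<in>{0..s} \<Longrightarrow> dist x u < d \<Longrightarrow> dist (N x \<omega>) (N u \<omega>) < 1 / real (Suc n)"
          by blast
        show "\<exists>q. - 1 / real (Suc n) < N (c q) \<omega>"
        proof (cases "s = 0")
          case True
          with u have "N (c 0) \<omega> \<ge> 0" by (simp add: c_def)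
          moreover have "- 1 / real (Suc n) < 0" by simp
          ultimately show ?thesis by (intro exI[of _ 0]) linarith
        next
          case False
          with s have s': "s > 0" by simp
          obtain q where q: "u / s - d / s < real_of_rat q" "real_of_rat q < u / s + d / s"
            using of_rat_dense[of "u / s - d / s" "u / s + d / s"] d(1) s' by auto
          have us: "0 \<le> u / s" "u / s \<le> 1" using u s' by auto
          have "\<bar>min 1 (max 0 (real_of_rat q)) - u / s\<bar> \<le> \<bar>real_of_rat q - u / s\<bar>"
            using clamp[OF us] .
          also have "\<dots> < d / s" using q by (auto simp: abs_less_iff)
          finally have "s * \<bar>min 1 (max 0 (real_of_rat q)) - u / s\<bar> < d"
            using s' by (simp add: field_simps)
          moreover have "\<bar>c q - u\<bar> = s * \<bar>min 1 (max 0 (real_of_rat q)) - u / s\<bar>"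
          proof -
            have "c q - u = s * (min 1 (max 0 (real_of_rat q)) - u / s)"
              using s' by (simp add: c_def right_diff_distrib)
            then show ?thesis using s' by (simp add: abs_mult)
          qed
          ultimately have "dist (c q) u < d" by (simp add: dist_real_def)
          then have "dist (N (c q) \<omega>) (N u \<omega>) < 1 / real (Suc n)"
            using d(2)[of "c q"] c[of q] by auto
          then have "- (1 / real (Suc n)) < N (c q) \<omega>"
            using u(3) by (simp add: dist_real_def abs_less_iff del: of_nat_Suc)
          then show ?thesis by (intro exI[of _ q]) (simp del: of_nat_Suc)
        qed
      qed
    next
      assume q: "\<forall>n::nat. \<exists>q. - 1 / real (Suc n) < N (c q) \<omega>"
      \<comment> \<open>The times found for different n may differ; the maximum point of the path
        serves for all of them at once.\<close>
      obtain u where u: "u \<in> {0..s}" "\<And>x. x \<in> {0..s} \<Longrightarrow> N x \<omega> \<le> N u \<omega>"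
        using continuous_attains_sup[OF _ _ cont] s by (auto intro: that)
      have "- 1 / real (Suc n) \<le> N u \<omega>" for n
      proof -
        obtain x where "- 1 / real (Suc n) < N (c x) \<omega>" using q by blast
        moreover have "N (c x) \<omega> \<le> N u \<omega>" using u(2)[of "c x"] c[of x] by auto
        ultimately show ?thesis by linarith
      qed
      then have "0 \<le> N u \<omega>"
        using LIMSEQ_le_const2[of "\<lambda>n. - 1 / real (Suc n)" 0 "N u \<omega>"]
          tendsto_minus[OF LIMSEQ_Suc[OF lim_1_over_n]] by auto
      then show "hit N \<omega> \<le> s" using hit_le_iff[OF \<omega> s] u(1) by auto
    qed
  qed
  also have "\<dots> \<in> sets (\<G> s)"
  proof -
    have [measurable]: "N (c q) \<in> borel_measurable (\<G> s)" for q
      using measurable_G_mono[OF adapted] c by blast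
    show ?thesis by measurable
  qed
  finally show "{\<omega>\<in>space M. hit N \<omega> \<le> s} \<in> sets (\<G> s)" .
qed (rule hit_bounds)

end

lemma stopped_measurable:
  fixes Y :: "real \<Rightarrow> 'a \<Rightarrow> 'b::metric_space"
  assumes T: "stopping T" and s: "0 \<le> s"
    and Y: "\<And>s. 0 \<le> s \<Longrightarrow> Y s \<in> borel_measurable (\<G> s)"
    and cont: "\<And>\<omega>. \<omega> \<in> space M \<Longrightarrow> continuous_on {0..} (\<lambda>t. Y t \<omega>)"
  shows "(\<lambda>\<omega>. Y (min (T \<omega>) s) \<omega>) \<in> borel_measurable (\<G> s)"
proof (rule borel_measurable_at_random_time[OF s])
  show "Y u \<in> borel_measurable (\<G> s)" if "0 \<le> u" "u \<le> s" for u
    using measurable_G_mono[OF Y] that by blast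
  show "continuous_on {0..s} (\<lambda>u. Y u \<omega>)" if "\<omega> \<in> space (\<G> s)" for \<omega>
    using cont[of \<omega>] that by (auto simp: space_G intro: continuous_on_subset)
  show "min (T \<omega>) s \<in> {0..s}" if "\<omega> \<in> space (\<G> s)" for \<omega>
    using stopping_nonneg[OF T, of \<omega>] that s by (auto simp: space_G)
qed (rule stopping_min_measurable[OF T])

text \<open>This expresses measurability with respect to the \<sigma>-algebra of the past of
  \<open>T\<close> without constructing that \<sigma>-algebra.\<close>

definition pre_measurable :: "('a \<Rightarrow> real) \<Rightarrow> ('a \<Rightarrow> complex) \<Rightarrow> bool" where
  "pre_measurable T Y \<longleftrightarrow> (\<forall>s\<ge>0. (\<lambda>\<omega>. Y \<omega> * indicator {\<omega>. T \<omega> \<le> s} \<omega>) \<in> borel_measurable (\<G> s))"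

text \<open>For a stopping time with finitely many values the claim is the martingale identity on
  each piece where the value is constant. Rounding \<open>T\<close> up to a grid, continuity of
  paths and dominated convergence give the general case.\<close>

theorem optional_stopping:
  fixes E :: "real \<Rightarrow> 'a \<Rightarrow> complex"
  assumes K: "0 < K"
    and E: "\<And>s. 0 \<le> s \<Longrightarrow> E s \<in> borel_measurable (\<G> s)"
    and cont: "\<And>\<omega>. \<omega> \<in> space M \<Longrightarrow> continuous_on {0..} (\<lambda>t. E t \<omega>)"
    and bound: "\<And>\<omega> s. \<omega> \<in> space M \<Longrightarrow> 0 \<le> s \<Longrightarrow> s \<le> K \<Longrightarrow> norm (E s \<omega>) \<le> C"
    and mart: "\<And>s Y' D'. 0 \<le> s \<Longrightarrow> s \<le> K \<Longrightarrow> Y' \<in> borel_measurable (\<G> s) \<Longrightarrow>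
      (\<And>\<omega>. \<omega> \<in> space M \<Longrightarrow> norm (Y' \<omega>) \<le> D') \<Longrightarrow> (\<integral>\<omega>. Y' \<omega> * E s \<omega> \<partial>M) = (\<integral>\<omega>. Y' \<omega> * E K \<omega> \<partial>M)"
    and T: "stopping T" "\<And>\<omega>. \<omega> \<in> space M \<Longrightarrow> T \<omega> \<le> K"
    and Y: "pre_measurable T Y" "\<And>\<omega>. \<omega> \<in> space M \<Longrightarrow> norm (Y \<omega>) \<le> D"
  shows "(\<integral>\<omega>. Y \<omega> * E (T \<omega>) \<omega> \<partial>M) = (\<integral>\<omega>. Y \<omega> * E K \<omega> \<partial>M)"
proof -
  have ind_le: "indicator {\<omega>. T \<omega> \<le> K} \<omega> = (1::complex)" if "\<omega> \<in> space M" for \<omega>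
    using T(2)[OF that] by simp
  have YK: "(\<lambda>\<omega>. Y \<omega> * indicator {\<omega>. T \<omega> \<le> K} \<omega>) \<in> borel_measurable M"
    using Y(1) K unfolding pre_measurable_def by (intro measurable_G_M[of _ K]) auto
  have Ym[measurable]: "Y \<in> borel_measurable M"
    by (rule measurable_cong[THEN iffD1, OF _ YK]) (use T(2) in auto)
  have [measurable]: "T \<in> borel_measurable M" using stopping_measurable[OF T(1)] .
  \<comment> \<open>Rounding up, not down: the event that the rounded time equals a grid point is
    then already decided at that grid point.\<close>
  define Tn where "Tn n \<omega> = K * of_int \<lceil>real (Suc n) * T \<omega> / K\<rceil> / real (Suc n)" for n \<omega>
  have Tn_ge: "T \<omega> \<le> Tn n \<omega>" and Tn_le: "Tn n \<omega> \<le> T \<omega> + K / real (Suc n)" for n \<omega>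
  proof -
    have "real (Suc n) * T \<omega> / K \<le> of_int \<lceil>real (Suc n) * T \<omega> / K\<rceil>" by simp
    then have "K * (real (Suc n) * T \<omega> / K) / real (Suc n) \<le> Tn n \<omega>"
      unfolding Tn_def using K by (intro divide_right_mono mult_left_mono) auto
    then show "T \<omega> \<le> Tn n \<omega>" using K by (simp del: of_nat_Suc)
    have "of_int \<lceil>real (Suc n) * T \<omega> / K\<rceil> \<le> real (Suc n) * T \<omega> / K + 1" by linarith
    then have "Tn n \<omega> \<le> K * (real (Suc n) * T \<omega> / K + 1) / real (Suc n)"
      unfolding Tn_def using K by (intro divide_right_mono mult_left_mono) auto
    also have "\<dots> = T \<omega> + K / real (Suc n)" using K by (simp add: field_simps del: of_nat_Suc)
    finally show "Tn n \<omega> \<le> T \<omega> + K / real (Suc n)" .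
  qed
  have ceil: "\<lceil>real (Suc n) * T \<omega> / K\<rceil> \<in> {0..int (Suc n)}" if \<omega>: "\<omega> \<in> space M" for n \<omega>
  proof -
    have "real (Suc n) * T \<omega> / K \<le> real (Suc n) * K / K"
      using T(2)[OF \<omega>] K by (intro divide_right_mono mult_left_mono) auto
    also have "\<dots> = real (Suc n)" using K by simp
    finally have "\<lceil>real (Suc n) * T \<omega> / K\<rceil> \<le> int (Suc n)" by (simp add: ceiling_le_iff)
    moreover have "0 \<le> real (Suc n) * T \<omega> / K" using stopping_nonneg[OF T(1) \<omega>] K by simp
    then have "0 \<le> \<lceil>real (Suc n) * T \<omega> / K\<rceil>" by linarith
    ultimately show ?thesis by simp
  qed
  have Tn_K: "0 \<le> Tn n \<omega>" "Tn n \<omega> \<le> K" if \<omega>: "\<omega> \<in> space M" for n \<omega>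
  proof -
    have "real_of_int \<lceil>real (Suc n) * T \<omega> / K\<rceil> \<le> real (Suc n)"
      using ceil[OF \<omega>, of n] by (metis atLeastAtMost_iff of_int_le_iff of_int_of_nat_eq)
    then have "Tn n \<omega> \<le> K * real (Suc n) / real (Suc n)"
      unfolding Tn_def using K by (intro divide_right_mono mult_left_mono) auto
    then show "Tn n \<omega> \<le> K" by (simp del: of_nat_Suc)
    show "0 \<le> Tn n \<omega>" using Tn_ge[of \<omega> n] stopping_nonneg[OF T(1) \<omega>] by simp
  qed
  have Tn_meas[measurable]: "Tn n \<in> borel_measurable M" for n
    unfolding Tn_def by measurable
  have E_at: "(\<lambda>\<omega>. E (R \<omega>) \<omega>) \<in> borel_measurable M"
    if "R \<in> borel_measurable M" "\<And>\<omega>. \<omega> \<in> space M \<Longrightarrow> R \<omega> \<in> {0..K}" for R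
  proof (rule borel_measurable_at_random_time[of 0 K, OF _ _ _ that])
    show "continuous_on {0..K} (\<lambda>u. E u \<omega>)" if "\<omega> \<in> space M" for \<omega>
      using cont[OF that] by (rule continuous_on_subset) auto
  qed (use K E in \<open>auto intro: measurable_G_M\<close>)
  have eq: "(\<integral>\<omega>. Y \<omega> * E (Tn n \<omega>) \<omega> \<partial>M) = (\<integral>\<omega>. Y \<omega> * E K \<omega> \<partial>M)" for n
  proof -
    define g where "g j = K * real_of_int j / real (Suc n)" for j
    \<comment> \<open>This is \<open>Y\<close> on the event that \<open>T\<close> lies in the
      half-open cell ending at \<open>g j\<close>, and 0 elsewhere. For j = 0 the cell catches
      exactly \<open>T\<close> = 0, because \<open>g (- 1)\<close> is negative.\<close>
    define Yj where "Yj j \<omega> = Y \<omega> * indicator {\<omega>. T \<omega> \<le> g j} \<omega> * (1 - indicator {\<omega>. T \<omega> \<le> g (j - 1)} \<omega>)" for j \<omega>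
    have g: "0 \<le> g j" "g j \<le> K" if "j \<in> {0..int (Suc n)}" for j
    proof -
      show "0 \<le> g j" using that K by (simp add: g_def)
      have "real_of_int j \<le> real (Suc n)" using that by (metis atLeastAtMost_iff of_int_le_iff of_int_of_nat_eq)
      then have "g j \<le> K * real (Suc n) / real (Suc n)"
        unfolding g_def using K by (intro divide_right_mono mult_left_mono) auto
      then show "g j \<le> K" by (simp del: of_nat_Suc)
    qed
    have Tg: "T \<omega> \<le> g j \<longleftrightarrow> real (Suc n) * T \<omega> / K \<le> real_of_int j" for j \<omega>
      using K by (simp add: g_def field_simps del: of_nat_Suc)
    have Yj: "Yj j \<omega> = (if j = \<lceil>real (Suc n) * T \<omega> / K\<rceil> then Y \<omega> else 0)" for j \<omega>
    proof -
      have "j = \<lceil>real (Suc n) * T \<omega> / K\<rceil> \<longleftrightarrow> T \<omega> \<le> g j \<and> \<not> T \<omega> \<le> g (j - 1)"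
        unfolding Tg by (subst eq_commute) (auto simp: ceiling_eq_iff)
      then show ?thesis by (auto simp: Yj_def)
    qed
    have dec: "Y \<omega> * F (Tn n \<omega>) \<omega> = (\<Sum>j\<in>{0..int (Suc n)}. Yj j \<omega> * F (g j) \<omega>)"
      if "\<omega> \<in> space M" for \<omega> and F :: "real \<Rightarrow> 'a \<Rightarrow> complex"
    proof -
      have "(\<Sum>j\<in>{0..int (Suc n)}. Yj j \<omega> * F (g j) \<omega>) =
        (\<Sum>j\<in>{0..int (Suc n)}. if j = \<lceil>real (Suc n) * T \<omega> / K\<rceil> then Y \<omega> * F (g j) \<omega> else 0)"
        by (intro sum.cong) (auto simp: Yj)
      also have "\<dots> = Y \<omega> * F (Tn n \<omega>) \<omega>"
        using ceil[OF that, of n] by (simp add: g_def Tn_def)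
      finally show ?thesis ..
    qed
    have Yj_meas: "Yj j \<in> borel_measurable (\<G> (g j))" if "j \<in> {0..int (Suc n)}" for j
    proof -
      have [measurable]: "(\<lambda>\<omega>. Y \<omega> * indicator {\<omega>. T \<omega> \<le> g j} \<omega>) \<in> borel_measurable (\<G> (g j))"
        using Y(1) g[OF that] by (auto simp: pre_measurable_def)
      have "g (j - 1) \<le> g j" using K by (simp add: g_def field_simps)
      then have "{\<omega>\<in>space M. T \<omega> \<le> g (j - 1)} \<in> sets (\<G> (g j))"
        by (rule stopping_le_sets[OF T(1)])
      then have [measurable]: "(\<lambda>\<omega>. indicator {\<omega>. T \<omega> \<le> g (j - 1)} \<omega> :: complex) \<in> borel_measurable (\<G> (g j))"
        by (intro borel_measurable_indicator') (simp add: space_G)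
      show ?thesis unfolding Yj_def by measurable
    qed
    have Yj_le: "norm (Yj j \<omega>) \<le> D" if "\<omega> \<in> space M" for j \<omega>
    proof -
      have "0 \<le> D" using Y(2)[OF that] norm_ge_zero order_trans by blast
      then show ?thesis using Y(2)[OF that] by (simp add: Yj)
    qed
    have int: "integrable M (\<lambda>\<omega>. Yj j \<omega> * E s \<omega>)" if "j \<in> {0..int (Suc n)}" "0 \<le> s" "s \<le> K" for j s
    proof (rule integrable_const_bound[of _ "D * C"])
      show "AE \<omega> in M. norm (Yj j \<omega> * E s \<omega>) \<le> D * C"
      proof (intro AE_I2)
        fix \<omega> assume \<omega>: "\<omega> \<in> space M"
        have "0 \<le> D" using Y(2)[OF \<omega>] norm_ge_zero order_trans by blast
        then show "norm (Yj j \<omega> * E s \<omega>) \<le> D * C"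
          unfolding norm_mult using Yj_le[OF \<omega>] bound[OF \<omega> that(2,3)] by (intro mult_mono) auto
      qed
      show "(\<lambda>\<omega>. Yj j \<omega> * E s \<omega>) \<in> borel_measurable M"
        using measurable_G_M[OF Yj_meas[OF that(1)]] measurable_G_M[OF E[OF that(2)]] by measurable
    qed
    have "(\<integral>\<omega>. Y \<omega> * E (Tn n \<omega>) \<omega> \<partial>M) = (\<integral>\<omega>. (\<Sum>j\<in>{0..int (Suc n)}. Yj j \<omega> * E (g j) \<omega>) \<partial>M)"
      by (intro Bochner_Integration.integral_cong refl dec)
    also have "\<dots> = (\<Sum>j\<in>{0..int (Suc n)}. \<integral>\<omega>. Yj j \<omega> * E (g j) \<omega> \<partial>M)"
      by (intro Bochner_Integration.integral_sum int) (auto simp: g)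
    also have "\<dots> = (\<Sum>j\<in>{0..int (Suc n)}. \<integral>\<omega>. Yj j \<omega> * E K \<omega> \<partial>M)"
      by (intro sum.cong refl mart[of _ _ D]) (auto simp: g Yj_meas Yj_le)
    also have "\<dots> = (\<integral>\<omega>. (\<Sum>j\<in>{0..int (Suc n)}. Yj j \<omega> * E K \<omega>) \<partial>M)"
      using K by (intro Bochner_Integration.integral_sum[symmetric] int) auto
    also have "\<dots> = (\<integral>\<omega>. Y \<omega> * E K \<omega> \<partial>M)"
      by (intro Bochner_Integration.integral_cong refl) (use dec[of _ "\<lambda>_. E K"] in auto)
    finally show ?thesis .
  qed
  have "(\<lambda>n. \<integral>\<omega>. Y \<omega> * E (Tn n \<omega>) \<omega> \<partial>M) \<longlonglongrightarrow> (\<integral>\<omega>. Y \<omega> * E (T \<omega>) \<omega> \<partial>M)"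
  proof (rule integral_dominated_convergence[where w="\<lambda>_. D * C"])
    show "(\<lambda>\<omega>. Y \<omega> * E (T \<omega>) \<omega>) \<in> borel_measurable M"
      using T stopping_nonneg[OF T(1)] by (intro borel_measurable_times Ym E_at stopping_measurable) auto
    show "(\<lambda>\<omega>. Y \<omega> * E (Tn n \<omega>) \<omega>) \<in> borel_measurable M" for n
      using Tn_K by (intro borel_measurable_times Ym E_at Tn_meas) auto
    show "AE \<omega> in M. norm (Y \<omega> * E (Tn n \<omega>) \<omega>) \<le> D * C" for n
    proof (intro AE_I2)
      fix \<omega> assume \<omega>: "\<omega> \<in> space M"
      have "0 \<le> D" using Y(2)[OF \<omega>] norm_ge_zero order_trans by blast
      then show "norm (Y \<omega> * E (Tn n \<omega>) \<omega>) \<le> D * C"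
        unfolding norm_mult using Y(2)[OF \<omega>] bound[OF \<omega> Tn_K[OF \<omega>]] by (intro mult_mono) auto
    qed
    show "AE \<omega> in M. (\<lambda>n. Y \<omega> * E (Tn n \<omega>) \<omega>) \<longlonglongrightarrow> Y \<omega> * E (T \<omega>) \<omega>"
    proof (intro AE_I2 tendsto_mult tendsto_const)
      fix \<omega> assume \<omega>: "\<omega> \<in> space M"
      have "(\<lambda>n. T \<omega> + K * (1 / real (Suc n))) \<longlonglongrightarrow> T \<omega> + K * 0"
        by (intro tendsto_intros LIMSEQ_Suc[OF lim_1_over_n])
      then have "(\<lambda>n. T \<omega> + K / real (Suc n)) \<longlonglongrightarrow> T \<omega>" by simp
      then have "(\<lambda>n. Tn n \<omega>) \<longlonglongrightarrow> T \<omega>"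
        by (rule tendsto_sandwich[OF always_eventually always_eventually tendsto_const, rotated 2])
           (simp_all add: Tn_ge Tn_le del: of_nat_Suc)
      then show "(\<lambda>n. E (Tn n \<omega>) \<omega>) \<longlonglongrightarrow> E (T \<omega>) \<omega>"
        by (rule continuous_on_tendsto_compose[OF cont[OF \<omega>]])
           (use Tn_K[OF \<omega>] stopping_nonneg[OF T(1) \<omega>] in auto)
    qed
  qed simp
  then show ?thesis unfolding eq by (intro LIMSEQ_unique[OF _ tendsto_const]) auto
qed

end

section \<open>A Feynman--Kac martingale\<close>

text \<open>The mean value inequality is applied first to the derivative of the remainder and then
  to the remainder. The shape of the bound is chosen for Brownian increments: over time \<delta>,
  the expectation of \<epsilon> y^2 + K y^4 is \<epsilon> \<delta> up to terms of order
  \<delta>^2.\<close>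

lemma taylor2_bound:
  fixes h h1 h2 :: "real \<Rightarrow> 'b::real_normed_vector"
  assumes h: "\<And>x. (h has_vector_derivative h1 x) (at x)"
    and h1: "\<And>x. (h1 has_vector_derivative h2 x) (at x)"
    and mod: "\<And>x y. norm (h2 (x + y) - h2 x) \<le> \<epsilon> + K * y\<^sup>2" and K: "0 \<le> K"
  shows "norm (h (x + y) - h x - y *\<^sub>R h1 x - (y\<^sup>2 / 2) *\<^sub>R h2 x) \<le> (\<epsilon> + K * y\<^sup>2) * y\<^sup>2"
proof -
  let ?S = "closed_segment 0 y"
  have S: "\<bar>z\<bar> \<le> \<bar>y\<bar>" if "z \<in> ?S" for z
    using that by (auto simp: closed_segment_eq_real_ivl split: if_splits)
  have sq: "z\<^sup>2 \<le> y\<^sup>2" if "z \<in> ?S" for z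
    using S[OF that] by (simp add: abs_le_square_iff)
  define B where "B = \<epsilon> + K * y\<^sup>2"
  have on: "onorm (\<lambda>a::real. a *\<^sub>R v) = norm v" for v :: 'b
    using onorm_scaleR_left[of "\<lambda>a::real. a" v] by (simp add: bounded_linear_ident onorm_id)
  define R where "R z = h (x + z) - h x - z *\<^sub>R h1 x - (z\<^sup>2 / 2) *\<^sub>R h2 x" for z
  define R1 where "R1 z = h1 (x + z) - h1 x - z *\<^sub>R h2 x" for z
  have shift: "((\<lambda>z. x + z) has_vector_derivative 1) (at z)" for z :: real
    by (auto intro!: derivative_eq_intros)
  have dh: "((\<lambda>z. h (x + z)) has_vector_derivative h1 (x + z)) (at z)" for z
    using vector_diff_chain_at[OF shift h] by (simp add: comp_def)
  have dh1: "((\<lambda>z. h1 (x + z)) has_vector_derivative h2 (x + z)) (at z)" for z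
    using vector_diff_chain_at[OF shift h1] by (simp add: comp_def)
  have R1': "(R1 has_vector_derivative h2 (x + z) - h2 x) (at z)" for z
    unfolding R1_def by (auto intro!: derivative_eq_intros dh1)
  have R': "(R has_vector_derivative R1 z) (at z)" for z
    unfolding R_def R1_def by (auto intro!: derivative_eq_intros dh simp: has_real_derivative_iff_has_vector_derivative[symmetric])
  have R1_0: "norm (R1 z - R1 0) \<le> B * norm (z - 0)" if z: "z \<in> ?S" for z
  proof (rule differentiable_bound[where S="?S" and f'="\<lambda>z a. a *\<^sub>R (h2 (x + z) - h2 x)"])
    fix w assume w: "w \<in> ?S"
    show "(R1 has_derivative (\<lambda>a. a *\<^sub>R (h2 (x + w) - h2 x))) (at w within ?S)"
      using R1'[of w] unfolding has_vector_derivative_def by (rule has_derivative_at_withinI)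
    have "norm (h2 (x + w) - h2 x) \<le> \<epsilon> + K * w\<^sup>2" by (rule mod)
    also have "\<dots> \<le> B" unfolding B_def using sq[OF w] K by (intro add_left_mono mult_left_mono) auto
    finally show "onorm (\<lambda>a. a *\<^sub>R (h2 (x + w) - h2 x)) \<le> B" by (simp add: on)
  qed (use z in auto)
  have R1_le: "norm (R1 z) \<le> B * \<bar>y\<bar>" if z: "z \<in> ?S" for z
  proof -
    have "norm (R1 z) \<le> B * \<bar>z\<bar>" using R1_0[OF z] by (simp add: R1_def)
    also have "0 \<le> B" using mod[of x y] norm_ge_zero unfolding B_def by (rule order_trans[rotated])
    then have "B * \<bar>z\<bar> \<le> B * \<bar>y\<bar>" using S[OF z] by (intro mult_left_mono) auto
    finally show ?thesis .
  qed
  have "norm (R y - R 0) \<le> (B * \<bar>y\<bar>) * norm (y - 0)"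
  proof (rule differentiable_bound[where S="?S" and f'="\<lambda>z a. a *\<^sub>R R1 z"])
    fix w assume w: "w \<in> ?S"
    show "(R has_derivative (\<lambda>a. a *\<^sub>R R1 w)) (at w within ?S)"
      using R'[of w] unfolding has_vector_derivative_def by (rule has_derivative_at_withinI)
    show "onorm (\<lambda>a. a *\<^sub>R R1 w) \<le> B * \<bar>y\<bar>" using R1_le[OF w] by (simp add: on)
  qed auto
  then show ?thesis by (simp add: R_def B_def power2_eq_square mult.assoc)
qed

text \<open>Displacements below the modulus d cost at most \<epsilon>. For larger ones y^2 / d^2 is
  at least 1, so the total oscillation 2 C is absorbed by K = 2 C / d^2. Uniform continuity is
  thereby turned into something whose expectation is computable.\<close>

lemma quadratic_modulus_of_continuity:
  fixes \<phi> :: "real \<Rightarrow> 'b::real_normed_vector"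
  assumes "uniformly_continuous_on UNIV \<phi>" and C: "\<And>x. norm (\<phi> x) \<le> C" and \<epsilon>: "0 < \<epsilon>"
  shows "\<exists>K\<ge>0. \<forall>x y. norm (\<phi> (x + y) - \<phi> x) \<le> \<epsilon> + K * y\<^sup>2"
proof -
  obtain d where d: "d > 0" "\<And>x y. dist y x < d \<Longrightarrow> dist (\<phi> y) (\<phi> x) < \<epsilon>"
    using assms(1) \<epsilon> unfolding uniformly_continuous_on_def by (meson UNIV_I)
  have C0: "0 \<le> C" using C[of 0] norm_ge_zero order_trans by blast
  show ?thesis
  proof (intro exI[of _ "2 * C / d\<^sup>2"] conjI allI)
    show "0 \<le> 2 * C / d\<^sup>2" using C0 by simp
    fix x y
    show "norm (\<phi> (x + y) - \<phi> x) \<le> \<epsilon> + 2 * C / d\<^sup>2 * y\<^sup>2"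
    proof (cases "\<bar>y\<bar> < d")
      case True
      then have "norm (\<phi> (x + y) - \<phi> x) < \<epsilon>" using d(2)[of "x + y" x] by (simp add: dist_norm)
      moreover have "0 \<le> 2 * C / d\<^sup>2 * y\<^sup>2" using C0 by simp
      ultimately show ?thesis by linarith
    next
      case False
      then have "\<bar>d\<bar> \<le> \<bar>y\<bar>" using d(1) by simp
      then have "d\<^sup>2 \<le> y\<^sup>2" by (simp add: abs_le_square_iff)
      then have "1 \<le> y\<^sup>2 / d\<^sup>2" using d(1) by simp
      then have "2 * C * 1 \<le> 2 * C * (y\<^sup>2 / d\<^sup>2)" using C0 by (intro mult_left_mono) auto
      moreover have "norm (\<phi> (x + y) - \<phi> x) \<le> C + C"
        using C[of "x + y"] C[of x] norm_triangle_ineq4[of "\<phi> (x + y)" "\<phi> x"] by linarith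
      ultimately show ?thesis using \<epsilon> by simp
    qed
  qed
qed

text \<open>Tonelli: the pointwise bound \<open>C\<close> serves integrability, while the bound
  \<open>c\<close> on the expectations at single times is what survives in the result.\<close>

lemma (in prob_space) expectation_integral_le:
  fixes Z :: "real \<Rightarrow> 'a \<Rightarrow> real"
  assumes ab: "a \<le> b"
    and Z: "\<And>u. a \<le> u \<Longrightarrow> u \<le> b \<Longrightarrow> Z u \<in> borel_measurable M"
    and cont: "\<And>\<omega>. \<omega> \<in> space M \<Longrightarrow> continuous_on {a..b} (\<lambda>u. Z u \<omega>)"
    and bound: "\<And>u \<omega>. a \<le> u \<Longrightarrow> u \<le> b \<Longrightarrow> \<omega> \<in> space M \<Longrightarrow> 0 \<le> Z u \<omega> \<and> Z u \<omega> \<le> C"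
    and E: "\<And>u. a \<le> u \<Longrightarrow> u \<le> b \<Longrightarrow> (\<integral>\<omega>. Z u \<omega> \<partial>M) \<le> c"
  shows "integrable M (\<lambda>\<omega>. integral {a..b} (\<lambda>u. Z u \<omega>))"
    "(\<integral>\<omega>. integral {a..b} (\<lambda>u. Z u \<omega>) \<partial>M) \<le> c * (b - a)"
proof -
  let ?J = "\<lambda>\<omega>. integral {a..b} (\<lambda>u. Z u \<omega>)"
  interpret pair_sigma_finite M lborel by unfold_locales
  have Jm: "?J \<in> borel_measurable M"
    by (rule borel_measurable_integral_continuous[OF Z cont])
  have J0: "0 \<le> ?J \<omega>" if "\<omega> \<in> space M" for \<omega>
    using bound that by (intro integral_nonneg integrable_continuous_real cont) auto
  have JC: "?J \<omega> \<le> C * (b - a)" if "\<omega> \<in> space M" for \<omega>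
  proof -
    have "norm (?J \<omega>) \<le> C * (b - a)"
      using bound that by (intro integral_bound ab cont) auto
    then show ?thesis by simp
  qed
  show Ji: "integrable M ?J"
    by (rule integrable_const_bound[of _ "C * (b - a)"]) (use J0 JC Jm in \<open>auto intro!: AE_I2\<close>)
  have m[measurable]: "(\<lambda>(\<omega>, u). Z (min b (max a u)) \<omega>) \<in> borel_measurable (M \<Otimes>\<^sub>M lborel)"
    using borel_measurable_pair_continuous[OF ab Z cont] .
  define g where "g \<omega> u = ennreal (indicator {a..b} u * Z (min b (max a u)) \<omega>)" for \<omega> u
  have g[measurable]: "(\<lambda>(\<omega>, u). g \<omega> u) \<in> borel_measurable (M \<Otimes>\<^sub>M lborel)"
    unfolding g_def by measurable
  have c0: "0 \<le> c"
    using E[of a] ab bound by (intro order_trans[OF _ E[of a]] integral_nonneg_AE) auto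
  have "ennreal (\<integral>\<omega>. ?J \<omega> \<partial>M) = (\<integral>\<^sup>+\<omega>. ennreal (?J \<omega>) \<partial>M)"
    using Ji J0 by (intro nn_integral_eq_integral[symmetric]) auto
  also have "\<dots> = (\<integral>\<^sup>+\<omega>. (\<integral>\<^sup>+u. g \<omega> u \<partial>lborel) \<partial>M)"
  proof (rule nn_integral_cong)
    fix \<omega> assume \<omega>: "\<omega> \<in> space M"
    have i: "set_integrable lborel {a..b} (\<lambda>u. Z u \<omega>)"
      unfolding set_integrable_def by (intro borel_integrable_compact cont[OF \<omega>]) simp
    have "?J \<omega> = (LINT u:{a..b}|lborel. Z u \<omega>)"
      by (rule set_borel_integral_eq_integral(2)[OF i, symmetric])
    also have "ennreal \<dots> = (\<integral>\<^sup>+u. ennreal (indicator {a..b} u * Z u \<omega>) \<partial>lborel)"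
      unfolding set_lebesgue_integral_def
      using i bound \<omega> by (subst nn_integral_eq_integral) (auto simp: set_integrable_def indicator_def)
    also have "\<dots> = (\<integral>\<^sup>+u. g \<omega> u \<partial>lborel)"
      unfolding g_def by (intro nn_integral_cong arg_cong[where f=ennreal]) (auto simp: indicator_def)
    finally show "ennreal (?J \<omega>) = (\<integral>\<^sup>+u. g \<omega> u \<partial>lborel)" .
  qed
  also have "\<dots> = (\<integral>\<^sup>+u. (\<integral>\<^sup>+\<omega>. g \<omega> u \<partial>M) \<partial>lborel)"
    using Fubini'[OF g] by simp
  also have "\<dots> \<le> (\<integral>\<^sup>+u. ennreal c * indicator {a..b} u \<partial>lborel)"
  proof (rule nn_integral_mono)
    fix u
    show "(\<integral>\<^sup>+\<omega>. g \<omega> u \<partial>M) \<le> ennreal c * indicator {a..b} u"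
    proof (cases "u \<in> {a..b}")
      case True
      then have u: "a \<le> u" "u \<le> b" by auto
      then have "integrable M (Z u)"
        using Z bound by (intro integrable_const_bound[of _ C]) (auto intro!: AE_I2)
      then have "(\<integral>\<^sup>+\<omega>. g \<omega> u \<partial>M) = ennreal (\<integral>\<omega>. Z u \<omega> \<partial>M)"
        using u bound unfolding g_def by (subst nn_integral_eq_integral[symmetric]) (auto intro!: AE_I2)
      then show ?thesis using E[OF u] u by (auto intro: ennreal_leI)
    qed (simp add: g_def)
  qed
  also have "\<dots> = ennreal (c * (b - a))"
    using ab c0 by (subst nn_integral_cmult) (auto simp: ennreal_mult)
  finally show "(\<integral>\<omega>. ?J \<omega> \<partial>M) \<le> c * (b - a)"
    using c0 ab by (subst (asm) ennreal_le_iff) auto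
qed

lemma Int_stable_vimage: "Int_stable {f -` A \<inter> \<Omega> | A. A \<in> sets N}"
proof (safe intro!: Int_stableI)
  fix A A' assume "A \<in> sets N" "A' \<in> sets N"
  then show "\<exists>C. (f -` A \<inter> \<Omega>) \<inter> (f -` A' \<inter> \<Omega>) = f -` C \<inter> \<Omega> \<and> C \<in> sets N"
    by (intro exI[of _ "A \<inter> A'"]) auto
qed

text \<open>The filtration may be larger than the one generated by \<open>B\<close>; this leaves
  room for the null sets that are adjoined later.\<close>

locale brownian_filtration = real_filtration M \<G> for M :: "'a measure" and \<G> +
  fixes B :: "real \<Rightarrow> 'a \<Rightarrow> real" and \<mu> :: real
  assumes B_0: "\<omega> \<in> space M \<Longrightarrow> B 0 \<omega> = 0"
    and B_cont: "\<omega> \<in> space M \<Longrightarrow> continuous_on {0..} (\<lambda>t. B t \<omega>)"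
    and B_adapted: "0 \<le> s \<Longrightarrow> B s \<in> borel_measurable (\<G> s)"
    and B_incr: "0 \<le> s \<Longrightarrow> s < t \<Longrightarrow>
      distributed M lborel (\<lambda>\<omega>. B t \<omega> - B s \<omega>) (normal_density 0 (sqrt (t - s)))"
    and B_indep: "0 \<le> s \<Longrightarrow> s < t \<Longrightarrow> indep_set (sets (\<G> s))
      (sets (vimage_algebra (space M) (\<lambda>\<omega>. B t \<omega> - B s \<omega>) borel))"
begin

definition X :: "real \<Rightarrow> 'a \<Rightarrow> real" where "X t \<omega> = B t \<omega> + \<mu> * t"

lemma X_0: "\<omega> \<in> space M \<Longrightarrow> X 0 \<omega> = 0" by (simp add: X_def B_0)

lemma X_cont: "\<omega> \<in> space M \<Longrightarrow> continuous_on {0..} (\<lambda>t. X t \<omega>)"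
  unfolding X_def by (intro continuous_intros B_cont)

lemma X_cont_on: "\<omega> \<in> space M \<Longrightarrow> 0 \<le> a \<Longrightarrow> continuous_on {a..b} (\<lambda>t. X t \<omega>)"
  by (rule continuous_on_subset[OF X_cont]) auto

lemma X_adapted: "0 \<le> s \<Longrightarrow> X s \<in> borel_measurable (\<G> s)"
  unfolding X_def using B_adapted by measurable

lemma X_adapted': "0 \<le> s \<Longrightarrow> s \<le> t \<Longrightarrow> X s \<in> borel_measurable (\<G> t)"
  using measurable_G_mono[OF X_adapted] .

lemma X_meas: "0 \<le> s \<Longrightarrow> X s \<in> borel_measurable M"
  using measurable_G_M[OF X_adapted] .

lemma B_meas: "0 \<le> s \<Longrightarrow> B s \<in> borel_measurable M"
  using measurable_G_M[OF B_adapted] .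

lemma incr_moment:
  assumes "0 \<le> s" "s < t"
  shows "integrable M (\<lambda>\<omega>. (B t \<omega> - B s \<omega>) ^ k)"
    and "(\<integral>\<omega>. (B t \<omega> - B s \<omega>) ^ k \<partial>M) = (\<integral>x. normal_density 0 (sqrt (t - s)) x * x ^ k \<partial>lborel)"
proof -
  have pos: "0 < sqrt (t - s)" using assms by simp
  show "integrable M (\<lambda>\<omega>. (B t \<omega> - B s \<omega>) ^ k)"
    using distributed_integrable[OF B_incr[OF assms], of "\<lambda>x. x ^ k"]
      integrable_normal_moment[OF pos, of 0 k] by simp
  show "(\<integral>\<omega>. (B t \<omega> - B s \<omega>) ^ k \<partial>M) = (\<integral>x. normal_density 0 (sqrt (t - s)) x * x ^ k \<partial>lborel)"
    using distributed_integral[OF B_incr[OF assms], of "\<lambda>x. x ^ k"] by simp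
qed

lemma incr_moments:
  assumes "0 \<le> s" "s < t"
  shows "(\<integral>\<omega>. B t \<omega> - B s \<omega> \<partial>M) = 0"
    and "(\<integral>\<omega>. (B t \<omega> - B s \<omega>)\<^sup>2 \<partial>M) = t - s"
    and "(\<integral>\<omega>. (B t \<omega> - B s \<omega>) ^ 4 \<partial>M) = 3 * (t - s)\<^sup>2"
proof -
  have pos: "0 < sqrt (t - s)" using assms by simp
  show "(\<integral>\<omega>. B t \<omega> - B s \<omega> \<partial>M) = 0"
    using incr_moment(2)[OF assms, of 1] integral_normal_moment_odd[OF pos, of 0 0] by simp
  show "(\<integral>\<omega>. (B t \<omega> - B s \<omega>)\<^sup>2 \<partial>M) = t - s"
    using incr_moment(2)[OF assms, of 2] integral_normal_moment_even[OF pos, of 0 1] assms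
    by (simp add: fact_numeral)
  show "(\<integral>\<omega>. (B t \<omega> - B s \<omega>) ^ 4 \<partial>M) = 3 * (t - s)\<^sup>2"
    using incr_moment(2)[OF assms, of 4] integral_normal_moment_even[OF pos, of 0 2] assms
    by (simp add: fact_numeral power2_eq_square)
qed

lemma indep_incr_expectation:
  fixes Y :: "'a \<Rightarrow> complex"
  assumes st: "0 \<le> s" "s < t" and Y: "Y \<in> borel_measurable (\<G> s)" "integrable M Y"
    and \<phi>: "\<phi> \<in> borel_measurable borel" "integrable M (\<lambda>\<omega>. \<phi> (B t \<omega> - B s \<omega>) :: complex)"
  shows "(\<integral>\<omega>. Y \<omega> * \<phi> (B t \<omega> - B s \<omega>) \<partial>M) = (\<integral>\<omega>. Y \<omega> \<partial>M) * (\<integral>\<omega>. \<phi> (B t \<omega> - B s \<omega>) \<partial>M)"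
    "integrable M (\<lambda>\<omega>. Y \<omega> * \<phi> (B t \<omega> - B s \<omega>))"
proof -
  let ?D = "\<lambda>\<omega>. B t \<omega> - B s \<omega>"
  note Ym = measurable_G_M[OF Y(1)]
  have Dm: "?D \<in> borel_measurable M" by (rule borel_measurable_diff) (use B_meas st in auto)
  have \<phi>m: "(\<lambda>\<omega>. \<phi> (?D \<omega>)) \<in> borel_measurable M" using \<phi>(1) Dm by measurable
  have "indep_var borel Y borel (\<lambda>\<omega>. \<phi> (?D \<omega>))"
    unfolding indep_var_eq
  proof (intro conjI Ym \<phi>m indep_set_sigma_sets)
    show "indep_set {Y -` A \<inter> space M |A. A \<in> sets borel} {(\<lambda>\<omega>. \<phi> (?D \<omega>)) -` A \<inter> space M |A. A \<in> sets borel}"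
    proof (rule indep_setI)
      fix a b assume "a \<in> {Y -` A \<inter> space M |A. A \<in> sets borel}"
        and "b \<in> {(\<lambda>\<omega>. \<phi> (?D \<omega>)) -` A \<inter> space M |A. A \<in> sets borel}"
      then obtain A A' where A: "a = Y -` A \<inter> space M" "A \<in> sets borel"
        "b = (\<lambda>\<omega>. \<phi> (?D \<omega>)) -` A' \<inter> space M" "A' \<in> sets borel" by blast
      have "a \<in> sets (\<G> s)" using measurable_sets[OF Y(1) A(2)] A(1) by (simp add: space_G)
      moreover have "\<phi> -` A' \<in> sets borel" using measurable_sets[OF \<phi>(1) A(4)] by simp
      then have "b \<in> sets (vimage_algebra (space M) ?D borel)"
        using in_vimage_algebra[of "\<phi> -` A'" borel ?D "space M"] A(3) by (simp add: vimage_def)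
      ultimately show "prob (a \<inter> b) = prob a * prob b"
        by (rule indep_setD[OF B_indep[OF st]])
    qed (use Ym \<phi>m in \<open>auto intro: measurable_sets\<close>)
  qed (intro Int_stable_vimage)+
  then show "(\<integral>\<omega>. Y \<omega> * \<phi> (?D \<omega>) \<partial>M) = (\<integral>\<omega>. Y \<omega> \<partial>M) * (\<integral>\<omega>. \<phi> (?D \<omega>) \<partial>M)"
    "integrable M (\<lambda>\<omega>. Y \<omega> * \<phi> (?D \<omega>))"
    using indep_var_lebesgue_integral indep_var_integrable Y(2) \<phi>(2) by blast+
qed

text \<open>The second moment is needed exactly, the fourth only up to a constant. The factor 8 is
  the convexity bound (a + b)^4 \<le> 8 a^4 + 8 b^4.\<close>

lemma incr_X_moments:
  assumes "0 \<le> s" "s \<le> t"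
  shows "integrable M (\<lambda>\<omega>. (X t \<omega> - X s \<omega>)\<^sup>2)" "integrable M (\<lambda>\<omega>. (X t \<omega> - X s \<omega>) ^ 4)"
    and "(\<integral>\<omega>. (X t \<omega> - X s \<omega>)\<^sup>2 \<partial>M) = (t - s) + \<mu>\<^sup>2 * (t - s)\<^sup>2"
    and "(\<integral>\<omega>. (X t \<omega> - X s \<omega>) ^ 4 \<partial>M) \<le> 8 * (3 * (t - s)\<^sup>2 + \<mu> ^ 4 * (t - s) ^ 4)"
proof -
  have "integrable M (\<lambda>\<omega>. (X t \<omega> - X s \<omega>)\<^sup>2) \<and> integrable M (\<lambda>\<omega>. (X t \<omega> - X s \<omega>) ^ 4) \<and>
    (\<integral>\<omega>. (X t \<omega> - X s \<omega>)\<^sup>2 \<partial>M) = (t - s) + \<mu>\<^sup>2 * (t - s)\<^sup>2 \<and>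
    (\<integral>\<omega>. (X t \<omega> - X s \<omega>) ^ 4 \<partial>M) \<le> 8 * (3 * (t - s)\<^sup>2 + \<mu> ^ 4 * (t - s) ^ 4)"
  proof (cases "s = t")
    case False
    with assms have st: "0 \<le> s" "s < t" by auto
    note i = incr_moment(1)[OF st]
    let ?D = "\<lambda>\<omega>. B t \<omega> - B s \<omega>"
    define m where "m = \<mu> * (t - s)"
    have D: "X t \<omega> - X s \<omega> = ?D \<omega> + m" for \<omega> by (simp add: X_def m_def algebra_simps)
    have e2: "(X t \<omega> - X s \<omega>)\<^sup>2 = (?D \<omega>)^2 + 2 * m * (?D \<omega>)^1 + m\<^sup>2" for \<omega>
      unfolding D by (simp add: power2_eq_square algebra_simps)
    have e4: "(X t \<omega> - X s \<omega>) ^ 4 = (?D \<omega>)^4 + 4 * m * (?D \<omega>)^3 + 6 * m\<^sup>2 * (?D \<omega>)^2 + 4 * m ^ 3 * (?D \<omega>)^1 + m ^ 4" for \<omega>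
      unfolding D by (simp add: power2_eq_square power4_eq_xxxx power3_eq_cube algebra_simps)
    have i2: "integrable M (\<lambda>\<omega>. (X t \<omega> - X s \<omega>)\<^sup>2)"
      unfolding e2 by (intro Bochner_Integration.integrable_add integrable_mult_right i) auto
    have i4: "integrable M (\<lambda>\<omega>. (X t \<omega> - X s \<omega>) ^ 4)"
      unfolding e4 by (intro Bochner_Integration.integrable_add integrable_mult_right i) auto
    have "(\<integral>\<omega>. (X t \<omega> - X s \<omega>)\<^sup>2 \<partial>M) = (t - s) + m\<^sup>2"
      unfolding e2 using i[of 2] i[of 1] incr_moments[OF st] by (simp add: prob_space)
    moreover have "(\<integral>\<omega>. (X t \<omega> - X s \<omega>) ^ 4 \<partial>M) \<le> (\<integral>\<omega>. 8 * (?D \<omega>)^4 + 8 * m ^ 4 \<partial>M)"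
    proof (rule integral_mono[OF i4])
      show "integrable M (\<lambda>\<omega>. 8 * (?D \<omega>)^4 + 8 * m ^ 4)"
        by (intro Bochner_Integration.integrable_add integrable_mult_right i) auto
      have "(a + b) ^ 4 \<le> 8 * a ^ 4 + 8 * b ^ 4" for a b :: real
      proof -
        have 1: "(a + b)\<^sup>2 \<le> 2 * a\<^sup>2 + 2 * b\<^sup>2"
          using zero_le_power2[of "a - b"] by (simp add: power2_eq_square algebra_simps)
        have "(a + b) ^ 4 = ((a + b)\<^sup>2)\<^sup>2" by simp
        also have "\<dots> \<le> (2 * a\<^sup>2 + 2 * b\<^sup>2)\<^sup>2" using 1 by (intro power_mono) auto
        also have "\<dots> \<le> 2 * (2 * a\<^sup>2)\<^sup>2 + 2 * (2 * b\<^sup>2)\<^sup>2"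
          using zero_le_power2[of "2 * a\<^sup>2 - 2 * b\<^sup>2"] by (simp add: power2_eq_square algebra_simps)
        also have "\<dots> = 8 * a ^ 4 + 8 * b ^ 4" by (simp add: power_mult_distrib)
        finally show ?thesis .
      qed
      then show "(X t \<omega> - X s \<omega>) ^ 4 \<le> 8 * (?D \<omega>)^4 + 8 * m ^ 4" for \<omega> unfolding D .
    qed
    moreover have "(\<integral>\<omega>. 8 * (?D \<omega>)^4 + 8 * m ^ 4 \<partial>M) = 8 * (3 * (t - s)\<^sup>2) + 8 * m ^ 4"
      using i[of 4] incr_moments[OF st] by (simp add: prob_space)
    ultimately show ?thesis using i2 i4 by (simp add: m_def power_mult_distrib)
  qed simp
  then show "integrable M (\<lambda>\<omega>. (X t \<omega> - X s \<omega>)\<^sup>2)" "integrable M (\<lambda>\<omega>. (X t \<omega> - X s \<omega>) ^ 4)"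
    "(\<integral>\<omega>. (X t \<omega> - X s \<omega>)\<^sup>2 \<partial>M) = (t - s) + \<mu>\<^sup>2 * (t - s)\<^sup>2"
    "(\<integral>\<omega>. (X t \<omega> - X s \<omega>) ^ 4 \<partial>M) \<le> 8 * (3 * (t - s)\<^sup>2 + \<mu> ^ 4 * (t - s) ^ 4)"
    by blast+
qed

end

lemma continuous_on_atLeastI:
  fixes f :: "real \<Rightarrow> 'b::topological_space"
  assumes "\<And>b. continuous_on {a..b} f"
  shows "continuous_on {a..} f"
  unfolding continuous_on_def
proof
  fix x assume x: "x \<in> {a..}"
  have "at x within {a..} = at x within {a..x + 1}"
    by (rule at_within_nhd[of x "{..<x + 1}"]) auto
  then show "(f \<longlongrightarrow> f x) (at x within {a..})"
    using assms[of "x + 1"] x by (simp add: continuous_on_def)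
qed

section \<open>Additive functionals and the infinitesimal Feynman--Kac step\<close>

context brownian_filtration
begin

text \<open>The codomain is left general because both real integrands (drift and clock) and a
  complex potential occur.\<close>

definition afun :: "(real \<Rightarrow> 'b::euclidean_space) \<Rightarrow> real \<Rightarrow> 'a \<Rightarrow> 'b" where
  "afun v t \<omega> = integral {0..t} (\<lambda>u. v (X u \<omega>))"

lemma comp_X_cont:
  assumes "continuous_on UNIV v" "\<omega> \<in> space M" "0 \<le> a"
  shows "continuous_on {a..b} (\<lambda>u. v (X u \<omega>))"
  using continuous_on_compose2[OF assms(1) X_cont_on[OF assms(2,3)]] by simp

lemma comp_X_adapted:
  assumes "continuous_on UNIV v" "0 \<le> s" "s \<le> t"
  shows "(\<lambda>\<omega>. v (X s \<omega>)) \<in> borel_measurable (\<G> t)"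
  using borel_measurable_continuous_onI[OF assms(1)] X_adapted'[OF assms(2,3)] by measurable

lemma afun_adapted:
  assumes "continuous_on UNIV v" "0 \<le> t"
  shows "afun v t \<in> borel_measurable (\<G> t)"
  unfolding afun_def
  by (rule borel_measurable_integral_continuous[of 0 t "\<lambda>u \<omega>. v (X u \<omega>)"])
     (auto simp: space_G intro: comp_X_adapted comp_X_cont assms)

lemma afun_integral_adapted:
  fixes v :: "real \<Rightarrow> 'b::euclidean_space"
  assumes "continuous_on UNIV v" "0 \<le> s" "t \<le> r"
  shows "(\<lambda>\<omega>. integral {s..t} (\<lambda>u. v (X u \<omega>))) \<in> borel_measurable (\<G> r)"
  by (rule borel_measurable_integral_continuous[of s t "\<lambda>u \<omega>. v (X u \<omega>)"])
     (use assms in \<open>auto simp: space_G intro: comp_X_adapted comp_X_cont\<close>)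

lemma afun_diff:
  assumes "continuous_on UNIV v" "\<omega> \<in> space M" "0 \<le> s" "s \<le> t"
  shows "afun v t \<omega> - afun v s \<omega> = integral {s..t} (\<lambda>u. v (X u \<omega>))"
proof -
  have "afun v s \<omega> + integral {s..t} (\<lambda>u. v (X u \<omega>)) = afun v t \<omega>"
    unfolding afun_def using assms
    by (intro Henstock_Kurzweil_Integration.integral_combine integrable_continuous_real comp_X_cont) auto
  then show ?thesis by (simp add: algebra_simps)
qed

lemma afun_cont:
  assumes "continuous_on UNIV v" "\<omega> \<in> space M"
  shows "continuous_on {0..} (\<lambda>t. afun v t \<omega>)"
proof (rule continuous_on_atLeastI)
  show "continuous_on {0..b} (\<lambda>t. afun v t \<omega>)" for b
    unfolding afun_def
    by (intro indefinite_integral_continuous_1 integrable_continuous_real comp_X_cont assms) auto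
qed

context
  fixes h h1 h2 V :: "real \<Rightarrow> complex" and C :: real
  assumes dh: "\<And>x. (h has_vector_derivative h1 x) (at x)"
    and dh1: "\<And>x. (h1 has_vector_derivative h2 x) (at x)"
    and pde: "\<And>x. h2 x / 2 + of_real \<mu> * h1 x + V x * h x = 0"
    and C: "\<And>x. norm (h x) \<le> C" "\<And>x. norm (h1 x) \<le> C" "\<And>x. norm (h2 x) \<le> C" "\<And>x. norm (V x) \<le> C"
    and uc: "uniformly_continuous_on UNIV h2" "uniformly_continuous_on UNIV V"
begin

lemma V_cont: "continuous_on UNIV V" and h2_cont: "continuous_on UNIV h2"
  using uc by (auto intro: uniformly_continuous_imp_continuous)

lemma h_cont: "continuous_on UNIV h"
  using dh by (intro differentiable_imp_continuous_on) (auto simp: differentiable_on_def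
    intro!: differentiable_at_withinI differentiableI_vector)

lemma h1_cont: "continuous_on UNIV h1"
  using dh1 by (intro differentiable_imp_continuous_on) (auto simp: differentiable_on_def
    intro!: differentiable_at_withinI differentiableI_vector)

lemma C_nonneg: "0 \<le> C" using C(1)[of 0] norm_ge_zero order_trans by blast

lemma h_lipschitz: "norm (h y - h x) \<le> C * \<bar>y - x\<bar>"
proof -
  have "norm (h y - h x) \<le> C * norm (y - x)"
  proof (rule differentiable_bound[where S=UNIV and f'="\<lambda>z a. a *\<^sub>R h1 z"])
    show "(h has_derivative (\<lambda>a. a *\<^sub>R h1 z)) (at z within UNIV)" for z
      using dh[of z] by (simp add: has_vector_derivative_def)
    have "onorm (\<lambda>a::real. a *\<^sub>R v) = norm v" for v :: complex
      using onorm_scaleR_left[of "\<lambda>a::real. a" v] by (simp add: bounded_linear_ident onorm_id)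
    then show "onorm (\<lambda>a. a *\<^sub>R h1 z) \<le> C" for z using C(2) by simp
  qed auto
  then show ?thesis by simp
qed

text \<open>This collects everything of order \<delta> in one time step. By the equation for
  \<open>h\<close>, drift, variance and potential cancel at that order, so its conditional
  expectation is of order \<delta>^2.\<close>

definition main :: "real \<Rightarrow> real \<Rightarrow> 'a \<Rightarrow> complex" where
  "main u \<delta> \<omega> = (X (u + \<delta>) \<omega> - X u \<omega>) *\<^sub>R h1 (X u \<omega>) +
     ((X (u + \<delta>) \<omega> - X u \<omega>)\<^sup>2 / 2) *\<^sub>R h2 (X u \<omega>) + \<delta> *\<^sub>R (V (X u \<omega>) * h (X u \<omega>))"

lemma main_expectation:
  assumes u: "0 \<le> u" and \<delta>: "0 < \<delta>" and Y: "Y \<in> borel_measurable (\<G> u)"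
    and D: "\<And>\<omega>. \<omega> \<in> space M \<Longrightarrow> norm (Y \<omega>) \<le> D" "0 \<le> D"
  shows "integrable M (\<lambda>\<omega>. Y \<omega> * main u \<delta> \<omega>)"
    "norm (\<integral>\<omega>. Y \<omega> * main u \<delta> \<omega> \<partial>M) \<le> D * (\<mu>\<^sup>2 * \<delta>\<^sup>2 * C)"
proof -
  let ?b = "\<lambda>\<omega>. B (u + \<delta>) \<omega> - B u \<omega>"
  have st: "0 \<le> u" "u < u + \<delta>" using u \<delta> by auto
  \<comment> \<open>After X_(u+\<delta>) - X_u is written as b + \<mu> \<delta> and V h is
    eliminated by the equation, these are the coefficients of b, b^2 and 1. In expectation b
    disappears and b^2 becomes \<delta>, which cancels the - \<delta> / 2 in
    \<open>Y3\<close>.\<close>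
  define Y1 where "Y1 \<omega> = Y \<omega> * (h1 (X u \<omega>) + of_real (\<mu> * \<delta>) * h2 (X u \<omega>))" for \<omega>
  define Y2 where "Y2 \<omega> = Y \<omega> * h2 (X u \<omega>) / 2" for \<omega>
  define Y3 where "Y3 \<omega> = of_real (\<mu>\<^sup>2 * \<delta>\<^sup>2 / 2 - \<delta> / 2) * (Y \<omega> * h2 (X u \<omega>))" for \<omega>
  note [measurable] = Y comp_X_adapted[OF h2_cont u order_refl] comp_X_adapted[OF h1_cont u order_refl]
  have Ym: "Y1 \<in> borel_measurable (\<G> u)" "Y2 \<in> borel_measurable (\<G> u)" "Y3 \<in> borel_measurable (\<G> u)"
    unfolding Y1_def Y2_def Y3_def by measurable
  have Yh2: "norm (Y \<omega> * h2 (X u \<omega>)) \<le> D * C" if "\<omega> \<in> space M" for \<omega>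
    unfolding norm_mult by (intro mult_mono D C that) auto
  have i2: "integrable M (\<lambda>\<omega>. Y \<omega> * h2 (X u \<omega>))"
    by (rule integrable_const_bound[of _ "D * C"])
       (auto intro!: AE_I2 Yh2 measurable_G_M[of _ u])
  have iY2: "integrable M Y2" unfolding Y2_def using i2 by simp
  have iY3: "integrable M Y3" unfolding Y3_def using i2 by simp
  have iY1: "integrable M Y1"
  proof (rule integrable_const_bound[of _ "D * (C + \<bar>\<mu> * \<delta>\<bar> * C)"])
    show "Y1 \<in> borel_measurable M" using Ym(1) by (rule measurable_G_M)
    show "AE \<omega> in M. norm (Y1 \<omega>) \<le> D * (C + \<bar>\<mu> * \<delta>\<bar> * C)"
    proof (intro AE_I2)
      fix \<omega> assume \<omega>: "\<omega> \<in> space M"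
      have "norm (h1 (X u \<omega>) + of_real (\<mu> * \<delta>) * h2 (X u \<omega>)) \<le> norm (h1 (X u \<omega>)) + norm (of_real (\<mu> * \<delta>) * h2 (X u \<omega>))"
        by (rule norm_triangle_ineq)
      also have "norm (of_real (\<mu> * \<delta>) * h2 (X u \<omega>)) = \<bar>\<mu> * \<delta>\<bar> * norm (h2 (X u \<omega>))"
        by (simp only: norm_mult norm_of_real)
      also have "norm (h1 (X u \<omega>)) + \<dots> \<le> C + \<bar>\<mu> * \<delta>\<bar> * C"
        by (intro add_mono mult_left_mono C) auto
      finally show "norm (Y1 \<omega>) \<le> D * (C + \<bar>\<mu> * \<delta>\<bar> * C)"
        unfolding Y1_def norm_mult by (intro mult_mono D \<omega>) (auto simp: C_nonneg D(2))
    qed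
  qed
  have b1: "integrable M (\<lambda>\<omega>. complex_of_real (?b \<omega>))"
    using integrable_of_real[OF incr_moment(1)[OF st, of 1]] by (simp del: of_real_diff)
  have b2: "integrable M (\<lambda>\<omega>. complex_of_real ((?b \<omega>)\<^sup>2))"
    using incr_moment(1)[OF st, of 2] by (simp del: of_real_power)
  have "Y \<omega> * main u \<delta> \<omega> = Y1 \<omega> * of_real (?b \<omega>) + Y2 \<omega> * of_real ((?b \<omega>)\<^sup>2) + Y3 \<omega>" for \<omega>
  proof -
    define b where "b = ?b \<omega>"
    have X: "X (u + \<delta>) \<omega> - X u \<omega> = b + \<mu> * \<delta>" by (simp add: X_def b_def algebra_simps)
    have Vh: "V (X u \<omega>) * h (X u \<omega>) = - (h2 (X u \<omega>) / 2 + of_real \<mu> * h1 (X u \<omega>))"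
      using pde[of "X u \<omega>"] by (simp add: add_eq_0_iff)
    show ?thesis
      unfolding main_def Y1_def Y2_def Y3_def X Vh b_def[symmetric]
      by (simp add: scaleR_conv_of_real power2_eq_square field_simps)
  qed
  note eq = this
  have I: "integrable M (\<lambda>\<omega>. Y1 \<omega> * of_real (?b \<omega>))" "integrable M (\<lambda>\<omega>. Y2 \<omega> * of_real ((?b \<omega>)\<^sup>2))"
    and E: "(\<integral>\<omega>. Y1 \<omega> * of_real (?b \<omega>) \<partial>M) = (\<integral>\<omega>. Y1 \<omega> \<partial>M) * (\<integral>\<omega>. of_real (?b \<omega>) \<partial>M)"
    "(\<integral>\<omega>. Y2 \<omega> * of_real ((?b \<omega>)\<^sup>2) \<partial>M) = (\<integral>\<omega>. Y2 \<omega> \<partial>M) * (\<integral>\<omega>. of_real ((?b \<omega>)\<^sup>2) \<partial>M)"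
    by (rule indep_incr_expectation[OF st Ym(1) iY1, of of_real] indep_incr_expectation[OF st Ym(2) iY2, of "\<lambda>x. of_real (x\<^sup>2)"];
        use b1 b2 in \<open>simp del: of_real_power of_real_diff\<close>)+
  show "integrable M (\<lambda>\<omega>. Y \<omega> * main u \<delta> \<omega>)"
    unfolding eq by (intro Bochner_Integration.integrable_add I iY3)
  have "(\<integral>\<omega>. Y \<omega> * main u \<delta> \<omega> \<partial>M) = (\<integral>\<omega>. Y2 \<omega> \<partial>M) * of_real \<delta> + (\<integral>\<omega>. Y3 \<omega> \<partial>M)"
    unfolding eq using I iY3 E incr_moments[OF st]
    by (simp del: of_real_diff of_real_power)
  also have "\<dots> = of_real (\<mu>\<^sup>2 * \<delta>\<^sup>2 / 2) * (\<integral>\<omega>. Y \<omega> * h2 (X u \<omega>) \<partial>M)"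
  proof -
    have "(\<integral>\<omega>. Y2 \<omega> \<partial>M) = (\<integral>\<omega>. Y \<omega> * h2 (X u \<omega>) \<partial>M) / 2"
      unfolding Y2_def by simp
    moreover have "(\<integral>\<omega>. Y3 \<omega> \<partial>M) = of_real (\<mu>\<^sup>2 * \<delta>\<^sup>2 / 2 - \<delta> / 2) * (\<integral>\<omega>. Y \<omega> * h2 (X u \<omega>) \<partial>M)"
      unfolding Y3_def by (rule integral_mult_right_zero)
    ultimately show ?thesis by (simp add: field_simps)
  qed
  also have "norm \<dots> \<le> (\<mu>\<^sup>2 * \<delta>\<^sup>2 / 2) * (D * C)"
  proof -
    have "norm (\<integral>\<omega>. Y \<omega> * h2 (X u \<omega>) \<partial>M) \<le> (\<integral>\<omega>. norm (Y \<omega> * h2 (X u \<omega>)) \<partial>M)"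
      by (rule integral_norm_bound)
    also have "\<dots> \<le> D * C"
      using i2 Yh2 by (intro integral_le_const) (auto intro!: AE_I2)
    finally have f: "norm (\<integral>\<omega>. Y \<omega> * h2 (X u \<omega>) \<partial>M) \<le> D * C" .
    show ?thesis unfolding norm_mult[of "of_real (\<mu>\<^sup>2 * \<delta>\<^sup>2 / 2)"] norm_of_real
      using f by (intro mult_mono) auto
  qed
  also have "\<dots> \<le> D * (\<mu>\<^sup>2 * \<delta>\<^sup>2 * C)"
    using D(2) C_nonneg by (simp add: field_simps)
  finally show "norm (\<integral>\<omega>. Y \<omega> * main u \<delta> \<omega> \<partial>M) \<le> D * (\<mu>\<^sup>2 * \<delta>\<^sup>2 * C)" .
qed

definition rem :: "real \<Rightarrow> real \<Rightarrow> 'a \<Rightarrow> complex" where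
  "rem u \<delta> \<omega> = h (X (u + \<delta>) \<omega>) * exp (integral {u..u+\<delta>} (\<lambda>r. V (X r \<omega>))) - h (X u \<omega>) - main u \<delta> \<omega>"

text \<open>There are four sources of error: the Taylor remainder of \<open>h\<close>, freezing
  \<open>V\<close> at the start of the step, the product of the increment of \<open>h\<close> with
  the exponent, and the quadratic remainder of the exponential function. The condition C \<delta>
  \<le> 1 keeps the exponent in the unit disc, whence the constant 3, an upper bound for e.\<close>

lemma rem_bound:
  assumes u: "0 \<le> u" and \<delta>: "0 < \<delta>" "C * \<delta> \<le> 1" and \<epsilon>: "0 < \<epsilon>" and K: "0 \<le> K"
    and mod2: "\<And>x y. norm (h2 (x + y) - h2 x) \<le> \<epsilon> + K * y\<^sup>2"
    and \<omega>: "\<omega> \<in> space M"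
  shows "norm (rem u \<delta> \<omega>) \<le> \<epsilon> * (X (u + \<delta>) \<omega> - X u \<omega>)\<^sup>2 + K * (X (u + \<delta>) \<omega> - X u \<omega>) ^ 4 +
    C * integral {u..u+\<delta>} (\<lambda>r. norm (V (X r \<omega>) - V (X u \<omega>))) +
    C * (\<epsilon> + (X (u + \<delta>) \<omega> - X u \<omega>)\<^sup>2 / \<epsilon>) * (C * \<delta>) + C * (3 * (C * \<delta>)\<^sup>2)"
proof -
  define x where "x = X u \<omega>"
  define y where "y = X (u + \<delta>) \<omega> - X u \<omega>"
  define J where "J = integral {u..u+\<delta>} (\<lambda>r. V (X r \<omega>))"
  have xy: "X (u + \<delta>) \<omega> = x + y" by (simp add: x_def y_def)
  have VX: "(\<lambda>r. V (X r \<omega>)) integrable_on {u..u+\<delta>}"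
    by (intro integrable_continuous_real comp_X_cont V_cont \<omega> u)
  have J: "norm J \<le> C * \<delta>"
    using integral_bound[of u "u + \<delta>" "\<lambda>r. V (X r \<omega>)" C] \<delta> C comp_X_cont[OF V_cont \<omega> u]
    by (simp add: J_def)
  have J1: "norm (J - \<delta> *\<^sub>R V x) \<le> integral {u..u+\<delta>} (\<lambda>r. norm (V (X r \<omega>) - V (X u \<omega>)))"
  proof -
    have "J - \<delta> *\<^sub>R V x = integral {u..u+\<delta>} (\<lambda>r. V (X r \<omega>) - V x)"
      using \<delta> VX by (subst Henstock_Kurzweil_Integration.integral_diff) (auto simp: J_def)
    also have "norm \<dots> \<le> integral {u..u+\<delta>} (\<lambda>r. norm (V (X r \<omega>) - V x))"
      using u by (intro Henstock_Kurzweil_Integration.integral_norm_bound_integral integrable_continuous_real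
        continuous_intros comp_X_cont V_cont \<omega>) auto
    finally show ?thesis by (simp add: x_def)
  qed
  have T: "norm (h (x + y) - h x - y *\<^sub>R h1 x - (y\<^sup>2 / 2) *\<^sub>R h2 x) \<le> (\<epsilon> + K * y\<^sup>2) * y\<^sup>2"
    by (rule taylor2_bound[OF dh dh1 mod2 K])
  have ex: "norm (exp J - 1 - J) \<le> 3 * (C * \<delta>)\<^sup>2"
  proof -
    have "norm (exp J - (\<Sum>i\<le>1. J ^ i / fact i)) \<le> exp (norm J) * (norm J ^ Suc 1) / fact 1"
      by (rule Taylor_exp_field)
    then have "norm (exp J - 1 - J) \<le> exp (norm J) * (norm J)\<^sup>2"
      by (simp add: power2_eq_square diff_diff_eq)
    also have "\<dots> \<le> 3 * (C * \<delta>)\<^sup>2"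
    proof (intro mult_mono power_mono J)
      have "exp (norm J) \<le> exp 1" using J \<delta> by simp
      also have "\<dots> \<le> 3" using exp_le by simp
      finally show "exp (norm J) \<le> 3" .
    qed auto
    finally show ?thesis .
  qed
  have hy: "norm (h (x + y) - h x) \<le> C * (\<epsilon> + y\<^sup>2 / \<epsilon>)"
  proof -
    \<comment> \<open>The absolute increment is traded for its square, because the second moment is
      the one that is known.\<close>
    have "\<bar>y\<bar> \<le> \<epsilon> + y\<^sup>2 / \<epsilon>"
    proof (cases "\<bar>y\<bar> \<le> \<epsilon>")
      case True
      then show ?thesis using \<epsilon> by (smt (verit) divide_nonneg_pos zero_le_power2)
    next
      case False
      then have "\<bar>y\<bar> * \<epsilon> \<le> \<bar>y\<bar> * \<bar>y\<bar>" using \<epsilon> by (intro mult_left_mono) auto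
      then have "\<bar>y\<bar> \<le> y\<^sup>2 / \<epsilon>" using \<epsilon> by (simp add: field_simps power2_eq_square)
      then show ?thesis using \<epsilon> by simp
    qed
    then have "C * \<bar>y\<bar> \<le> C * (\<epsilon> + y\<^sup>2 / \<epsilon>)" using C_nonneg by (rule mult_left_mono)
    then show ?thesis using h_lipschitz[of "x + y" x] by simp
  qed
  have "rem u \<delta> \<omega> = (h (x + y) - h x - y *\<^sub>R h1 x - (y\<^sup>2 / 2) *\<^sub>R h2 x) + h x * (J - \<delta> *\<^sub>R V x)
     + (h (x + y) - h x) * J + h (x + y) * (exp J - 1 - J)"
    unfolding rem_def main_def y_def[symmetric] x_def[symmetric] J_def[symmetric] xy
    by (simp add: scaleR_conv_of_real algebra_simps)
  also have "norm \<dots> \<le> norm (h (x + y) - h x - y *\<^sub>R h1 x - (y\<^sup>2 / 2) *\<^sub>R h2 x) + norm (h x * (J - \<delta> *\<^sub>R V x))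
     + norm ((h (x + y) - h x) * J) + norm (h (x + y) * (exp J - 1 - J))"
    by (intro norm_triangle_mono order_refl)
  also have "\<dots> \<le> (\<epsilon> + K * y\<^sup>2) * y\<^sup>2 + C * integral {u..u+\<delta>} (\<lambda>r. norm (V (X r \<omega>) - V (X u \<omega>)))
     + C * (\<epsilon> + y\<^sup>2 / \<epsilon>) * (C * \<delta>) + C * (3 * (C * \<delta>)\<^sup>2)"
    unfolding norm_mult using C_nonneg \<epsilon> by (intro add_mono mult_mono C J J1 T hy ex) auto
  also have "(\<epsilon> + K * y\<^sup>2) * y\<^sup>2 = \<epsilon> * y\<^sup>2 + K * y ^ 4"
    by (simp add: power2_eq_square power4_eq_xxxx algebra_simps)
  finally show ?thesis unfolding y_def .
qed

lemma rem_adapted: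
  assumes "0 \<le> u" "0 \<le> \<delta>" shows "rem u \<delta> \<in> borel_measurable M"
proof -
  have u: "0 \<le> u + \<delta>" using assms by simp
  note m = measurable_G_M
  have [measurable]: "(\<lambda>\<omega>. h (X (u + \<delta>) \<omega>)) \<in> borel_measurable M" "(\<lambda>\<omega>. h (X u \<omega>)) \<in> borel_measurable M"
    "(\<lambda>\<omega>. h1 (X u \<omega>)) \<in> borel_measurable M" "(\<lambda>\<omega>. h2 (X u \<omega>)) \<in> borel_measurable M"
    "(\<lambda>\<omega>. V (X u \<omega>)) \<in> borel_measurable M" "X (u + \<delta>) \<in> borel_measurable M" "X u \<in> borel_measurable M"
    "(\<lambda>\<omega>. integral {u..u+\<delta>} (\<lambda>r. V (X r \<omega>))) \<in> borel_measurable M"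
    using m[OF comp_X_adapted[OF h_cont u order_refl]] m[OF comp_X_adapted[OF h_cont assms(1) order_refl]]
      m[OF comp_X_adapted[OF h1_cont assms(1) order_refl]] m[OF comp_X_adapted[OF h2_cont assms(1) order_refl]]
      m[OF comp_X_adapted[OF V_cont assms(1) order_refl]] X_meas[OF u] X_meas[OF assms(1)]
      m[OF afun_integral_adapted[OF V_cont assms(1) order_refl, of "u + \<delta>"]]
    by simp_all
  show ?thesis unfolding rem_def main_def by measurable
qed

text \<open>The error of one step is o(\<delta>), uniformly in the starting time and in the test
  variable. This uniformity lets the errors be added over a mesh whose number of steps is of order 1
  / \<delta>.\<close>

lemma one_step:
  assumes \<epsilon>: "0 < \<epsilon>"
  shows "\<exists>\<delta>0>0. \<forall>\<delta> u Y D. 0 < \<delta> \<longrightarrow> \<delta> \<le> \<delta>0 \<longrightarrow> 0 \<le> u \<longrightarrow> Y \<in> borel_measurable (\<G> u) \<longrightarrow> 0 \<le> D \<longrightarrow>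
    (\<forall>\<omega>\<in>space M. norm (Y \<omega>) \<le> D) \<longrightarrow>
    norm (\<integral>\<omega>. Y \<omega> * (h (X (u + \<delta>) \<omega>) * exp (integral {u..u+\<delta>} (\<lambda>r. V (X r \<omega>))) - h (X u \<omega>)) \<partial>M)
      \<le> D * (\<epsilon> * \<delta>)"
proof -
  \<comment> \<open>The expected error will be e A \<delta> + L \<delta>^2: \<open>A\<close> sums
    the coefficients of e \<delta>, and \<open>L\<close>, which depends on e, sums those of
    \<delta>^2. The choice of e gives the first term half of \<epsilon> \<delta>, and
    \<open>\<delta>0\<close> is so small that the second gets at most the other half.\<close>
  define A where "A = 1 + \<mu>\<^sup>2 + C + C\<^sup>2"
  have A: "A \<ge> 1" using C_nonneg by (simp add: A_def)
  define e where "e = \<epsilon> / (2 * A)"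
  have e: "0 < e" using A \<epsilon> by (simp add: e_def)
  obtain K2 where K2: "0 \<le> K2" "\<And>x y. norm (h2 (x + y) - h2 x) \<le> e + K2 * y\<^sup>2"
    using quadratic_modulus_of_continuity[OF uc(1) C(3) e] by auto
  obtain KV where KV: "0 \<le> KV" "\<And>x y. norm (V (x + y) - V x) \<le> e + KV * y\<^sup>2"
    using quadratic_modulus_of_continuity[OF uc(2) C(4) e] by auto
  define K where "K = max K2 KV"
  have K: "0 \<le> K" using K2 by (simp add: K_def)
  have mod2: "norm (h2 (x + y) - h2 x) \<le> e + K * y\<^sup>2" for x y
    using K2(2)[of x y] mult_right_mono[of K2 K "y\<^sup>2"] by (auto simp: K_def)
  have modV: "norm (V (x + y) - V x) \<le> e + K * y\<^sup>2" for x y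
    using KV(2)[of x y] mult_right_mono[of KV K "y\<^sup>2"] by (auto simp: K_def)
  define L where "L = \<mu>\<^sup>2 * C + 8 * K * (3 + \<mu> ^ 4) + C * K * (1 + \<mu>\<^sup>2) + C\<^sup>2 * (1 + \<mu>\<^sup>2) / e + 3 * C ^ 3"
  have L: "0 \<le> L" using C_nonneg K e unfolding L_def by (intro add_nonneg_nonneg mult_nonneg_nonneg divide_nonneg_pos) auto
  define \<delta>0 where "\<delta>0 = min 1 (min (1 / (C + 1)) (\<epsilon> / (2 * (L + 1))))"
  have d0: "\<delta>0 > 0" using C_nonneg L \<epsilon> by (simp add: \<delta>0_def)
  show ?thesis
  proof (intro exI[of _ \<delta>0] conjI d0 allI impI)
    fix \<delta> u D :: real and Y :: "'a \<Rightarrow> complex"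
    assume \<delta>: "0 < \<delta>" "\<delta> \<le> \<delta>0" and u: "0 \<le> u" and Y: "Y \<in> borel_measurable (\<G> u)" and D0: "0 \<le> D"
      and "\<forall>\<omega>\<in>space M. norm (Y \<omega>) \<le> D"
    then have D: "norm (Y \<omega>) \<le> D" if "\<omega> \<in> space M" for \<omega> using that by auto
    have \<delta>1: "\<delta> \<le> 1" and "\<delta> \<le> 1 / (C + 1)" and \<delta>3: "\<delta> \<le> \<epsilon> / (2 * (L + 1))"
      using \<delta> by (auto simp: \<delta>0_def)
    then have "\<delta> * (C + 1) \<le> 1" using C_nonneg by (simp add: field_simps)
    then have C\<delta>: "C * \<delta> \<le> 1" using \<delta> by (simp add: algebra_simps)
    have "\<delta> * (2 * (L + 1)) \<le> \<epsilon>" using \<delta>3 L by (simp add: field_simps)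
    then have L\<delta>: "L * \<delta> \<le> \<epsilon> / 2" using \<delta> by (simp add: algebra_simps)
    let ?d = "\<lambda>\<omega>. X (u + \<delta>) \<omega> - X u \<omega>"
    let ?J = "\<lambda>\<omega>. integral {u..u+\<delta>} (\<lambda>r. norm (V (X r \<omega>) - V (X u \<omega>)))"
    define W where "W \<omega> = e * (?d \<omega>)\<^sup>2 + K * (?d \<omega>) ^ 4 + C * ?J \<omega> +
      C * (e + (?d \<omega>)\<^sup>2 / e) * (C * \<delta>) + C * (3 * (C * \<delta>)\<^sup>2)" for \<omega>
    have rW: "norm (rem u \<delta> \<omega>) \<le> W \<omega>" if "\<omega> \<in> space M" for \<omega>
      unfolding W_def by (rule rem_bound[OF u \<delta>(1) C\<delta> e K mod2 that])
    have m2: "(\<integral>\<omega>. (X r \<omega> - X u \<omega>)\<^sup>2 \<partial>M) \<le> (1 + \<mu>\<^sup>2) * \<delta>" if "u \<le> r" "r \<le> u + \<delta>" for r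
    proof -
      have "(r - u) + \<mu>\<^sup>2 * (r - u)\<^sup>2 \<le> \<delta> + \<mu>\<^sup>2 * \<delta>\<^sup>2"
        using that by (intro add_mono mult_left_mono power_mono) auto
      also have "\<delta>\<^sup>2 \<le> \<delta>" using \<delta> \<delta>1 by (simp add: power2_eq_square mult_left_le)
      then have "\<delta> + \<mu>\<^sup>2 * \<delta>\<^sup>2 \<le> (1 + \<mu>\<^sup>2) * \<delta>"
        using mult_left_mono[of "\<delta>\<^sup>2" \<delta> "\<mu>\<^sup>2"] by (simp add: algebra_simps)
      finally show ?thesis using incr_X_moments(3)[OF u that(1)] by simp
    qed
    have m4: "(\<integral>\<omega>. (?d \<omega>) ^ 4 \<partial>M) \<le> 8 * (3 + \<mu> ^ 4) * \<delta>\<^sup>2"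
    proof -
      have "\<delta> ^ 4 \<le> \<delta>\<^sup>2" using \<delta> \<delta>1 by (intro power_decreasing) auto
      then have "8 * (3 * \<delta>\<^sup>2 + \<mu> ^ 4 * \<delta> ^ 4) \<le> 8 * (3 + \<mu> ^ 4) * \<delta>\<^sup>2"
        using mult_left_mono[of "\<delta> ^ 4" "\<delta>\<^sup>2" "\<mu> ^ 4"] by (simp add: algebra_simps)
      then show ?thesis using incr_X_moments(4)[OF u, of "u + \<delta>"] \<delta> by simp
    qed
    note i = incr_X_moments(1,2)[OF u, of "u + \<delta>"]
    have JE: "integrable M ?J" "(\<integral>\<omega>. ?J \<omega> \<partial>M) \<le> (e + K * ((1 + \<mu>\<^sup>2) * \<delta>)) * \<delta>"
    proof -
      have m: "(\<lambda>\<omega>. norm (V (X r \<omega>) - V (X u \<omega>))) \<in> borel_measurable M" if "u \<le> r" for r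
        using measurable_G_M[OF comp_X_adapted[OF V_cont u order_refl]]
          measurable_G_M[OF comp_X_adapted[OF V_cont order_trans[OF u that] order_refl]] by measurable
        have le: "norm (V (X r \<omega>) - V (X u \<omega>)) \<le> 2 * C" for r \<omega>
          using C(4)[of "X r \<omega>"] C(4)[of "X u \<omega>"] norm_triangle_ineq4[of "V (X r \<omega>)" "V (X u \<omega>)"] by linarith
      have E: "(\<integral>\<omega>. norm (V (X r \<omega>) - V (X u \<omega>)) \<partial>M) \<le> e + K * ((1 + \<mu>\<^sup>2) * \<delta>)"
        if r: "u \<le> r" "r \<le> u + \<delta>" for r
      proof -
        have "(\<integral>\<omega>. norm (V (X r \<omega>) - V (X u \<omega>)) \<partial>M) \<le> (\<integral>\<omega>. e + K * (X r \<omega> - X u \<omega>)\<^sup>2 \<partial>M)"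
        proof (rule integral_mono)
          show "integrable M (\<lambda>\<omega>. norm (V (X r \<omega>) - V (X u \<omega>)))"
            using m[OF r(1)] le by (intro integrable_const_bound[of _ "2 * C"]) auto
          show "integrable M (\<lambda>\<omega>. e + K * (X r \<omega> - X u \<omega>)\<^sup>2)"
            using incr_X_moments(1)[OF u r(1)] by simp
          show "norm (V (X r \<omega>) - V (X u \<omega>)) \<le> e + K * (X r \<omega> - X u \<omega>)\<^sup>2" for \<omega>
            using modV[of "X u \<omega>" "X r \<omega> - X u \<omega>"] by simp
        qed
        also have "\<dots> = e + K * (\<integral>\<omega>. (X r \<omega> - X u \<omega>)\<^sup>2 \<partial>M)"
          using incr_X_moments(1)[OF u r(1)] by (simp add: prob_space)
        also have "\<dots> \<le> e + K * ((1 + \<mu>\<^sup>2) * \<delta>)"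
          using m2[OF r] K by (intro add_left_mono mult_left_mono)
        finally show "(\<integral>\<omega>. norm (V (X r \<omega>) - V (X u \<omega>)) \<partial>M) \<le> e + K * ((1 + \<mu>\<^sup>2) * \<delta>)" .
      qed
      have cont: "continuous_on {u..u+\<delta>} (\<lambda>r. norm (V (X r \<omega>) - V (X u \<omega>)))" if "\<omega> \<in> space M" for \<omega>
        by (intro continuous_intros comp_X_cont V_cont that u)
      note * = expectation_integral_le[of u "u + \<delta>" "\<lambda>r \<omega>. norm (V (X r \<omega>) - V (X u \<omega>))" "2 * C",
        OF _ m cont _ E]
      show "integrable M ?J" "(\<integral>\<omega>. ?J \<omega> \<partial>M) \<le> (e + K * ((1 + \<mu>\<^sup>2) * \<delta>)) * \<delta>"
        using *(1) *(2) le \<delta> by auto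
    qed
    have Wi: "integrable M W"
      unfolding W_def using i \<delta> JE(1) by simp
    have "(\<integral>\<omega>. W \<omega> \<partial>M) = e * (\<integral>\<omega>. (?d \<omega>)\<^sup>2 \<partial>M) + K * (\<integral>\<omega>. (?d \<omega>) ^ 4 \<partial>M) + C * (\<integral>\<omega>. ?J \<omega> \<partial>M) +
      C * (e + (\<integral>\<omega>. (?d \<omega>)\<^sup>2 \<partial>M) / e) * (C * \<delta>) + C * (3 * (C * \<delta>)\<^sup>2)"
      unfolding W_def using i \<delta> JE(1) by (simp add: prob_space)
    also have "\<dots> \<le> e * ((1 + \<mu>\<^sup>2) * \<delta>) + K * (8 * (3 + \<mu> ^ 4) * \<delta>\<^sup>2) + C * ((e + K * ((1 + \<mu>\<^sup>2) * \<delta>)) * \<delta>) +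
      C * (e + ((1 + \<mu>\<^sup>2) * \<delta>) / e) * (C * \<delta>) + C * (3 * (C * \<delta>)\<^sup>2)"
      using \<delta> m2[of "u + \<delta>"] m4 JE(2) e K C_nonneg
      by (intro add_mono mult_left_mono mult_right_mono divide_right_mono order_refl) auto
    finally have EW: "(\<integral>\<omega>. W \<omega> \<partial>M) + \<mu>\<^sup>2 * \<delta>\<^sup>2 * C \<le> e * A * \<delta> + L * \<delta>\<^sup>2"
      unfolding A_def L_def by (simp add: algebra_simps power2_eq_square power3_eq_cube add_divide_distrib)
    have Yi: "integrable M (\<lambda>\<omega>. Y \<omega> * rem u \<delta> \<omega>)"
    proof (rule Bochner_Integration.integrable_bound[where f="\<lambda>\<omega>. D * W \<omega>"])
      show "(\<lambda>\<omega>. Y \<omega> * rem u \<delta> \<omega>) \<in> borel_measurable M"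
        using rem_adapted[OF u, of \<delta>] measurable_G_M[OF Y] \<delta> by simp
      show "AE \<omega> in M. norm (Y \<omega> * rem u \<delta> \<omega>) \<le> norm (D * W \<omega>)"
      proof (intro AE_I2)
        fix \<omega> assume \<omega>: "\<omega> \<in> space M"
        have "norm (Y \<omega> * rem u \<delta> \<omega>) \<le> D * W \<omega>"
          unfolding norm_mult by (intro mult_mono D rW \<omega> D0) auto
        then show "norm (Y \<omega> * rem u \<delta> \<omega>) \<le> norm (D * W \<omega>)" by simp
      qed
    qed (use Wi in simp)
    have Yr: "norm (\<integral>\<omega>. Y \<omega> * rem u \<delta> \<omega> \<partial>M) \<le> D * (\<integral>\<omega>. W \<omega> \<partial>M)"
    proof -
      have "norm (\<integral>\<omega>. Y \<omega> * rem u \<delta> \<omega> \<partial>M) \<le> (\<integral>\<omega>. norm (Y \<omega> * rem u \<delta> \<omega>) \<partial>M)"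
        by (rule integral_norm_bound)
      also have "\<dots> \<le> (\<integral>\<omega>. D * W \<omega> \<partial>M)"
      proof (rule integral_mono[OF integrable_norm[OF Yi]])
        show "norm (Y \<omega> * rem u \<delta> \<omega>) \<le> D * W \<omega>" if "\<omega> \<in> space M" for \<omega>
          unfolding norm_mult using that by (intro mult_mono D rW D0) auto
      qed (use Wi in simp)
      finally show ?thesis by simp
    qed
    note main = main_expectation[OF u \<delta>(1) Y D D0]
    have "(\<integral>\<omega>. Y \<omega> * (h (X (u + \<delta>) \<omega>) * exp (integral {u..u+\<delta>} (\<lambda>r. V (X r \<omega>))) - h (X u \<omega>)) \<partial>M)
      = (\<integral>\<omega>. Y \<omega> * main u \<delta> \<omega> + Y \<omega> * rem u \<delta> \<omega> \<partial>M)"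
      by (intro Bochner_Integration.integral_cong) (auto simp: rem_def algebra_simps)
    also have "\<dots> = (\<integral>\<omega>. Y \<omega> * main u \<delta> \<omega> \<partial>M) + (\<integral>\<omega>. Y \<omega> * rem u \<delta> \<omega> \<partial>M)"
      by (rule Bochner_Integration.integral_add[OF main(1) Yi])
    also have "norm \<dots> \<le> D * (\<mu>\<^sup>2 * \<delta>\<^sup>2 * C) + D * (\<integral>\<omega>. W \<omega> \<partial>M)"
      by (intro norm_triangle_mono main Yr)
    also have "\<dots> = D * ((\<integral>\<omega>. W \<omega> \<partial>M) + \<mu>\<^sup>2 * \<delta>\<^sup>2 * C)" by (simp add: algebra_simps)
    also have "\<dots> \<le> D * (\<epsilon> * \<delta>)"
    proof (rule mult_left_mono[OF _ D0])
      have "L * \<delta>\<^sup>2 \<le> \<epsilon> / 2 * \<delta>"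
        using mult_right_mono[OF L\<delta>, of \<delta>] \<delta> by (simp add: power2_eq_square mult.assoc)
      moreover have "e * A * \<delta> = \<epsilon> / 2 * \<delta>" using A by (simp add: e_def)
      ultimately show "(\<integral>\<omega>. W \<omega> \<partial>M) + \<mu>\<^sup>2 * \<delta>\<^sup>2 * C \<le> \<epsilon> * \<delta>"
        using EW by linarith
    qed
    finally show "norm (\<integral>\<omega>. Y \<omega> * (h (X (u + \<delta>) \<omega>) * exp (integral {u..u+\<delta>} (\<lambda>r. V (X r \<omega>))) - h (X u \<omega>)) \<partial>M)
      \<le> D * (\<epsilon> * \<delta>)" .
  qed
qed

text \<open>Summing \<open>one_step\<close> over a mesh of width \<open>(t - s) / n\<close> bounds the difference of the two sides by a
  multiple of \<open>\<epsilon> (t - s)\<close>.\<close>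

theorem feynman_kac_martingale:
  assumes st: "0 \<le> s" "s \<le> t" and Y: "Y \<in> borel_measurable (\<G> s)"
    and D: "\<And>\<omega>. \<omega> \<in> space M \<Longrightarrow> norm (Y \<omega>) \<le> D"
  shows "(\<integral>\<omega>. Y \<omega> * (h (X s \<omega>) * exp (afun V s \<omega>)) \<partial>M) = (\<integral>\<omega>. Y \<omega> * (h (X t \<omega>) * exp (afun V t \<omega>)) \<partial>M)"
proof (cases "s = t")
  case False
  with st have lt: "s < t" by simp
  have D0: "0 \<le> D"
    using not_empty D norm_ge_zero order_trans by blast
  let ?E = "\<lambda>u \<omega>. h (X u \<omega>) * exp (afun V u \<omega>)"
  have aV: "norm (exp (afun V u \<omega>)) \<le> exp (C * t)" if "\<omega> \<in> space M" "0 \<le> u" "u \<le> t" for u \<omega>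
  proof -
    have "Re (afun V u \<omega>) \<le> norm (afun V u \<omega>)" by (rule complex_Re_le_cmod)
    also have "\<dots> \<le> C * (u - 0)"
      unfolding afun_def using that C by (intro integral_bound comp_X_cont V_cont) auto
    also have "\<dots> \<le> C * t" using that C_nonneg by (simp add: mult_left_mono)
    finally show ?thesis by simp
  qed
  have Em: "(\<lambda>\<omega>. Y \<omega> * ?E u \<omega>) \<in> borel_measurable M" if "0 \<le> u" for u
    using measurable_G_M[OF Y] measurable_G_M[OF afun_adapted[OF V_cont that]]
      measurable_G_M[OF comp_X_adapted[OF h_cont that order_refl]] by measurable
  have Ei: "integrable M (\<lambda>\<omega>. Y \<omega> * ?E u \<omega>)" if "0 \<le> u" "u \<le> t" for u
  proof (rule integrable_const_bound[of _ "D * (C * exp (C * t))"])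
    show "AE \<omega> in M. norm (Y \<omega> * ?E u \<omega>) \<le> D * (C * exp (C * t))"
      unfolding norm_mult using that C_nonneg D0 by (intro AE_I2 mult_mono D C aV) auto
  qed (rule Em[OF that(1)])
  have small: "norm ((\<integral>\<omega>. Y \<omega> * ?E t \<omega> \<partial>M) - (\<integral>\<omega>. Y \<omega> * ?E s \<omega> \<partial>M)) \<le> D * exp (C * t) * (t - s) * \<epsilon>"
    if \<epsilon>: "0 < \<epsilon>" for \<epsilon>
  proof -
    obtain \<delta>0 where \<delta>0: "\<delta>0 > 0" and step: "\<And>\<delta> u Y D. 0 < \<delta> \<Longrightarrow> \<delta> \<le> \<delta>0 \<Longrightarrow> 0 \<le> u \<Longrightarrow> Y \<in> borel_measurable (\<G> u) \<Longrightarrow> 0 \<le> D \<Longrightarrow>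
      (\<forall>\<omega>\<in>space M. norm (Y \<omega>) \<le> D) \<Longrightarrow>
      norm (\<integral>\<omega>. Y \<omega> * (h (X (u + \<delta>) \<omega>) * exp (integral {u..u+\<delta>} (\<lambda>r. V (X r \<omega>))) - h (X u \<omega>)) \<partial>M)
        \<le> D * (\<epsilon> * \<delta>)"
      using one_step[OF \<epsilon>] by blast
    obtain n :: nat where n: "(t - s) / \<delta>0 < real n" using reals_Archimedean2 by blast
    then have n0: "0 < real n" using lt \<delta>0 by (smt (verit) divide_pos_pos)
    define \<delta> where "\<delta> = (t - s) / real n"
    have \<delta>: "0 < \<delta>" "\<delta> \<le> \<delta>0" using n n0 lt \<delta>0 by (auto simp: \<delta>_def field_simps)
    have n\<delta>: "real n * \<delta> = t - s" using n0 by (simp add: \<delta>_def)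
    define g where "g k = (\<integral>\<omega>. Y \<omega> * ?E (s + real k * \<delta>) \<omega> \<partial>M)" for k :: nat
    have "norm (g k - g 0) \<le> real k * (D * exp (C * t) * (\<epsilon> * \<delta>))" if "k \<le> n" for k
      using that
    proof (induction k)
      case (Suc k)
      define u where "u = s + real k * \<delta>"
      have u0: "0 \<le> u" and su: "s \<le> u" using st \<delta> by (auto simp: u_def)
      have "real (Suc k) * \<delta> \<le> real n * \<delta>" using Suc.prems \<delta> by (intro mult_right_mono) auto
      then have ut: "u + \<delta> \<le> t" using n\<delta> by (simp add: u_def algebra_simps)
      \<comment> \<open>The exponential accumulated so far belongs to the past, so it joins the test
        variable. Each mesh step is then an instance of the same estimate, with the single bound D
        exp (C t).\<close>
      define Y' where "Y' \<omega> = Y \<omega> * exp (afun V u \<omega>)" for \<omega>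
      have Y'm: "Y' \<in> borel_measurable (\<G> u)"
        using measurable_G_mono[OF Y su] afun_adapted[OF V_cont u0] unfolding Y'_def by measurable
      have Y'b: "\<forall>\<omega>\<in>space M. norm (Y' \<omega>) \<le> D * exp (C * t)"
        unfolding Y'_def norm_mult using u0 ut \<delta> D0 by (intro ballI mult_mono D aV) auto
      have "g (Suc k) - g k = (\<integral>\<omega>. Y \<omega> * ?E (u + \<delta>) \<omega> - Y \<omega> * ?E u \<omega> \<partial>M)"
        using Ei[of "u + \<delta>"] Ei[of u] u0 ut \<delta>
        by (subst Bochner_Integration.integral_diff) (auto simp: g_def u_def algebra_simps)
      also have "\<dots> = (\<integral>\<omega>. Y' \<omega> * (h (X (u + \<delta>) \<omega>) * exp (integral {u..u+\<delta>} (\<lambda>r. V (X r \<omega>))) - h (X u \<omega>)) \<partial>M)"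
      proof (intro Bochner_Integration.integral_cong refl)
        fix \<omega> assume \<omega>: "\<omega> \<in> space M"
        have "afun V (u + \<delta>) \<omega> = afun V u \<omega> + integral {u..u+\<delta>} (\<lambda>r. V (X r \<omega>))"
          using afun_diff[OF V_cont \<omega> u0, of "u + \<delta>"] \<delta> by (simp add: algebra_simps)
        then show "Y \<omega> * ?E (u + \<delta>) \<omega> - Y \<omega> * ?E u \<omega> =
          Y' \<omega> * (h (X (u + \<delta>) \<omega>) * exp (integral {u..u+\<delta>} (\<lambda>r. V (X r \<omega>))) - h (X u \<omega>))"
          by (simp add: Y'_def exp_add algebra_simps)
      qed
      also have "norm \<dots> \<le> D * exp (C * t) * (\<epsilon> * \<delta>)"
        using \<delta> u0 Y'm Y'b D0 by (intro step) auto
      finally have "norm (g (Suc k) - g k) \<le> D * exp (C * t) * (\<epsilon> * \<delta>)" .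
      moreover have "norm (g k - g 0) \<le> real k * (D * exp (C * t) * (\<epsilon> * \<delta>))"
        using Suc by simp
      ultimately have "norm ((g (Suc k) - g k) + (g k - g 0)) \<le>
        D * exp (C * t) * (\<epsilon> * \<delta>) + real k * (D * exp (C * t) * (\<epsilon> * \<delta>))"
        by (rule norm_triangle_mono)
      then show ?case by (simp add: algebra_simps)
    qed simp
    from this[of n] have "norm (g n - g 0) \<le> D * exp (C * t) * ((real n * \<delta>) * \<epsilon>)" by (simp add: algebra_simps)
    then show ?thesis unfolding n\<delta> g_def by (simp add: n\<delta> mult.assoc)
  qed
  have "norm ((\<integral>\<omega>. Y \<omega> * ?E t \<omega> \<partial>M) - (\<integral>\<omega>. Y \<omega> * ?E s \<omega> \<partial>M)) \<le> 0"
  proof (rule field_le_epsilon)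
    fix \<epsilon> :: real assume \<epsilon>: "0 < \<epsilon>"
    define c where "c = D * exp (C * t) * (t - s)"
    have c: "0 \<le> c" using D0 lt by (simp add: c_def)
    have "c * (\<epsilon> / (c + 1)) \<le> \<epsilon>" using c \<epsilon> by (simp add: field_simps)
    then show "norm ((\<integral>\<omega>. Y \<omega> * ?E t \<omega> \<partial>M) - (\<integral>\<omega>. Y \<omega> * ?E s \<omega> \<partial>M)) \<le> 0 + \<epsilon>"
      using small[of "\<epsilon> / (c + 1)"] c \<epsilon> unfolding c_def by auto
  qed
  then show ?thesis by simp
qed simp

end

end

section \<open>Localisation\<close>

text \<open>Bounded uniformly continuous functions: the regularity that the Feynman--Kac martingale
  asks of \<open>h2\<close> and \<open>V\<close>, and a class closed under the sums and products
  from which these are formed.\<close>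

definition buc :: "(real \<Rightarrow> 'b::real_normed_vector) \<Rightarrow> bool" where
  "buc g \<longleftrightarrow> uniformly_continuous_on UNIV g \<and> (\<exists>C. \<forall>x. norm (g x) \<le> C)"

lemma buc_const: "buc (\<lambda>_. c)"
  unfolding buc_def by (auto intro: uniformly_continuous_on_const)

lemma buc_add: "buc f \<Longrightarrow> buc g \<Longrightarrow> buc (\<lambda>x. f x + g x)"
  unfolding buc_def by (blast intro: uniformly_continuous_on_add norm_triangle_mono)

lemma buc_mult:
  fixes f g :: "real \<Rightarrow> 'b::real_normed_algebra"
  assumes "buc f" "buc g" shows "buc (\<lambda>x. f x * g x)"
proof -
  obtain C D where C: "\<And>x. norm (f x) \<le> C" and D: "\<And>x. norm (g x) \<le> D"
    using assms by (auto simp: buc_def)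
  have C0: "0 \<le> C" using C[of 0] norm_ge_zero order_trans by blast
  have "norm (f x * g x) \<le> C * D" for x
    using norm_mult_ineq mult_mono[OF C D C0] by (meson norm_ge_zero order_trans)
  moreover have "uniformly_continuous_on UNIV (\<lambda>x. f x * g x)"
    unfolding uniformly_continuous_on_sequentially
  proof (intro allI impI)
    fix x y :: "nat \<Rightarrow> real"
    assume xy: "(\<forall>n. x n \<in> UNIV) \<and> (\<forall>n. y n \<in> UNIV) \<and> (\<lambda>n. dist (x n) (y n)) \<longlonglongrightarrow> 0"
    have f: "(\<lambda>n. dist (f (x n)) (f (y n))) \<longlonglongrightarrow> 0" and g: "(\<lambda>n. dist (g (x n)) (g (y n))) \<longlonglongrightarrow> 0"
      using assms xy unfolding buc_def uniformly_continuous_on_sequentially by auto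
    have "(\<lambda>n. C * dist (g (x n)) (g (y n)) + dist (f (x n)) (f (y n)) * D) \<longlonglongrightarrow> C * 0 + 0 * D"
      by (intro tendsto_intros f g)
    then have lim: "(\<lambda>n. C * dist (g (x n)) (g (y n)) + dist (f (x n)) (f (y n)) * D) \<longlonglongrightarrow> 0" by simp
    have "dist (f (x n) * g (x n)) (f (y n) * g (y n)) \<le> C * dist (g (x n)) (g (y n)) + dist (f (x n)) (f (y n)) * D" for n
    proof -
      have "f (x n) * g (x n) - f (y n) * g (y n) = f (x n) * (g (x n) - g (y n)) + (f (x n) - f (y n)) * g (y n)"
        by (simp add: algebra_simps)
      also have "norm \<dots> \<le> norm (f (x n)) * norm (g (x n) - g (y n)) + norm (f (x n) - f (y n)) * norm (g (y n))"
        by (intro norm_triangle_mono norm_mult_ineq)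
      also have "\<dots> \<le> C * norm (g (x n) - g (y n)) + norm (f (x n) - f (y n)) * D"
        by (intro add_mono mult_right_mono mult_left_mono C D) auto
      finally show ?thesis by (simp add: dist_norm)
    qed
    then show "(\<lambda>n. dist (f (x n) * g (x n)) (f (y n) * g (y n))) \<longlonglongrightarrow> 0"
      by (intro tendsto_sandwich[OF _ _ tendsto_const lim]) auto
  qed
  ultimately show ?thesis unfolding buc_def by auto
qed

lemma buc_of_real:
  assumes "buc g" shows "buc (\<lambda>x. complex_of_real (g x))"
proof -
  obtain C where "\<And>x. norm (g x) \<le> C" using assms by (auto simp: buc_def)
  then show ?thesis
    using assms bounded_linear.uniformly_continuous_on[OF bounded_linear_of_real]
    unfolding buc_def by (auto intro!: exI[of _ C])
qed

text \<open>A function that is constant on both sides of [a, b] factors through the 1-Lipschitz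
  projection to [a, b], where compactness gives boundedness and uniform continuity.\<close>

lemma buc_clamp:
  fixes g :: "real \<Rightarrow> 'b::real_normed_vector"
  assumes "a \<le> b" "continuous_on {a..b} g" and g: "\<And>x. g x = g (min b (max a x))"
  shows "buc g"
proof -
  have uc: "uniformly_continuous_on {a..b} g"
    by (intro compact_uniformly_continuous assms) auto
  have "1-lipschitz_on UNIV (\<lambda>x. min b (max a x))"
    by (rule lipschitz_onI) (auto simp: dist_real_def min_def max_def abs_if)
  then have "uniformly_continuous_on UNIV (\<lambda>x. min b (max a x))"
    by (rule lipschitz_on_uniformly_continuous)
  then have "uniformly_continuous_on UNIV (\<lambda>x. g (min b (max a x)))"
  proof (rule uniformly_continuous_on_compose)
    show "uniformly_continuous_on (range (\<lambda>x. min b (max a x))) g"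
      unfolding uniformly_continuous_on_def
    proof (intro allI impI)
      fix e :: real assume "0 < e"
      with uc obtain d where "d > 0" "\<And>x x'. x \<in> {a..b} \<Longrightarrow> x' \<in> {a..b} \<Longrightarrow> dist x' x < d \<Longrightarrow> dist (g x') (g x) < e"
        unfolding uniformly_continuous_on_def by meson
      then show "\<exists>d>0. \<forall>x\<in>range (\<lambda>x. min b (max a x)). \<forall>x'\<in>range (\<lambda>x. min b (max a x)).
        dist x' x < d \<longrightarrow> dist (g x') (g x) < e"
        using assms(1) by (intro exI[of _ d]) auto
    qed
  qed
  moreover have "(\<lambda>x. g (min b (max a x))) = g" using g by (auto simp: fun_eq_iff)
  moreover have "bounded (g ` {a..b})"
    by (intro compact_imp_bounded compact_continuous_image assms) auto
  then obtain C where "\<forall>x\<in>{a..b}. norm (g x) \<le> C"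
    by (auto simp: bounded_iff)
  then have C: "norm (g x) \<le> C" if "x \<in> {a..b}" for x
    using that by blast
  have "norm (g x) \<le> C" for x
    using C[of "min b (max a x)"] g[of x] assms(1) by auto
  ultimately show ?thesis unfolding buc_def by auto
qed

lemma real_antiderivative:
  fixes g :: "real \<Rightarrow> real"
  assumes "continuous_on UNIV g"
  shows "\<exists>F. (\<forall>x. (F has_real_derivative g x) (at x)) \<and> F c = y"
proof -
  have "\<exists>F. \<forall>x::real. - \<infinity> < ereal x \<longrightarrow> ereal x < \<infinity> \<longrightarrow> (F has_vector_derivative g x) (at x)"
    using assms by (intro einterval_antiderivative) (auto simp: continuous_on_eq_continuous_at)
  then obtain F where F: "\<And>x. (F has_real_derivative g x) (at x)"
    by (auto simp: has_real_derivative_iff_has_vector_derivative)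
  show ?thesis
    by (rule exI[of _ "\<lambda>x. F x - F c + y"]) (auto intro!: derivative_eq_intros F)
qed

lemma zero_deriv_eq:
  fixes D :: "real \<Rightarrow> real"
  assumes "\<And>x. x \<in> {a..b} \<Longrightarrow> (D has_real_derivative 0) (at x)" "x \<in> {a..b}" "y \<in> {a..b}"
  shows "D x = D y"
proof -
  have "\<exists>c. \<forall>x\<in>{a..b}. D x = c"
    using assms(1) by (intro has_field_derivative_zero_constant)
      (auto intro: has_field_derivative_at_within)
  then show ?thesis using assms(2,3) by auto
qed

text \<open>The cutoff is applied to the second derivative, which is then integrated twice;
  multiplying \<open>f\<close> itself would bring in derivatives of the cutoff. Outside
  [-n - 1, n + 1] the new \<open>F2\<close> vanishes and \<open>F1\<close> is constant.
  \<open>F\<close> may grow linearly, which is harmless since it enters only through exp (\<i>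
  F).\<close>

lemma compact_cutoff:
  fixes f f' f'' :: "real \<Rightarrow> real" and n :: real
  assumes n: "0 \<le> n"
    and f': "\<And>x. (f has_real_derivative f' x) (at x)"
    and f'': "\<And>x. (f' has_real_derivative f'' x) (at x)"
    and cont: "continuous_on UNIV f''"
  obtains F F1 F2 where "\<And>x. (F has_real_derivative F1 x) (at x)"
    "\<And>x. (F1 has_real_derivative F2 x) (at x)" "buc F1" "buc F2"
    "\<And>x. \<bar>x\<bar> \<le> n \<Longrightarrow> F x = f x \<and> F1 x = f' x \<and> F2 x = f'' x"
proof -
  define m where "m = n + 1"
  define F2 where "F2 x = max 0 (min 1 (m - \<bar>x\<bar>)) * f'' x" for x
  have F2c: "continuous_on UNIV F2"
    unfolding F2_def by (intro continuous_intros cont)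
  obtain F1 where F1: "\<And>x. (F1 has_real_derivative F2 x) (at x)" "F1 0 = f' 0"
    using real_antiderivative[OF F2c, of 0 "f' 0"] by blast
  have F1c: "continuous_on UNIV F1"
    using F1(1) by (meson DERIV_continuous_on has_field_derivative_at_within)
  obtain F where F: "\<And>x. (F has_real_derivative F1 x) (at x)" "F 0 = f 0"
    using real_antiderivative[OF F1c, of 0 "f 0"] by blast
  have m: "- m \<le> m" using n by (simp add: m_def)
  have F2_0: "F2 x = 0" if "m \<le> \<bar>x\<bar>" for x using that by (simp add: F2_def)
  have F1_flat: "(F1 has_real_derivative 0) (at z)" if "m \<le> \<bar>z\<bar>" for z
    using F1(1)[of z] F2_0[OF that] by simp
  have F2_clamp: "F2 x = F2 (min m (max (- m) x))" for x
    using F2_0[of x] F2_0[of m] F2_0[of "- m"] n by (auto simp: min_def max_def m_def)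
  have F1_clamp: "F1 x = F1 (min m (max (- m) x))" for x
  proof -
    consider "x < - m" | "\<bar>x\<bar> \<le> m" | "m < x" by linarith
    then show ?thesis
    proof cases
      case 1
      have "F1 x = F1 (- m)"
        by (rule zero_deriv_eq[of x "- m" F1]) (use 1 in \<open>auto intro!: F1_flat\<close>)
      then show ?thesis using 1 m by simp
    next
      case 3
      have "F1 x = F1 m"
        by (rule zero_deriv_eq[of m x F1]) (use 3 in \<open>auto intro!: F1_flat\<close>)
      then show ?thesis using 3 m by simp
    qed auto
  qed
  have e2: "F2 x = f'' x" if "\<bar>x\<bar> \<le> n" for x using that by (simp add: F2_def m_def)
  have e1: "F1 x = f' x" if "\<bar>x\<bar> \<le> n" for x
  proof -
    have "F1 x - f' x = F1 0 - f' 0"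
    proof (rule zero_deriv_eq[of "-n" n "\<lambda>x. F1 x - f' x"])
      fix z assume "z \<in> {- n..n}"
      then have "F2 z - f'' z = 0" using e2[of z] by auto
      then show "((\<lambda>x. F1 x - f' x) has_real_derivative 0) (at z)"
        using DERIV_diff[OF F1(1) f''] by metis
    qed (use that n in auto)
    then show ?thesis using F1(2) by simp
  qed
  have e0: "F x = f x" if "\<bar>x\<bar> \<le> n" for x
  proof -
    have "F x - f x = F 0 - f 0"
    proof (rule zero_deriv_eq[of "-n" n "\<lambda>x. F x - f x"])
      fix z assume "z \<in> {- n..n}"
      then have "F1 z - f' z = 0" using e1[of z] by auto
      then show "((\<lambda>x. F x - f x) has_real_derivative 0) (at z)"
        using DERIV_diff[OF F(1) f'] by metis
    qed (use that n in auto)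
    then show ?thesis using F(2) by simp
  qed
  show thesis
    by (rule that[OF F(1) F1(1)])
       (use buc_clamp[OF m continuous_on_subset[OF F1c] F1_clamp]
          buc_clamp[OF m continuous_on_subset[OF F2c] F2_clamp] e0 e1 e2 in auto)
qed

section \<open>The Ito decomposition of f(X) and its exponential martingale\<close>

context brownian_filtration
begin

context
  fixes f f' f'' :: "real \<Rightarrow> real"
  assumes f': "\<And>x. (f has_real_derivative f' x) (at x)"
    and f'': "\<And>x. (f' has_real_derivative f'' x) (at x)"
    and cont_f'': "continuous_on UNIV f''"
begin

text \<open>The generator of \<open>X\<close> applied to \<open>f\<close>.\<close>

definition drift :: "real \<Rightarrow> real" where "drift x = f'' x / 2 + \<mu> * f' x"

text \<open>The local martingale in Ito's formula for f(X), that is, the stochastic integral of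
  f'(X) against \<open>B\<close>, written as what is left over after subtracting the drift. Its
  quadratic variation is \<open>qvar\<close>, which is also the clock.\<close>

definition mart :: "real \<Rightarrow> 'a \<Rightarrow> real" where
  "mart s \<omega> = f (X s \<omega>) - f 0 - afun drift s \<omega>"

definition qvar :: "real \<Rightarrow> 'a \<Rightarrow> real" where
  "qvar s \<omega> = afun (\<lambda>x. (f' x)\<^sup>2) s \<omega>"

lemma f_cont: "continuous_on UNIV f" and f'_cont: "continuous_on UNIV f'"
  using f' f'' by (meson DERIV_continuous_on has_field_derivative_at_within)+

lemma drift_cont: "continuous_on UNIV drift"
  unfolding drift_def by (intro continuous_intros f'_cont cont_f'') simp

lemma f'2_cont: "continuous_on UNIV (\<lambda>x. (f' x)\<^sup>2)"
  by (intro continuous_intros f'_cont)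

lemma mart_0: "\<omega> \<in> space M \<Longrightarrow> mart 0 \<omega> = 0"
  by (simp add: mart_def X_0 afun_def)

lemma qvar_0: "qvar 0 \<omega> = 0" by (simp add: qvar_def afun_def)

lemma mart_cont: "\<omega> \<in> space M \<Longrightarrow> continuous_on {0..} (\<lambda>s. mart s \<omega>)"
  unfolding mart_def
  by (intro continuous_intros afun_cont drift_cont continuous_on_compose2[OF f_cont X_cont]) auto

lemma qvar_cont: "\<omega> \<in> space M \<Longrightarrow> continuous_on {0..} (\<lambda>s. qvar s \<omega>)"
  unfolding qvar_def by (intro afun_cont f'2_cont)

lemma mart_adapted: "0 \<le> s \<Longrightarrow> mart s \<in> borel_measurable (\<G> s)"
  unfolding mart_def using comp_X_adapted[OF f_cont _ order_refl] afun_adapted[OF drift_cont] by measurable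

lemma qvar_adapted: "0 \<le> s \<Longrightarrow> qvar s \<in> borel_measurable (\<G> s)"
  unfolding qvar_def using afun_adapted[OF f'2_cont] by simp

lemma qvar_mono: "\<omega> \<in> space M \<Longrightarrow> 0 \<le> s \<Longrightarrow> s \<le> t \<Longrightarrow> qvar s \<omega> \<le> qvar t \<omega>"
  using afun_diff[OF f'2_cont, of \<omega> s t]
    integral_nonneg[OF integrable_continuous_real[OF comp_X_cont[OF f'2_cont, of \<omega> s t]]]
  by (simp add: qvar_def)

text \<open>The Feynman--Kac martingale for \<open>h = exp (i F)\<close>, where \<open>F\<close> agrees with \<open>f\<close> on the range that the
  stopped path can reach, and \<open>V\<close> determined by the equation \<open>h''/2 + \<mu> h' + V h = 0\<close>.\<close>

theorem stopped_exponential_martingale: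
  assumes S: "stopping S" and T: "stopping T" and ST: "\<And>\<omega>. \<omega> \<in> space M \<Longrightarrow> S \<omega> \<le> T \<omega>"
    and K: "0 < K" "\<And>\<omega>. \<omega> \<in> space M \<Longrightarrow> T \<omega> \<le> K"
    and n: "0 \<le> n" "\<And>\<omega> u. \<omega> \<in> space M \<Longrightarrow> 0 \<le> u \<Longrightarrow> u \<le> T \<omega> \<Longrightarrow> \<bar>X u \<omega>\<bar> \<le> n"
    and A: "A \<in> sets M" "\<And>s. 0 \<le> s \<Longrightarrow> A \<inter> {\<omega>\<in>space M. S \<omega> \<le> s} \<in> sets (\<G> s)"
  shows "(\<integral>\<omega>. indicator A \<omega> * exp (\<i> * of_real (mart (T \<omega>) \<omega> - mart (S \<omega>) \<omega>) +
      of_real ((qvar (T \<omega>) \<omega> - qvar (S \<omega>) \<omega>) / 2)) \<partial>M) = complex_of_real (prob A)"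
proof -
  obtain F F1 F2 where F: "\<And>x. (F has_real_derivative F1 x) (at x)"
    and F1: "\<And>x. (F1 has_real_derivative F2 x) (at x)" and buc: "buc F1" "buc F2"
    and Ff: "\<And>x. \<bar>x\<bar> \<le> n \<Longrightarrow> F x = f x \<and> F1 x = f' x \<and> F2 x = f'' x"
    using compact_cutoff[OF n(1) f' f'' cont_f''] by blast
  define d where "d x = F2 x / 2 + \<mu> * F1 x" for x
  define h where "h x = exp (\<i> * of_real (F x))" for x
  define h1 where "h1 x = \<i> * of_real (F1 x) * h x" for x
  define h2 where "h2 x = (\<i> * of_real (F2 x) - (of_real (F1 x))\<^sup>2) * h x" for x
  define V where "V x = - \<i> * of_real (d x) + of_real ((F1 x)\<^sup>2 / 2)" for x
  have dF: "((\<lambda>x. complex_of_real (F x)) has_vector_derivative of_real (F1 x)) (at x)" for x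
    using has_vector_derivative_of_real[OF F] .
  have dF1: "((\<lambda>x. complex_of_real (F1 x)) has_vector_derivative of_real (F2 x)) (at x)" for x
    using has_vector_derivative_of_real[OF F1] .
  have dh: "(h has_vector_derivative h1 x) (at x)" for x
  proof -
    have "((\<lambda>x. \<i> * complex_of_real (F x)) has_vector_derivative \<i> * of_real (F1 x)) (at x)"
      by (intro derivative_intros dF)
    from field_vector_diff_chain_at[OF this DERIV_exp]
    show ?thesis by (simp add: h_def[abs_def] h1_def comp_def)
  qed
  have dh1: "(h1 has_vector_derivative h2 x) (at x)" for x
  proof -
    have "((\<lambda>x. (\<i> * complex_of_real (F1 x)) * h x) has_vector_derivative (\<i> * of_real (F1 x)) * h1 x + (\<i> * of_real (F2 x)) * h x) (at x)"
      by (intro derivative_intros dF1 dh)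
    moreover have "(\<i> * of_real (F1 x)) * h1 x + (\<i> * of_real (F2 x)) * h x = h2 x"
      by (simp add: h1_def h2_def power2_eq_square algebra_simps)
    ultimately show ?thesis by (simp add: h1_def[abs_def])
  qed
  have pde: "h2 x / 2 + of_real \<mu> * h1 x + V x * h x = 0" for x
    by (simp add: h1_def h2_def V_def d_def power2_eq_square algebra_simps add_divide_distrib diff_divide_distrib)
  have hn: "norm (h x) = 1" for x by (simp add: h_def)
  obtain C1 where C1: "\<And>x. norm (F1 x) \<le> C1" using buc by (auto simp: buc_def)
  have h1n: "norm (h1 x) \<le> C1" for x using C1[of x] by (simp add: h1_def norm_mult hn)
  have "C1-lipschitz_on UNIV h"
  proof (rule lipschitz_onI)
    show "0 \<le> C1" using C1[of 0] norm_ge_zero order_trans by blast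
    show "dist (h x) (h y) \<le> C1 * dist x y" for x y
      unfolding dist_norm
    proof (rule differentiable_bound[where S=UNIV and f'="\<lambda>z a. a *\<^sub>R h1 z"])
      show "(h has_derivative (\<lambda>a. a *\<^sub>R h1 z)) (at z within UNIV)" for z
        using dh[of z] by (simp add: has_vector_derivative_def)
      have "onorm (\<lambda>a::real. a *\<^sub>R v) = norm v" for v :: complex
        using onorm_scaleR_left[of "\<lambda>a::real. a" v] by (simp add: bounded_linear_ident onorm_id)
      then show "onorm (\<lambda>a. a *\<^sub>R h1 z) \<le> C1" for z using h1n by simp
    qed auto
  qed
  then have buch: "buc h" unfolding buc_def using hn lipschitz_on_uniformly_continuous
    by (metis order_refl)
  have bd: "buc d"
    unfolding d_def using buc_add[OF buc_mult[OF buc(2) buc_const[of "1/2"]] buc_mult[OF buc_const[of \<mu>] buc(1)]]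
    by simp
  have bV: "buc V"
    using buc_add[OF buc_mult[OF buc_const[of "- \<i>"] buc_of_real[OF bd]]
      buc_of_real[OF buc_mult[OF buc_mult[OF buc(1) buc(1)] buc_const[of "1/2"]]]]
    by (simp add: V_def[abs_def] power2_eq_square)
  have bh2: "buc h2"
    using buc_mult[OF buc_add[OF buc_mult[OF buc_const[of \<i>] buc_of_real[OF buc(2)]]
      buc_mult[OF buc_const[of "-1"] buc_mult[OF buc_of_real[OF buc(1)] buc_of_real[OF buc(1)]]]] buch]
    by (simp add: h2_def[abs_def] power2_eq_square)
  obtain C2 CV where "\<And>x. norm (h2 x) \<le> C2" "\<And>x. norm (V x) \<le> CV"
    using bh2 bV by (auto simp: buc_def)
  then have C: "norm (h x) \<le> Max {1, C1, C2, CV}" "norm (h1 x) \<le> Max {1, C1, C2, CV}"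
    "norm (h2 x) \<le> Max {1, C1, C2, CV}" "norm (V x) \<le> Max {1, C1, C2, CV}" for x
    using h1n[of x] hn[of x] by (auto simp: le_max_iff_disj)
  have uc: "uniformly_continuous_on UNIV h2" "uniformly_continuous_on UNIV V"
    using bh2 bV by (auto simp: buc_def)
  note fk = feynman_kac_martingale[of h h1 h2 V, OF dh dh1 pde C uc]
  have Vc: "continuous_on UNIV V" using uc(2) by (rule uniformly_continuous_imp_continuous)
  have hc: "continuous_on UNIV h" using buch by (auto simp: buc_def intro: uniformly_continuous_imp_continuous)
  have dc: "continuous_on UNIV d" using bd by (auto simp: buc_def intro: uniformly_continuous_imp_continuous)
  have F1c: "continuous_on UNIV F1" using buc by (auto simp: buc_def intro: uniformly_continuous_imp_continuous)
  define E where "E t \<omega> = h (X t \<omega>) * exp (afun V t \<omega>)" for t \<omega>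
  have aV: "afun V t \<omega> = - \<i> * of_real (afun d t \<omega>) + of_real (afun (\<lambda>x. (F1 x)\<^sup>2) t \<omega> / 2)"
    if "\<omega> \<in> space M" "0 \<le> t" for t \<omega>
  proof -
    have "(((\<lambda>u. d (X u \<omega>))) has_integral afun d t \<omega>) {0..t}"
      "((\<lambda>u. (F1 (X u \<omega>))\<^sup>2) has_integral afun (\<lambda>x. (F1 x)\<^sup>2) t \<omega>) {0..t}"
      unfolding afun_def
      by (intro integrable_integral integrable_continuous_real comp_X_cont[of d] comp_X_cont[of "\<lambda>x. (F1 x)\<^sup>2"]
        continuous_intros dc F1c that; simp)+
    then have "((\<lambda>u. - \<i> * of_real (d (X u \<omega>)) + of_real ((F1 (X u \<omega>))\<^sup>2) / 2) has_integral
      (- \<i> * of_real (afun d t \<omega>) + of_real (afun (\<lambda>x. (F1 x)\<^sup>2) t \<omega>) / 2)) {0..t}"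
      by (intro has_integral_add has_integral_mult_right has_integral_divide has_integral_of_real)
    then show ?thesis
      unfolding afun_def[of V] V_def by (intro integral_unique) simp
  qed
  have F1sq_nonneg: "0 \<le> afun (\<lambda>x. (F1 x)\<^sup>2) t \<omega>" if "\<omega> \<in> space M" "0 \<le> t" for t \<omega>
    unfolding afun_def
    by (intro integral_nonneg integrable_continuous_real comp_X_cont[of "\<lambda>x. (F1 x)\<^sup>2"] continuous_intros F1c that) auto
  have Eexp: "E t \<omega> = exp (\<i> * of_real (F (X t \<omega>) - afun d t \<omega>) + of_real (afun (\<lambda>x. (F1 x)\<^sup>2) t \<omega> / 2))"
    if "\<omega> \<in> space M" "0 \<le> t" for t \<omega>
    unfolding E_def h_def aV[OF that] by (simp add: exp_add[symmetric] algebra_simps)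
  \<comment> \<open>The modulus of \<open>E\<close> is the exponential of a nonnegative number.
    Hence 1 / \<open>E\<close> is bounded by 1 and may be used as a test variable.\<close>
  have En: "1 \<le> norm (E t \<omega>)" if "\<omega> \<in> space M" "0 \<le> t" for t \<omega>
    using F1sq_nonneg[OF that] unfolding Eexp[OF that] by simp
  have Ec: "continuous_on {0..} (\<lambda>t. E t \<omega>)" if "\<omega> \<in> space M" for \<omega>
    unfolding E_def by (intro continuous_intros afun_cont Vc continuous_on_compose2[OF hc X_cont] that) auto
  have Em: "E s \<in> borel_measurable (\<G> s)" if "0 \<le> s" for s
    unfolding E_def using comp_X_adapted[OF hc that order_refl] afun_adapted[OF Vc that] by measurable
  define CE where "CE = exp (Max {1, C1, C2, CV} * K)"
  have Eb: "norm (E s \<omega>) \<le> CE" if "\<omega> \<in> space M" "0 \<le> s" "s \<le> K" for s \<omega>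
  proof -
    have "Re (afun V s \<omega>) \<le> norm (afun V s \<omega>)" by (rule complex_Re_le_cmod)
    also have "\<dots> \<le> Max {1, C1, C2, CV} * (s - 0)"
      unfolding afun_def using that C by (intro integral_bound comp_X_cont Vc) auto
    also have "\<dots> \<le> Max {1, C1, C2, CV} * K" using that by (intro mult_left_mono) (auto simp: le_max_iff_disj)
    finally show ?thesis by (simp add: E_def norm_mult hn CE_def)
  qed
  \<comment> \<open>Before \<open>T\<close> the path stays in [-n, n], where the cut-off function
    and its derivatives coincide with those of \<open>f\<close>.\<close>
  have EF: "E t \<omega> = exp (\<i> * of_real (f 0 + mart t \<omega>) + of_real (qvar t \<omega> / 2))"
    if \<omega>: "\<omega> \<in> space M" and t: "0 \<le> t" "t \<le> T \<omega>" for t \<omega>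
  proof -
    have X: "\<bar>X u \<omega>\<bar> \<le> n" if "u \<in> {0..t}" for u using n(2)[OF \<omega>, of u] that t by auto
    have "afun d t \<omega> = afun drift t \<omega>" "afun (\<lambda>x. (F1 x)\<^sup>2) t \<omega> = qvar t \<omega>"
      unfolding qvar_def afun_def using Ff X by (auto intro!: integral_cong simp: d_def drift_def)
    then show ?thesis
      unfolding Eexp[OF \<omega> t(1)] mart_def using Ff[OF X[of t]] t by simp
  qed
  \<comment> \<open>Dividing by the value at \<open>S\<close>, which belongs to the past of
    \<open>S\<close>, turns the martingale into its multiplicative increment between
    \<open>S\<close> and \<open>T\<close>.\<close>
  define Y where "Y \<omega> = indicator A \<omega> * inverse (E (S \<omega>) \<omega>)" for \<omega>
  have YS: "pre_measurable S Y"
    unfolding pre_measurable_def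
  proof (intro allI impI)
    fix s :: real assume s: "0 \<le> s"
    have [measurable]: "(\<lambda>\<omega>. E (min (S \<omega>) s) \<omega>) \<in> borel_measurable (\<G> s)"
      by (rule stopped_measurable[OF S s Em Ec])
    have [measurable]: "A \<inter> {\<omega>\<in>space M. S \<omega> \<le> s} \<in> sets (\<G> s)" using A(2)[OF s] .
    have "(\<lambda>\<omega>. indicator (A \<inter> {\<omega>\<in>space M. S \<omega> \<le> s}) \<omega> * inverse (E (min (S \<omega>) s) \<omega>)) \<in> borel_measurable (\<G> s)"
      by measurable
    also have "?this \<longleftrightarrow> (\<lambda>\<omega>. Y \<omega> * indicator {\<omega>. S \<omega> \<le> s} \<omega>) \<in> borel_measurable (\<G> s)"
      by (rule measurable_cong) (auto simp: Y_def indicator_def space_G)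
    finally show "(\<lambda>\<omega>. Y \<omega> * indicator {\<omega>. S \<omega> \<le> s} \<omega>) \<in> borel_measurable (\<G> s)" .
  qed
  have YT: "pre_measurable T Y"
    unfolding pre_measurable_def
  proof (intro allI impI)
    fix s :: real assume s: "0 \<le> s"
    have [measurable]: "(\<lambda>\<omega>. Y \<omega> * indicator {\<omega>. S \<omega> \<le> s} \<omega>) \<in> borel_measurable (\<G> s)"
      using YS s by (simp add: pre_measurable_def)
    have [measurable]: "(\<lambda>\<omega>. indicator {\<omega>. T \<omega> \<le> s} \<omega> :: complex) \<in> borel_measurable (\<G> s)"
      using stopping_le_sets[OF T order_refl] by (intro borel_measurable_indicator') (simp add: space_G)
    have "(\<lambda>\<omega>. (Y \<omega> * indicator {\<omega>. S \<omega> \<le> s} \<omega>) * indicator {\<omega>. T \<omega> \<le> s} \<omega>) \<in> borel_measurable (\<G> s)"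
      by measurable
    also have "?this \<longleftrightarrow> (\<lambda>\<omega>. Y \<omega> * indicator {\<omega>. T \<omega> \<le> s} \<omega>) \<in> borel_measurable (\<G> s)"
      using ST by (intro measurable_cong) (force simp: indicator_def space_G)
    finally show "(\<lambda>\<omega>. Y \<omega> * indicator {\<omega>. T \<omega> \<le> s} \<omega>) \<in> borel_measurable (\<G> s)" .
  qed
  have Yb: "norm (Y \<omega>) \<le> 1" if "\<omega> \<in> space M" for \<omega>
    using En[OF that stopping_nonneg[OF S that]]
    by (auto simp: Y_def indicator_def norm_inverse inverse_le_1_iff)
  have mart: "(\<integral>\<omega>. Y' \<omega> * E s \<omega> \<partial>M) = (\<integral>\<omega>. Y' \<omega> * E K \<omega> \<partial>M)"
    if "0 \<le> s" "s \<le> K" "Y' \<in> borel_measurable (\<G> s)" "\<And>\<omega>. \<omega> \<in> space M \<Longrightarrow> norm (Y' \<omega>) \<le> D'" for s Y' D'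
    unfolding E_def using fk[OF that] .
  have SK: "S \<omega> \<le> K" if "\<omega> \<in> space M" for \<omega> using ST[OF that] K(2)[OF that] by simp
  \<comment> \<open>The two stopping times are not compared directly: each is compared with the
    common horizon \<open>K\<close>.\<close>
  have "(\<integral>\<omega>. Y \<omega> * E (T \<omega>) \<omega> \<partial>M) = (\<integral>\<omega>. Y \<omega> * E K \<omega> \<partial>M)"
    by (rule optional_stopping[where E=E, OF K(1) Em Ec Eb mart T K(2) YT Yb])
  also have "\<dots> = (\<integral>\<omega>. Y \<omega> * E (S \<omega>) \<omega> \<partial>M)"
    by (rule optional_stopping[where E=E, OF K(1) Em Ec Eb mart S SK YS Yb, symmetric])
  also have "\<dots> = (\<integral>\<omega>. indicator A \<omega> \<partial>M)"
  proof (rule Bochner_Integration.integral_cong[OF refl])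
    fix \<omega> assume \<omega>: "\<omega> \<in> space M"
    have "E (S \<omega>) \<omega> \<noteq> 0" using En[OF \<omega> stopping_nonneg[OF S \<omega>]] by auto
    then show "Y \<omega> * E (S \<omega>) \<omega> = indicator A \<omega>" by (simp add: Y_def)
  qed
  also have "\<dots> = complex_of_real (prob A)"
  proof -
    have "(\<integral>\<omega>. (indicator A \<omega> :: complex) \<partial>M) = (\<integral>\<omega>. complex_of_real (indicator A \<omega>) \<partial>M)"
      by (intro Bochner_Integration.integral_cong) (auto simp: indicator_def)
    then show ?thesis using A(1) by simp
  qed
  also have "(\<integral>\<omega>. Y \<omega> * E (T \<omega>) \<omega> \<partial>M) = (\<integral>\<omega>. indicator A \<omega> * exp (\<i> * of_real (mart (T \<omega>) \<omega> - mart (S \<omega>) \<omega>) +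
      of_real ((qvar (T \<omega>) \<omega> - qvar (S \<omega>) \<omega>) / 2)) \<partial>M)"
  proof (rule Bochner_Integration.integral_cong[OF refl])
    fix \<omega> assume \<omega>: "\<omega> \<in> space M"
    show "Y \<omega> * E (T \<omega>) \<omega> = indicator A \<omega> * exp (\<i> * of_real (mart (T \<omega>) \<omega> - mart (S \<omega>) \<omega>) +
      of_real ((qvar (T \<omega>) \<omega> - qvar (S \<omega>) \<omega>) / 2))"
      unfolding Y_def EF[OF \<omega> stopping_nonneg[OF T \<omega>] order_refl] EF[OF \<omega> stopping_nonneg[OF S \<omega>] ST[OF \<omega>]]
      by (simp add: exp_minus[symmetric] exp_add[symmetric] algebra_simps add_divide_distrib diff_divide_distrib)
  qed
  finally show ?thesis .
qed

end

end

section \<open>A maximal inequality and its consequences\<close>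

lemma cos_1_less_1: "cos (1::real) < 1"
  using cos_monotone_0_pi[of 0 1] pi_gt3 by simp

text \<open>A positive value would, by the intermediate value theorem, be preceded by an earlier
  zero. As the hitting time itself is included, the stopped quantities do not overshoot their
  bounds.\<close>

lemma (in real_filtration) hit_nonpos:
  assumes "\<omega> \<in> space M" "continuous_on {0..} (\<lambda>t. N t \<omega>)" "0 \<le> K" "0 \<le> N K \<omega>" "N 0 \<omega> \<le> 0"
    and u: "0 \<le> u" "u \<le> hit N \<omega>"
  shows "N u \<omega> \<le> 0"
proof (rule ccontr)
  assume "\<not> N u \<omega> \<le> 0"
  then have pos: "0 < N u \<omega>" by simp
  have "continuous_on {0..u} (\<lambda>t. N t \<omega>)"
    using assms(2) by (rule continuous_on_subset) auto
  then obtain v where v: "0 \<le> v" "v \<le> u" "N v \<omega> = 0"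
    using IVT'[of "\<lambda>t. N t \<omega>" 0 0 u] pos assms(5) u by auto
  with pos have "v < u" by (cases "v = u") auto
  moreover have "hit N \<omega> \<le> v"
    unfolding hit_def using v by (intro cInf_lower) (auto intro!: bdd_belowI[of _ 0])
  ultimately show False using u by simp
qed

text \<open>A bound on the outer probability: events that involve uncountably many times need not be shown to be
  measurable.\<close>

definition (in prob_space) covered :: "'a set \<Rightarrow> real \<Rightarrow> bool" where
  "covered S c \<longleftrightarrow> (\<exists>D\<in>events. S \<subseteq> D \<and> prob D \<le> c)"

lemma (in prob_space) covered_choice:
  assumes "\<forall>k. covered (S k) (c k)"
  shows "\<exists>D. \<forall>k. D k \<in> events \<and> S k \<subseteq> D k \<and> prob (D k) \<le> c k"
  using assms unfolding covered_def by metis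

text \<open>The intersections of the tails of \<open>D\<close> increase with the starting index and
  each has probability at most c, so their union has too. It suits localisation, where a path
  satisfies the stopped condition for all large indices.\<close>

lemma (in prob_space) liminf_cover:
  assumes D: "\<And>k::nat. D k \<in> events" "\<And>k. prob (D k) \<le> c"
    and S: "S \<subseteq> (\<Union>k. \<Inter>j\<in>{k..}. D j)"
  shows "covered S c"
  unfolding covered_def
proof (intro bexI[of _ "\<Union>k. \<Inter>j\<in>{k..}. D j"] conjI S)
  show "(\<Union>k. \<Inter>j\<in>{k..}. D j) \<in> events" using D by auto
  have "(\<lambda>k. prob (\<Inter>j\<in>{k..}. D j)) \<longlonglongrightarrow> prob (\<Union>k. \<Inter>j\<in>{k..}. D j)"
    using D by (intro finite_Lim_measure_incseq) (auto simp: incseq_def)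
  moreover have "prob (\<Inter>j\<in>{k..}. D j) \<le> c" for k
    using D by (intro order_trans[OF finite_measure_mono D(2)[of k]]) auto
  ultimately show "prob (\<Union>k. \<Inter>j\<in>{k..}. D j) \<le> c"
    by (intro LIMSEQ_le_const2) auto
qed

context brownian_filtration
begin

context
  fixes f f' f'' :: "real \<Rightarrow> real"
  assumes f': "\<And>x. (f has_real_derivative f' x) (at x)"
    and f'': "\<And>x. (f' has_real_derivative f'' x) (at x)"
    and cont_f'': "continuous_on UNIV f''"
begin

abbreviation (input) "m \<equiv> mart f f' f''"
abbreviation (input) "q \<equiv> qvar f'"

lemmas C2 = f' f'' cont_f''

text \<open>Real parts of the exponential martingale, stopped when \<open>\<bar>m\<bar>\<close> grows by 1 or \<open>q\<close> grows by \<open>\<delta>\<close>: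
  the expectation of \<open>cos\<close> of the increment of \<open>m\<close> is at least \<open>exp (- \<delta> / 2) \<ge> 1 - \<delta> / 2\<close>.\<close>

lemma maximal_inequality:
  assumes s0: "0 \<le> s0" and \<delta>: "0 < \<delta>"
  shows "covered {\<omega>\<in>space M. \<exists>u\<ge>s0. 1 \<le> \<bar>m u \<omega> - m s0 \<omega>\<bar> \<and> q u \<omega> - q s0 \<omega> < \<delta>}
    (\<delta> / (2 * (1 - cos 1)))"
proof -
  \<comment> \<open>Stopping occurs when the path or time reaches k + 1, when \<open>m\<close> has
    moved by 1, or when \<open>q\<close> has grown by \<delta>. With \<open>min s0 u\<close> as
    reference time, the last two conditions stay inactive until s0.\<close>
  define N where "N k u \<omega> = max (max (\<bar>X u \<omega>\<bar> - real (Suc k)) (u - real (Suc k)))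
    (max (\<bar>m u \<omega> - m (min s0 u) \<omega>\<bar> - 1) (q u \<omega> - q (min s0 u) \<omega> - \<delta>))" for k :: nat and u \<omega>
  define T where "T k = hit (N k)" for k
  \<comment> \<open>Localisation may stop before s0; capping the start by \<open>T k\<close> keeps
    the two stopping times ordered, with zero increments in that case.\<close>
  define S where "S k \<omega> = min s0 (T k \<omega>)" for k \<omega>
  define D where "D k = {\<omega>\<in>space M. 1 \<le> \<bar>m (T k \<omega>) \<omega> - m (S k \<omega>) \<omega>\<bar>}" for k
  note m_cont = mart_cont[OF C2] and q_cont = qvar_cont[OF C2]
  have N_cont: "continuous_on {0..} (\<lambda>t. N k t \<omega>)" if "\<omega> \<in> space M" for k \<omega>
    unfolding N_def using s0
    by (intro continuous_intros X_cont m_cont q_cont that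
        continuous_on_compose2[OF m_cont[OF that]] continuous_on_compose2[OF q_cont[OF that]]) auto
  have N_ad: "N k s \<in> borel_measurable (\<G> s)" if s: "0 \<le> s" for k s
  proof -
    have ms: "0 \<le> min s0 s" "min s0 s \<le> s" using s s0 by auto
    note [measurable] = X_adapted[OF s] mart_adapted[OF C2 s] qvar_adapted[OF C2 s]
      measurable_G_mono[OF mart_adapted[OF C2 ms(1)] ms(2)] measurable_G_mono[OF qvar_adapted[OF C2 ms(1)] ms(2)]
    show ?thesis unfolding N_def by measurable
  qed
  have N_K: "0 \<le> real (Suc k)" "0 \<le> N k (real (Suc k)) \<omega>" for k \<omega>
    by (auto simp: N_def le_max_iff_disj)
  have N_0: "N k 0 \<omega> \<le> 0" if "\<omega> \<in> space M" for k \<omega>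
    using \<delta> s0 X_0[OF that] by (simp add: N_def)
  have Tst: "stopping (T k)" for k
    unfolding T_def by (rule stopping_hit[OF N_cont N_K N_ad])
  have Sst: "stopping (S k)" for k
    unfolding S_def by (intro stopping_min stopping_const s0 Tst)
  have T0: "0 \<le> T k \<omega>" and TK: "T k \<omega> \<le> real (Suc k)" and TN: "0 \<le> N k (T k \<omega>) \<omega>" if "\<omega> \<in> space M" for k \<omega>
    using hit_bounds[where N="N k" and K="real (Suc k)", OF N_cont N_K that] by (simp_all add: T_def)
  have le0: "N k u \<omega> \<le> 0" if "\<omega> \<in> space M" "0 \<le> u" "u \<le> T k \<omega>" for k u \<omega>
    using hit_nonpos[where N="N k" and K="real (Suc k)", OF that(1) N_cont[OF that(1)] N_K N_0[OF that(1)] that(2)] that(3)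
    by (simp add: T_def)
  have X_le: "\<bar>X u \<omega>\<bar> \<le> real (Suc k)" if "\<omega> \<in> space M" "0 \<le> u" "u \<le> T k \<omega>" for k u \<omega>
    using le0[OF that] by (simp add: N_def)
  have mT: "\<bar>m (T k \<omega>) \<omega> - m (S k \<omega>) \<omega>\<bar> \<le> 1" and qT: "q (T k \<omega>) \<omega> - q (S k \<omega>) \<omega> \<le> \<delta>"
    if "\<omega> \<in> space M" for k \<omega>
    using le0[OF that T0[OF that] order_refl] by (simp_all add: N_def S_def)
  have meas: "(\<lambda>\<omega>. m (R \<omega>) \<omega>) \<in> borel_measurable M" "(\<lambda>\<omega>. q (R \<omega>) \<omega>) \<in> borel_measurable M"
    if "stopping R" "\<And>\<omega>. \<omega> \<in> space M \<Longrightarrow> R \<omega> \<le> real (Suc k)" for R k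
  proof -
    have "(\<lambda>\<omega>. m (min (R \<omega>) (real (Suc k))) \<omega>) \<in> borel_measurable M"
      "(\<lambda>\<omega>. q (min (R \<omega>) (real (Suc k))) \<omega>) \<in> borel_measurable M"
      by (rule measurable_G_M, rule stopped_measurable[OF that(1) N_K(1) mart_adapted[OF C2] m_cont]; simp)
         (rule measurable_G_M, rule stopped_measurable[OF that(1) N_K(1) qvar_adapted[OF C2] q_cont]; simp)
    moreover have "min (R \<omega>) (real (Suc k)) = R \<omega>" if "\<omega> \<in> space M" for \<omega> using \<open>\<And>\<omega>. \<omega> \<in> space M \<Longrightarrow> R \<omega> \<le> real (Suc k)\<close>[OF that] by simp
    ultimately show "(\<lambda>\<omega>. m (R \<omega>) \<omega>) \<in> borel_measurable M" "(\<lambda>\<omega>. q (R \<omega>) \<omega>) \<in> borel_measurable M"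
      by (simp_all cong: measurable_cong)
  qed
  have SK: "S k \<omega> \<le> real (Suc k)" if "\<omega> \<in> space M" for k \<omega> using TK[OF that, of k] by (simp add: S_def)
  note [measurable] = meas[OF Tst TK] meas[OF Sst SK]
  have D_ev: "D k \<in> events" for k unfolding D_def by measurable
  have D_prob: "prob (D k) \<le> \<delta> / (2 * (1 - cos 1))" for k
  proof -
    let ?dm = "\<lambda>\<omega>. m (T k \<omega>) \<omega> - m (S k \<omega>) \<omega>" and ?dq = "\<lambda>\<omega>. q (T k \<omega>) \<omega> - q (S k \<omega>) \<omega>"
    let ?Z = "\<lambda>\<omega>. exp (\<i> * of_real (?dm \<omega>) + of_real (?dq \<omega> / 2))"
    have "(\<integral>\<omega>. indicator (space M) \<omega> * ?Z \<omega> \<partial>M) = complex_of_real (prob (space M))"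
    proof (rule stopped_exponential_martingale[OF C2 Sst Tst _ _ TK _ X_le])
      show "space M \<inter> {\<omega> \<in> space M. S k \<omega> \<le> s} \<in> sets (\<G> s)" if "0 \<le> s" for s
        using stopping_le_sets[OF Sst order_refl] by (simp add: Int_absorb1)
    qed (auto simp: S_def)
    moreover have "(\<integral>\<omega>. indicator (space M) \<omega> * ?Z \<omega> \<partial>M) = (\<integral>\<omega>. ?Z \<omega> \<partial>M)"
      by (intro Bochner_Integration.integral_cong) auto
    ultimately have Z1: "(\<integral>\<omega>. ?Z \<omega> \<partial>M) = 1" by (simp add: prob_space)
    have nZ: "norm (?Z \<omega>) \<le> exp (\<delta> / 2)" if "\<omega> \<in> space M" for \<omega>
      using qT[OF that, of k] by simp
    have Zi: "integrable M ?Z"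
      by (rule integrable_const_bound[of _ "exp (\<delta> / 2)"]) (use nZ in auto)
    have ReZ: "Re (?Z \<omega>) = exp (?dq \<omega> / 2) * cos (?dm \<omega>)" for \<omega>
      by (simp add: Re_exp)
    have cos_ge: "cos 1 \<le> cos (?dm \<omega>)" if "\<omega> \<in> space M" for \<omega>
    proof -
      have "cos 1 \<le> cos \<bar>?dm \<omega>\<bar>" using mT[OF that, of k] pi_gt3 by (intro cos_monotone_0_pi_le) auto
      then show ?thesis by (metis cos_abs_real)
    qed
    \<comment> \<open>Increments of \<open>m\<close> are at most 1 in modulus, so their cosine is
      nonnegative, and exp (dq / 2) may be replaced by its upper bound exp (\<delta> / 2).\<close>
    have cos1: "0 \<le> cos (1::real)" using pi_gt3 by (intro cos_ge_zero) auto
    have ci: "integrable M (\<lambda>\<omega>. cos (?dm \<omega>))"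
      by (rule integrable_const_bound[of _ 1]) auto
    have "1 = Re (\<integral>\<omega>. ?Z \<omega> \<partial>M)" unfolding Z1 by simp
    also have "\<dots> = (\<integral>\<omega>. Re (?Z \<omega>) \<partial>M)" using Zi by (rule integral_Re[symmetric])
    also have "\<dots> \<le> (\<integral>\<omega>. exp (\<delta> / 2) * cos (?dm \<omega>) \<partial>M)"
    proof (rule integral_mono[OF integrable_Re[OF Zi]])
      show "Re (?Z \<omega>) \<le> exp (\<delta> / 2) * cos (?dm \<omega>)" if "\<omega> \<in> space M" for \<omega>
        unfolding ReZ using qT[OF that, of k] cos_ge[OF that] cos1 by (intro mult_right_mono) auto
    qed (use ci in simp)
    also have "\<dots> = exp (\<delta> / 2) * (\<integral>\<omega>. cos (?dm \<omega>) \<partial>M)" by simp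
    finally have "exp (- \<delta> / 2) \<le> (\<integral>\<omega>. cos (?dm \<omega>) \<partial>M)"
      by (simp add: exp_minus field_simps)
    moreover have "1 - \<delta> / 2 \<le> exp (- \<delta> / 2)" using exp_ge_add_one_self[of "- \<delta> / 2"] by simp
    ultimately have "1 - (\<integral>\<omega>. cos (?dm \<omega>) \<partial>M) \<le> \<delta> / 2" by linarith
    \<comment> \<open>Markov's inequality for 1 - cos, which takes the value 1 - cos 1 when the
      increment has modulus 1. This is the origin of the constant in the bound.\<close>
    moreover have "(\<integral>\<omega>. (1 - cos 1) * indicator (D k) \<omega> \<partial>M) \<le> (\<integral>\<omega>. 1 - cos (?dm \<omega>) \<partial>M)"
    proof (rule integral_mono)
      show "integrable M (\<lambda>\<omega>. (1 - cos 1) * indicator (D k) \<omega> :: real)"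
      proof (rule integrable_const_bound[of _ "1 - cos 1"])
        show "(\<lambda>\<omega>. (1 - cos 1) * indicator (D k) \<omega> :: real) \<in> borel_measurable M"
          by (intro borel_measurable_times borel_measurable_const borel_measurable_indicator D_ev)
      qed (use cos_1_less_1 in \<open>auto simp: indicator_def\<close>)
      show "integrable M (\<lambda>\<omega>. 1 - cos (?dm \<omega>))" using ci by simp
      fix \<omega> assume \<omega>: "\<omega> \<in> space M"
      show "(1 - cos 1) * indicator (D k) \<omega> \<le> 1 - cos (?dm \<omega>)"
      proof (cases "\<omega> \<in> D k")
        case True
        then have "\<bar>?dm \<omega>\<bar> = 1" using mT[OF \<omega>, of k] by (simp add: D_def)
        then have "cos (?dm \<omega>) = cos 1" by (metis cos_abs_real)
        then show ?thesis using True by simp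
      qed simp
    qed
    ultimately have "(1 - cos 1) * prob (D k) \<le> \<delta> / 2"
      using D_ev ci by (simp add: prob_space)
    then show ?thesis using cos_1_less_1 by (simp add: field_simps)
  qed
  show ?thesis
  proof (rule liminf_cover[OF D_ev D_prob], rule subsetI)
    fix \<omega> assume "\<omega> \<in> {\<omega>\<in>space M. \<exists>u\<ge>s0. 1 \<le> \<bar>m u \<omega> - m s0 \<omega>\<bar> \<and> q u \<omega> - q s0 \<omega> < \<delta>}"
    then obtain u where \<omega>: "\<omega> \<in> space M" and u: "s0 \<le> u" "1 \<le> \<bar>m u \<omega> - m s0 \<omega>\<bar>" "q u \<omega> - q s0 \<omega> < \<delta>"
      by blast
    have u0: "0 \<le> u" using u s0 by simp
    have "bounded ((\<lambda>t. X t \<omega>) ` {0..u})"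
      by (intro compact_imp_bounded compact_continuous_image X_cont_on \<omega>) auto
    then obtain c where c: "\<forall>t\<in>{0..u}. \<bar>X t \<omega>\<bar> \<le> c" by (auto simp: bounded_iff)
    obtain k :: nat where k: "max c u < real k" using reals_Archimedean2 by blast
    \<comment> \<open>For large j neither the path nor the time reaches j + 1 before u, and
      \<open>q\<close> has not grown by \<delta>. What stops the process must therefore be
      \<open>m\<close>.\<close>
    have "\<omega> \<in> D j" if j: "k \<le> j" for j
    proof -
      have jk: "max c u < real (Suc j)" using k j by simp
      have "0 \<le> N j u \<omega>" using u by (simp add: N_def min_absorb1)
      then have Tu: "T j \<omega> \<le> u"
        unfolding T_def using hit_le_iff[where N="N j" and K="real (Suc j)", OF N_cont N_K \<omega> u0] u0 by blast
      have "\<bar>X (T j \<omega>) \<omega>\<bar> \<le> c" using c Tu T0[OF \<omega>, of j] by auto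
      moreover have "q (T j \<omega>) \<omega> - q (min s0 (T j \<omega>)) \<omega> < \<delta>"
      proof (cases "s0 \<le> T j \<omega>")
        case True
        then show ?thesis using qvar_mono[OF C2 \<omega> T0[OF \<omega>] Tu] u(3) by (simp add: min_absorb1)
      next
        case False
        then show ?thesis using \<delta> by (simp add: min_absorb2)
      qed
      ultimately show ?thesis
        using TN[OF \<omega>, of j] jk Tu \<omega> by (auto simp: N_def D_def S_def le_max_iff_disj)
    qed
    then show "\<omega> \<in> (\<Union>k. \<Inter>j\<in>{k..}. D j)" by blast
  qed
qed

end

end

section \<open>Long-time behaviour of X and convergence of m\<close>

context brownian_filtration
begin

text \<open>The maximal inequality for the linear function x / lam, for which \<open>m\<close> is B
  / lam and \<open>q\<close> is u / lam^2.\<close>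

lemma B_sup:
  assumes "0 < lam" "0 < L"
  shows "covered {\<omega>\<in>space M. \<exists>u\<ge>0. u < L \<and> lam \<le> \<bar>B u \<omega>\<bar>} (L / lam\<^sup>2 / (2 * (1 - cos 1)))"
proof -
  let ?f = "\<lambda>x::real. x / lam" and ?f' = "\<lambda>x::real. 1 / lam" and ?f'' = "\<lambda>x::real. 0::real"
  have C2: "(?f has_real_derivative ?f' x) (at x)" "(?f' has_real_derivative ?f'' x) (at x)"
    "continuous_on UNIV ?f''" for x
    using assms by (auto intro!: derivative_eq_intros)
  have m: "mart ?f ?f' ?f'' u \<omega> = B u \<omega> / lam" if "0 \<le> u" for u \<omega>
    using that by (simp add: mart_def[OF C2] drift_def[OF C2] afun_def X_def add_divide_distrib)
  have q: "qvar ?f' u \<omega> = u / lam\<^sup>2" if "0 \<le> u" for u \<omega>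
    using that by (simp add: qvar_def[OF C2] afun_def power_divide)
  have "0 < L / lam\<^sup>2" using assms by simp
  from maximal_inequality[OF C2 order_refl this]
  obtain D where D: "D \<in> events" "prob D \<le> L / lam\<^sup>2 / (2 * (1 - cos 1))"
    "{\<omega>\<in>space M. \<exists>u\<ge>0. 1 \<le> \<bar>mart ?f ?f' ?f'' u \<omega> - mart ?f ?f' ?f'' 0 \<omega>\<bar> \<and> qvar ?f' u \<omega> - qvar ?f' 0 \<omega> < L / lam\<^sup>2} \<subseteq> D"
    unfolding covered_def by blast
  have "{\<omega>\<in>space M. \<exists>u\<ge>0. u < L \<and> lam \<le> \<bar>B u \<omega>\<bar>} \<subseteq> D"
  proof (intro subset_trans[OF _ D(3)] subsetI)
    fix \<omega> assume "\<omega> \<in> {\<omega>\<in>space M. \<exists>u\<ge>0. u < L \<and> lam \<le> \<bar>B u \<omega>\<bar>}"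
    then obtain u where u: "\<omega> \<in> space M" "0 \<le> u" "u < L" "lam \<le> \<bar>B u \<omega>\<bar>" by blast
    then have "1 \<le> \<bar>B u \<omega> / lam\<bar>" "u / lam\<^sup>2 < L / lam\<^sup>2"
      using assms by (auto simp: abs_divide divide_strict_right_mono)
    then show "\<omega> \<in> {\<omega>\<in>space M. \<exists>u\<ge>0. 1 \<le> \<bar>mart ?f ?f' ?f'' u \<omega> - mart ?f ?f' ?f'' 0 \<omega>\<bar> \<and> qvar ?f' u \<omega> - qvar ?f' 0 \<omega> < L / lam\<^sup>2}"
      using u m[of u \<omega>] m[of 0 \<omega>] q[of u \<omega>] q[of 0 \<omega>] B_0[of \<omega>] by auto
  qed
  then show ?thesis unfolding covered_def using D(1,2) by blast
qed

text \<open>Borel--Cantelli over dyadic blocks of time: eventually, on the block from 2^k to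
  2^(k+1), the noise is below half the drift accumulated at the start of the block, hence X_t \<ge>
  \<mu> t / 2.\<close>

theorem X_tendsto_infinity:
  assumes \<mu>: "0 < \<mu>"
  shows "AE \<omega> in M. filterlim (\<lambda>t. X t \<omega>) at_top at_top"
proof -
  \<comment> \<open>Half the drift at time 2^k. With the horizon 2^(k+1), the quotient of horizon
    and squared level decays like 2^(-k), which is summable.\<close>
  define lam where "lam k = \<mu> / 2 * 2 ^ k" for k :: nat
  have lam: "0 < lam k" for k using \<mu> by (simp add: lam_def)
  have "\<forall>k. covered {\<omega>\<in>space M. \<exists>u\<ge>0. u < 2 ^ Suc k \<and> lam k \<le> \<bar>B u \<omega>\<bar>}
      (2 ^ Suc k / (lam k)\<^sup>2 / (2 * (1 - cos 1)))"
    by (intro allI B_sup lam) simp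
  from covered_choice[OF this] obtain D where D': "\<forall>k. D k \<in> events \<and>
    {\<omega>\<in>space M. \<exists>u\<ge>0. u < 2 ^ Suc k \<and> lam k \<le> \<bar>B u \<omega>\<bar>} \<subseteq> D k \<and>
    prob (D k) \<le> 2 ^ Suc k / (lam k)\<^sup>2 / (2 * (1 - cos 1))" by (elim exE)
  note D = D'[THEN spec, THEN conjunct1] D'[THEN spec, THEN conjunct2, THEN conjunct1]
    D'[THEN spec, THEN conjunct2, THEN conjunct2]
  have eq: "2 ^ Suc k / (lam k)\<^sup>2 / (2 * (1 - cos 1)) = 4 / ((1 - cos 1) * \<mu>\<^sup>2) * (1 / 2) ^ k" for k
  proof -
    have "2 * p / (\<mu> / 2 * p)\<^sup>2 / (2 * c) = 4 / (c * \<mu>\<^sup>2) * (1 / p)" if "0 < p" "0 < c" for p c :: real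
      using that \<mu> by (simp add: power2_eq_square field_simps)
    from this[of "2 ^ k" "1 - cos 1"] show ?thesis
      using cos_1_less_1 by (simp add: lam_def power_one_over)
  qed
  have "summable (\<lambda>k. prob (D k))"
  proof (rule summable_comparison_test'[of _ 0])
    show "summable (\<lambda>k. 4 / ((1 - cos 1) * \<mu>\<^sup>2) * (1 / 2) ^ k)"
      by (intro summable_mult summable_geometric) simp
    show "norm (prob (D k)) \<le> 4 / ((1 - cos 1) * \<mu>\<^sup>2) * (1 / 2) ^ k" for k
      using D(3)[of k] unfolding eq by simp
  qed
  then have "AE \<omega> in M. eventually (\<lambda>k. \<omega> \<in> space M - D k) sequentially"
    by (intro borel_cantelli_AE1 D(1)) (auto simp: emeasure_eq_measure)
  then show ?thesis
  proof (eventually_elim)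
    case (elim \<omega>)
    then obtain n where n: "\<And>k. n \<le> k \<Longrightarrow> \<omega> \<in> space M - D k"
      by (auto simp: eventually_sequentially)
    have "\<mu> / 2 * t \<le> X t \<omega>" if t: "2 ^ n \<le> t" for t
    proof -
      have t1: "1 \<le> t" using t one_le_power[of "2::real" n] by linarith
      define k where "k = nat \<lfloor>log 2 t\<rfloor>"
      have l0: "0 \<le> log 2 t" using t1 by simp
      have "real n \<le> log 2 t" using t t1 by (simp add: le_log_iff powr_realpow)
      then have nk: "n \<le> k" using l0 by (simp add: k_def le_nat_floor)
      have "real k \<le> log 2 t" using l0 by (simp add: k_def)
      then have kt: "2 ^ k \<le> t" using t1 by (simp add: le_log_iff powr_realpow)
      have "log 2 t < real (Suc k)"
      proof -
        have "real k = real_of_int \<lfloor>log 2 t\<rfloor>" using l0 by (simp add: k_def)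
        then show ?thesis using real_of_int_floor_add_one_gt[of "log 2 t"] by linarith
      qed
      then have tk: "t < 2 ^ Suc k" using t1 by (subst (asm) log_less_iff) (auto simp: powr_realpow simp del: power_Suc of_nat_Suc)
      have "\<not> lam k \<le> \<bar>B t \<omega>\<bar>"
      proof
        assume "lam k \<le> \<bar>B t \<omega>\<bar>"
        then have "\<omega> \<in> {\<omega>\<in>space M. \<exists>u\<ge>0. u < 2 ^ Suc k \<and> lam k \<le> \<bar>B u \<omega>\<bar>}"
          using n[OF nk] t1 tk by (intro CollectI conjI exI[of _ t]) auto
        then show False using D(2) n[OF nk] by blast
      qed
      then have "\<bar>B t \<omega>\<bar> \<le> \<mu> / 2 * 2 ^ k" by (simp add: lam_def)
      also have "\<dots> \<le> \<mu> / 2 * t" using kt \<mu> by (intro mult_left_mono) auto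
      finally show ?thesis by (simp add: X_def abs_le_iff)
    qed
    then have ev: "eventually (\<lambda>t. \<mu> / 2 * t \<le> X t \<omega>) at_top"
      by (auto simp: eventually_at_top_linorder)
    have "filterlim (\<lambda>t. \<mu> / 2 * t) at_top at_top"
      using \<mu> by (intro filterlim_tendsto_pos_mult_at_top[OF tendsto_const] filterlim_ident) auto
    then show ?case by (rule filterlim_at_top_mono[OF _ ev])
  qed
qed

lemma scaled_C2:
  fixes f f' f'' :: "real \<Rightarrow> real"
  assumes "\<And>x. (f has_real_derivative f' x) (at x)" "\<And>x. (f' has_real_derivative f'' x) (at x)"
    "continuous_on UNIV f''"
  shows "((\<lambda>x. a * f x) has_real_derivative a * f' x) (at x)"
    "((\<lambda>x. a * f' x) has_real_derivative a * f'' x) (at x)" "continuous_on UNIV (\<lambda>x. a * f'' x)"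
  using assms by (auto intro!: derivative_eq_intros continuous_intros)

text \<open>Scaling \<open>f\<close> scales \<open>m\<close> linearly and \<open>q\<close>
  quadratically. It yields the maximal inequality for other thresholds and, later, the exponential
  martingale at every frequency.\<close>

lemma scaled_mart:
  fixes f f' f'' :: "real \<Rightarrow> real"
  assumes C2: "\<And>x. (f has_real_derivative f' x) (at x)" "\<And>x. (f' has_real_derivative f'' x) (at x)"
    "continuous_on UNIV f''"
  shows "mart (\<lambda>x. a * f x) (\<lambda>x. a * f' x) (\<lambda>x. a * f'' x) u \<omega> = a * mart f f' f'' u \<omega>"
    "qvar (\<lambda>x. a * f' x) u \<omega> = a\<^sup>2 * qvar f' u \<omega>"
proof -
  note C2' = scaled_C2[OF C2, of a]
  have d: "drift (\<lambda>x. a * f' x) (\<lambda>x. a * f'' x) = (\<lambda>x. a * drift f' f'' x)"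
    by (auto simp: drift_def[OF C2] drift_def[OF C2'] algebra_simps)
  show "mart (\<lambda>x. a * f x) (\<lambda>x. a * f' x) (\<lambda>x. a * f'' x) u \<omega> = a * mart f f' f'' u \<omega>"
    by (simp add: mart_def[OF C2] mart_def[OF C2'] d afun_def algebra_simps)
  show "qvar (\<lambda>x. a * f' x) u \<omega> = a\<^sup>2 * qvar f' u \<omega>"
    by (simp add: qvar_def[OF C2] qvar_def[OF C2'] afun_def power_mult_distrib)
qed

text \<open>If \<open>q\<close> is bounded, its growth after a late time is arbitrarily small, and
  the maximal inequality then makes an oscillation of \<open>m\<close> by a fixed amount improbable.
  Oscillation by 1 / (n + 1) after every time thus has probability 0, which is the Cauchy
  criterion.\<close>

theorem mart_converges:
  fixes f f' f'' :: "real \<Rightarrow> real"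
  assumes f': "\<And>x. (f has_real_derivative f' x) (at x)"
    and f'': "\<And>x. (f' has_real_derivative f'' x) (at x)"
    and cont_f'': "continuous_on UNIV f''"
  shows "AE \<omega> in M. (\<exists>c. \<forall>s\<ge>0. qvar f' s \<omega> \<le> c) \<longrightarrow> (\<exists>l. ((\<lambda>s. mart f f' f'' s \<omega>) \<longlongrightarrow> l) at_top)"
proof -
  note C2 = f' f'' cont_f''
  let ?m = "mart f f' f''" and ?q = "qvar f'"
  define osc where "osc n s \<omega> \<longleftrightarrow> (\<exists>u\<ge>s. 1 \<le> real (Suc n) * \<bar>?m u \<omega> - ?m s \<omega>\<bar>)" for n :: nat and s \<omega>
  have max: "covered {\<omega>\<in>space M. \<exists>u\<ge>s. 1 \<le> real (Suc n) * \<bar>?m u \<omega> - ?m s \<omega>\<bar> \<and> (real (Suc n))\<^sup>2 * (?q u \<omega> - ?q s \<omega>) < \<delta>}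
      (\<delta> / (2 * (1 - cos 1)))" if s: "0 \<le> s" and \<delta>: "0 < \<delta>" for n s \<delta>
  proof -
    define a where "a = real (Suc n)"
    have a: "0 < a" by (simp add: a_def)
    have e: "\<bar>a * x\<bar> = a * \<bar>x\<bar>" for x
      using a by (simp add: abs_mult)
    show ?thesis
      using maximal_inequality[OF scaled_C2[OF C2, of a] s \<delta>]
      unfolding scaled_mart[OF C2] right_diff_distrib[symmetric] e unfolding a_def .
  qed
  have "AE \<omega> in M. \<not> ((\<exists>c. \<forall>s\<ge>0. ?q s \<omega> \<le> c) \<and> (\<forall>k::nat. osc n (real k) \<omega>))" for n
  proof -
    let ?bad = "{\<omega>\<in>space M. (\<exists>c. \<forall>s\<ge>0. ?q s \<omega> \<le> c) \<and> (\<forall>k::nat. osc n (real k) \<omega>)}"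
    \<comment> \<open>The threshold for \<open>m\<close> stays fixed while the allowed growth
      \<delta> of \<open>q\<close> is arbitrary; letting \<delta> tend to 0 exhibits the bad set as
      a subset of a null set.\<close>
    have cover: "covered ?bad (\<delta> / (2 * (1 - cos 1)))" if \<delta>: "0 < \<delta>" for \<delta>
    proof -
      have "\<forall>k. covered {\<omega>\<in>space M. \<exists>u\<ge>real k. 1 \<le> real (Suc n) * \<bar>?m u \<omega> - ?m (real k) \<omega>\<bar> \<and> (real (Suc n))\<^sup>2 * (?q u \<omega> - ?q (real k) \<omega>) < \<delta>}
        (\<delta> / (2 * (1 - cos 1)))"
        by (intro allI max \<delta>) simp
      from covered_choice[OF this] obtain D where D': "\<forall>k. D k \<in> events \<and>
        {\<omega>\<in>space M. \<exists>u\<ge>real k. 1 \<le> real (Suc n) * \<bar>?m u \<omega> - ?m (real k) \<omega>\<bar> \<and> (real (Suc n))\<^sup>2 * (?q u \<omega> - ?q (real k) \<omega>) < \<delta>} \<subseteq> D k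
        \<and> prob (D k) \<le> \<delta> / (2 * (1 - cos 1))" by (elim exE)
      note D = D'[THEN spec, THEN conjunct1] D'[THEN spec, THEN conjunct2, THEN conjunct1]
        D'[THEN spec, THEN conjunct2, THEN conjunct2]
      show ?thesis
      proof (rule liminf_cover[OF D(1,3)], rule subsetI)
        fix \<omega> assume "\<omega> \<in> ?bad"
        then obtain c where \<omega>: "\<omega> \<in> space M" and c: "\<And>s. 0 \<le> s \<Longrightarrow> ?q s \<omega> \<le> c" and osc: "\<And>k::nat. osc n (real k) \<omega>"
          by blast
        define \<eta> where "\<eta> = \<delta> / (real (Suc n))\<^sup>2"
        have \<eta>: "0 < \<eta>" using \<delta> by (simp add: \<eta>_def)
        \<comment> \<open>Once \<open>q\<close> is within \<eta> of its supremum, every later growth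
          is below \<eta>, and \<eta> is \<delta> adjusted to the scaling by n + 1.\<close>
        define Q where "Q = (SUP s\<in>{0..}. ?q s \<omega>)"
        have bdd: "bdd_above ((\<lambda>s. ?q s \<omega>) ` {0..})" using c by (auto intro!: bdd_aboveI[of _ c])
        have Qu: "?q s \<omega> \<le> Q" if "0 \<le> s" for s
          unfolding Q_def using that bdd by (intro cSUP_upper) auto
        have "\<exists>s\<in>{0..}. Q - \<eta> < ?q s \<omega>"
          unfolding Q_def using \<eta> bdd by (subst less_cSUP_iff[symmetric]) auto
        then obtain s where s: "0 \<le> s" "Q - \<eta> < ?q s \<omega>" by auto
        obtain k :: nat where k: "s \<le> real k" using real_arch_simple by blast
        have "\<omega> \<in> D j" if j: "k \<le> j" for j
        proof -
          obtain u where u: "real j \<le> u" "1 \<le> real (Suc n) * \<bar>?m u \<omega> - ?m (real j) \<omega>\<bar>"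
            using osc[of j] by (auto simp: osc_def)
          have "s \<le> real j" using k j by simp
          then have "?q s \<omega> \<le> ?q (real j) \<omega>" by (rule qvar_mono[OF C2 \<omega> s(1)])
          moreover have "?q u \<omega> \<le> Q" using u(1) by (intro Qu) linarith
          ultimately have "?q u \<omega> - ?q (real j) \<omega> < \<eta>" using s(2) by linarith
          then have "(real (Suc n))\<^sup>2 * (?q u \<omega> - ?q (real j) \<omega>) < \<delta>"
            by (simp add: \<eta>_def pos_less_divide_eq mult.commute del: of_nat_Suc)
          then show ?thesis using D(2)[of j] u \<omega> by blast
        qed
        then show "\<omega> \<in> (\<Union>k. \<Inter>j\<in>{k..}. D j)" by blast
      qed
    qed
    have "\<forall>i::nat. covered ?bad ((1 / real (Suc i)) / (2 * (1 - cos 1)))"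
      by (intro allI cover) simp
    from covered_choice[OF this] obtain D where D': "\<forall>i. D i \<in> events \<and> ?bad \<subseteq> D i \<and>
      prob (D i) \<le> (1 / real (Suc i)) / (2 * (1 - cos 1))" by (elim exE)
    note D = D'[THEN spec, THEN conjunct1] D'[THEN spec, THEN conjunct2, THEN conjunct1]
      D'[THEN spec, THEN conjunct2, THEN conjunct2]
    have ev: "(\<Inter>i. D i) \<in> events" using D(1) by auto
    have "prob (\<Inter>i. D i) \<le> (1 / real (Suc i)) / (2 * (1 - cos 1))" for i
      using D(1) by (intro order_trans[OF finite_measure_mono D(3)[of i]]) auto
    moreover have "(\<lambda>i. (1 / real (Suc i)) / (2 * (1 - cos 1))) \<longlonglongrightarrow> 0 / (2 * (1 - cos 1))"
      using cos_1_less_1 by (intro tendsto_divide LIMSEQ_Suc[OF lim_1_over_n] tendsto_const) auto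
    ultimately have "prob (\<Inter>i. D i) \<le> 0"
      by (intro LIMSEQ_le_const[of "\<lambda>i. (1 / real (Suc i)) / (2 * (1 - cos 1))"]) auto
    then have "prob (\<Inter>i. D i) = 0" using measure_nonneg[of M "\<Inter>i. D i"] by linarith
    then have "emeasure M (\<Inter>i. D i) = 0" by (simp add: emeasure_eq_measure)
    with ev show ?thesis
      using D(2) by (intro AE_I[of _ _ "\<Inter>i. D i"]) auto
  qed
  then have "AE \<omega> in M. \<forall>n. \<not> ((\<exists>c. \<forall>s\<ge>0. ?q s \<omega> \<le> c) \<and> (\<forall>k::nat. osc n (real k) \<omega>))"
    by (subst AE_all_countable) blast
  then show ?thesis
  proof eventually_elim
    case (elim \<omega>)
    show ?case
    proof
    assume "\<exists>c. \<forall>s\<ge>0. ?q s \<omega> \<le> c"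
    with elim have no: "\<exists>k::nat. \<not> osc n (real k) \<omega>" for n by blast
    have "cauchy_filter (filtermap (\<lambda>s. ?m s \<omega>) at_top)"
      unfolding cauchy_filter_metric_filtermap
    proof (intro allI impI)
      fix e :: real assume e: "0 < e"
      obtain n :: nat where n: "2 / e < real (Suc n)"
        using reals_Archimedean2[of "2 / e"] by (metis less_Suc_eq of_nat_less_iff order_less_trans)
      obtain k :: nat where k: "\<not> osc n (real k) \<omega>" using no by blast
      have lt: "\<bar>?m u \<omega> - ?m (real k) \<omega>\<bar> < e / 2" if "real k \<le> u" for u
      proof -
        have "real (Suc n) * \<bar>?m u \<omega> - ?m (real k) \<omega>\<bar> < 1"
          using k that unfolding osc_def by force
        then have "\<bar>?m u \<omega> - ?m (real k) \<omega>\<bar> < 1 / real (Suc n)"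
          by (simp add: field_simps del: of_nat_Suc)
        also have "1 / real (Suc n) \<le> e / 2"
          using n e by (simp add: field_simps del: of_nat_Suc)
        finally show ?thesis .
      qed
      show "\<exists>P. eventually P at_top \<and> (\<forall>x y. P x \<and> P y \<longrightarrow> dist (?m x \<omega>) (?m y \<omega>) < e)"
      proof (intro exI[of _ "\<lambda>u. real k \<le> u"] conjI allI impI)
        show "eventually (\<lambda>u. real k \<le> u) at_top" by (rule eventually_ge_at_top)
        fix x y assume "real k \<le> x \<and> real k \<le> y"
        then show "dist (?m x \<omega>) (?m y \<omega>) < e"
          using lt[of x] lt[of y] unfolding dist_real_def by linarith
      qed
    qed
    then have "\<exists>l. filtermap (\<lambda>s. ?m s \<omega>) at_top \<le> nhds l"
      by (rule cauchy_filter_complete_converges[of _ UNIV]) (auto simp: complete_UNIV trivial_limit_at_top_linorder filtermap_bot_iff)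
    then show "\<exists>l. ((\<lambda>s. ?m s \<omega>) \<longlongrightarrow> l) at_top" by (auto simp: filterlim_def)
    qed
  qed
qed

end

section \<open>Finiteness of the total clock\<close>

text \<open>The exact value for x > 0 is 1 / \<mu>. The surplus comes from enlarging 1 / sqrt u to 2
  v' / \<mu>: the added term is 1 / \<mu> times the density of the first passage time to x, which
  has mass 1.\<close>

lemma green_density_bound:
  assumes \<mu>: "0 < \<mu>" and x: "0 < x"
  shows "(\<integral>\<^sup>+u. ennreal (normal_density (\<mu> * u) (sqrt u) x) * indicator {0<..} u \<partial>lborel) \<le> ennreal (2 / \<mu>)"
proof -
  define f where "f u = ennreal (normal_density (\<mu> * u) (sqrt u) x)" for u
  have f[measurable]: "f \<in> borel_measurable borel"
    unfolding f_def normal_density_def by measurable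
  \<comment> \<open>Since \<open>v\<^sup>2 = (x - \<mu> u)\<^sup>2 / u\<close> and \<open>1 / sqrt u \<le> 2 v' / \<mu>\<close>, the substitution \<open>v\<close> bounds the
    integral by \<open>2 / \<mu>\<close> times a Gaussian mass.\<close>
  define v where "v u = \<mu> * sqrt u - x / sqrt u" for u
  define v' where "v' u = \<mu> / (2 * sqrt u) + x / (2 * u * sqrt u)" for u
  have le: "(\<integral>\<^sup>+u. f u * indicator {a..b} u \<partial>lborel) \<le> ennreal (2 / \<mu>)" if ab: "0 < a" "a \<le> b" for a b
  proof -
    have v': "(v has_real_derivative v' u) (at u)" if "u \<in> {a..b}" for u
      using that ab unfolding v_def v'_def
      by (auto intro!: derivative_eq_intros simp: field_simps)
    have c: "continuous_on {a..b} v'"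
      using ab unfolding v'_def by (intro continuous_intros) auto
    have nonneg: "0 \<le> v' u" if "u \<in> {a..b}" for u
      using that ab \<mu> x by (auto simp: v'_def)
    have "(\<integral>\<^sup>+u. f u * indicator {a..b} u \<partial>lborel) \<le> (\<integral>\<^sup>+u. ennreal (2 / \<mu>) * ennreal (std_normal_density (v u) * v' u * indicator {a..b} u) \<partial>lborel)"
    proof (rule nn_integral_mono)
      fix u
      show "f u * indicator {a..b} u \<le> ennreal (2 / \<mu>) * ennreal (std_normal_density (v u) * v' u * indicator {a..b} u)"
      proof (cases "u \<in> {a..b}")
        case True
        then have u: "0 < u" using ab by auto
        have vv: "(v u)\<^sup>2 = (x - \<mu> * u)\<^sup>2 / u"
        proof -
          have "v u = (\<mu> * u - x) / sqrt u"
          proof -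
            have "(\<mu> * u - x) / sqrt u = \<mu> * (u / sqrt u) - x / sqrt u" by (simp add: diff_divide_distrib)
            also have "u / sqrt u = sqrt u" using u by (intro real_div_sqrt) simp
            finally show ?thesis by (simp add: v_def)
          qed
          then have "(v u)\<^sup>2 = ((\<mu> * u - x) / sqrt u)\<^sup>2" by (rule arg_cong)
          also have "\<dots> = (\<mu> * u - x)\<^sup>2 / (sqrt u)\<^sup>2" by (rule power_divide)
          also have "(sqrt u)\<^sup>2 = u" using u by simp
          also have "(\<mu> * u - x)\<^sup>2 = (x - \<mu> * u)\<^sup>2" by (rule power2_commute)
          finally show ?thesis .
        qed
        have "normal_density (\<mu> * u) (sqrt u) x = std_normal_density (v u) * (1 / sqrt u)"
          using u by (simp add: normal_density_def vv real_sqrt_mult)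
        also have "\<dots> \<le> std_normal_density (v u) * (2 / \<mu> * v' u)"
        proof (rule mult_left_mono)
          have "2 / \<mu> * v' u = 1 / sqrt u + 2 / \<mu> * (x / (2 * u * sqrt u))"
            using \<mu> by (simp add: v'_def distrib_left)
          then show "1 / sqrt u \<le> 2 / \<mu> * v' u" using \<mu> x u by simp
        qed simp
        finally have "normal_density (\<mu> * u) (sqrt u) x \<le> 2 / \<mu> * (std_normal_density (v u) * v' u)"
          by (simp add: mult_ac)
        then have "f u \<le> ennreal (2 / \<mu> * (std_normal_density (v u) * v' u))"
          unfolding f_def by (rule ennreal_leI)
        also have "\<dots> = ennreal (2 / \<mu>) * ennreal (std_normal_density (v u) * v' u)"
          using \<mu> by (intro ennreal_mult') simp
        finally show ?thesis using True by simp
      qed simp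
    qed
    also have "\<dots> = ennreal (2 / \<mu>) * (\<integral>\<^sup>+u. ennreal (std_normal_density (v u) * v' u * indicator {a..b} u) \<partial>lborel)"
    proof (rule nn_integral_cmult)
      have "v \<in> borel_measurable borel" "v' \<in> borel_measurable borel"
        unfolding v_def v'_def by measurable
      then show "(\<lambda>u. ennreal (std_normal_density (v u) * v' u * indicator {a..b} u)) \<in> borel_measurable lborel"
        by measurable
    qed
    also have "(\<integral>\<^sup>+u. ennreal (std_normal_density (v u) * v' u * indicator {a..b} u) \<partial>lborel) =
      (\<integral>\<^sup>+y. ennreal (std_normal_density y * indicator {v a..v b} y) \<partial>lborel)"
      by (rule nn_integral_substitution[OF _ v' c nonneg ab(2), symmetric])
         (auto simp: set_borel_measurable_def)
    also have "\<dots> \<le> (\<integral>\<^sup>+y. ennreal (std_normal_density y) \<partial>lborel)"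
      by (intro nn_integral_mono ennreal_leI) (auto simp: indicator_def)
    also have "\<dots> = 1"
      by (subst nn_integral_eq_integral) auto
    finally show ?thesis by (simp add: mult_left_mono)
  qed
  \<comment> \<open>The substitution is singular at u = 0, so the half-line is exhausted by compact
    intervals that stay away from it.\<close>
  define A where "A n = {1 / real (Suc n)..real (Suc n)}" for n
  have "(\<integral>\<^sup>+u. f u * indicator {0<..} u \<partial>lborel) = emeasure (density lborel f) (\<Union>n. A n)"
  proof -
    have "(\<Union>n. A n) = {0<..}"
    proof (intro equalityI subsetI)
      fix u :: real assume "u \<in> {0<..}"
      then have u: "0 < u" by simp
      obtain n :: nat where n: "max u (1 / u) < real n" using reals_Archimedean2 by blast
      then have "1 / u < real (Suc n)" by simp
      then have "1 < real (Suc n) * u" using u by (simp add: pos_divide_less_eq del: of_nat_Suc)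
      then have "1 / real (Suc n) \<le> u" by (simp add: pos_divide_le_eq mult.commute del: of_nat_Suc)
      then show "u \<in> (\<Union>n. A n)" using n by (intro UN_I[of n]) (auto simp: A_def)
    next
      fix u assume "u \<in> (\<Union>n. A n)"
      then obtain n where "1 / real (Suc n) \<le> u" by (auto simp: A_def)
      moreover have "0 < 1 / real (Suc n)" by simp
      ultimately have "0 < u" by (rule order_less_le_trans[rotated])
      then show "u \<in> {0<..}" by simp
    qed
    then show ?thesis by (simp add: emeasure_density)
  qed
  also have "\<dots> = (SUP n. emeasure (density lborel f) (A n))"
  proof (rule SUP_emeasure_incseq[symmetric])
    show "incseq A"
    proof (rule incseq_SucI)
      fix n
      have "1 / real (Suc (Suc n)) \<le> 1 / real (Suc n)" by (rule divide_left_mono) auto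
      then show "A n \<subseteq> A (Suc n)" unfolding A_def by auto
    qed
  qed (auto simp: A_def)
  also have "\<dots> \<le> ennreal (2 / \<mu>)"
  proof (rule SUP_least)
    fix n
    have "emeasure (density lborel f) (A n) = (\<integral>\<^sup>+u. f u * indicator (A n) u \<partial>lborel)"
      by (simp add: emeasure_density A_def)
    also have "\<dots> \<le> ennreal (2 / \<mu>)"
      unfolding A_def
    proof (rule le)
      have "1 / real (Suc n) \<le> 1" by simp
      also have "1 \<le> real (Suc n)" by simp
      finally show "1 / real (Suc n) \<le> real (Suc n)" .
    qed simp
    finally show "emeasure (density lborel f) (A n) \<le> ennreal (2 / \<mu>)" .
  qed
  finally show ?thesis unfolding f_def .
qed

context brownian_filtration
begin

lemma X_pair_measurable: "(\<lambda>(\<omega>, u). X (max 0 u) \<omega>) \<in> borel_measurable (M \<Otimes>\<^sub>M lborel)"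
proof (rule borel_measurable_LIMSEQ_metric)
  show "(\<lambda>(\<omega>, u). X (min (real n) (max 0 u)) \<omega>) \<in> borel_measurable (M \<Otimes>\<^sub>M lborel)" for n
    by (rule borel_measurable_pair_continuous) (auto intro: X_meas X_cont_on)
  fix p :: "'a \<times> real"
  obtain n :: nat where n: "snd p \<le> real n" using real_arch_simple by blast
  show "(\<lambda>n. case p of (\<omega>, u) \<Rightarrow> X (min (real n) (max 0 u)) \<omega>) \<longlonglongrightarrow> (case p of (\<omega>, u) \<Rightarrow> X (max 0 u) \<omega>)"
  proof (rule tendsto_eventually, rule eventually_sequentiallyI)
    fix k assume "n \<le> k"
    then have "max 0 (snd p) \<le> real k" using n by auto
    then show "(case p of (\<omega>, u) \<Rightarrow> X (min (real k) (max 0 u)) \<omega>) = (case p of (\<omega>, u) \<Rightarrow> X (max 0 u) \<omega>)"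
      by (simp add: case_prod_beta' min_absorb2)
  qed
qed

lemma X_distributed:
  assumes "0 < u" shows "distributed M lborel (X u) (normal_density (\<mu> * u) (sqrt u))"
proof -
  have "distributed M lborel (\<lambda>\<omega>. \<mu> * u + 1 * (B u \<omega> - B 0 \<omega>)) (normal_density (\<mu> * u + 1 * 0) (\<bar>1\<bar> * sqrt u))"
    using B_incr[of 0 u] assms by (intro normal_density_affine) auto
  also have "?this \<longleftrightarrow> distributed M lborel (X u) (normal_density (\<mu> * u) (sqrt u))"
    unfolding distributed_def
    by (intro conj_cong arg_cong2[where f="(=)"] distr_cong measurable_cong) (auto simp: X_def B_0)
  finally show ?thesis .
qed

text \<open>Tonelli, used twice, turns the expected time integral of w(X) into the integral of w
  against the Green density. The restriction to positive values of \<open>X\<close> matches the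
  range of x on which that density has been bounded.\<close>

lemma occupation_bound:
  assumes \<mu>: "0 < \<mu>" and w[measurable]: "w \<in> borel_measurable borel"
  shows "(\<integral>\<^sup>+\<omega>. (\<integral>\<^sup>+u. w (X (max 0 u) \<omega>) * indicator {0<..} (X (max 0 u) \<omega>) * indicator {0<..} u \<partial>lborel) \<partial>M)
    \<le> ennreal (2 / \<mu>) * (\<integral>\<^sup>+x. w x * indicator {0<..} x \<partial>lborel)"
proof -
  interpret pair_sigma_finite M lborel by unfold_locales
  note [measurable] = X_pair_measurable
  define g where "g \<omega> u = w (X (max 0 u) \<omega>) * indicator {0<..} (X (max 0 u) \<omega>) * indicator {0<..} u" for \<omega> u
  have g: "(\<lambda>(\<omega>, u). g \<omega> u) \<in> borel_measurable (M \<Otimes>\<^sub>M lborel)"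
    unfolding g_def by measurable
  define p where "p u x = ennreal (normal_density (\<mu> * u) (sqrt u) x) * indicator {0<..} u" for u x :: real
  have p[measurable]: "(\<lambda>(u, x). p u x) \<in> borel_measurable (lborel \<Otimes>\<^sub>M lborel)"
    unfolding p_def normal_density_def by measurable
  have p'[measurable]: "(\<lambda>(u, x). p u x * (w x * indicator {0<..} x)) \<in> borel_measurable (lborel \<Otimes>\<^sub>M lborel)"
    by measurable
  have "(\<integral>\<^sup>+\<omega>. (\<integral>\<^sup>+u. g \<omega> u \<partial>lborel) \<partial>M) = (\<integral>\<^sup>+u. (\<integral>\<^sup>+\<omega>. g \<omega> u \<partial>M) \<partial>lborel)"
    using Fubini'[OF g] by simp
  also have "\<dots> = (\<integral>\<^sup>+u. (\<integral>\<^sup>+x. p u x * (w x * indicator {0<..} x) \<partial>lborel) \<partial>lborel)"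
  proof (rule nn_integral_cong)
    fix u :: real
    show "(\<integral>\<^sup>+\<omega>. g \<omega> u \<partial>M) = (\<integral>\<^sup>+x. p u x * (w x * indicator {0<..} x) \<partial>lborel)"
    proof (cases "0 < u")
      case True
      have "(\<integral>\<^sup>+x. ennreal (normal_density (\<mu> * u) (sqrt u) x) * (w x * indicator {0<..} x) \<partial>lborel) =
        (\<integral>\<^sup>+\<omega>. w (X u \<omega>) * indicator {0<..} (X u \<omega>) \<partial>M)"
        by (rule distributed_nn_integral[OF X_distributed[OF True]]) measurable
      then show ?thesis using True by (simp add: g_def p_def)
    qed (simp add: g_def p_def)
  qed
  also have "\<dots> = (\<integral>\<^sup>+x. (\<integral>\<^sup>+u. p u x * (w x * indicator {0<..} x) \<partial>lborel) \<partial>lborel)"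
    using lborel_pair.Fubini'[OF p'] by simp
  also have "\<dots> \<le> (\<integral>\<^sup>+x. ennreal (2 / \<mu>) * (w x * indicator {0<..} x) \<partial>lborel)"
  proof (rule nn_integral_mono)
    fix x :: real
    have "(\<integral>\<^sup>+u. p u x * (w x * indicator {0<..} x) \<partial>lborel) = (\<integral>\<^sup>+u. p u x \<partial>lborel) * (w x * indicator {0<..} x)"
      by (rule nn_integral_multc) measurable
    also have "\<dots> \<le> ennreal (2 / \<mu>) * (w x * indicator {0<..} x)"
    proof (cases "0 < x")
      case True
      then show ?thesis unfolding p_def by (intro mult_right_mono green_density_bound \<mu>) auto
    qed simp
    finally show "(\<integral>\<^sup>+u. p u x * (w x * indicator {0<..} x) \<partial>lborel) \<le> ennreal (2 / \<mu>) * (w x * indicator {0<..} x)" .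
  qed
  also have "\<dots> = ennreal (2 / \<mu>) * (\<integral>\<^sup>+x. w x * indicator {0<..} x \<partial>lborel)"
    by (rule nn_integral_cmult) measurable
  finally show ?thesis unfolding g_def .
qed

text \<open>Since \<open>X\<close> tends to infinity, the path is above b after some finite time.
  The clock up to that time is finite by continuity; the remainder is dominated by an occupation
  integral with finite expectation.\<close>

theorem total_clock_finite:
  assumes \<mu>: "0 < \<mu>" and g: "continuous_on UNIV g"
    and int: "set_integrable lborel {a..} (\<lambda>x. (g x)\<^sup>2)"
  shows "AE \<omega> in M. total_clock g X \<omega> < \<infinity>"
proof -
  \<comment> \<open>The maximum with 1 makes b positive, so that values of \<open>X\<close> above b
    meet the restriction in \<open>occupation_bound\<close>.\<close>
  define b where "b = max a 1"
  define w where "w x = ennreal ((g x)\<^sup>2) * indicator {b..} x" for x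
  have [measurable]: "g \<in> borel_measurable borel" using g by (rule borel_measurable_continuous_onI)
  have wm[measurable]: "w \<in> borel_measurable borel" unfolding w_def by measurable
  note [measurable] = X_pair_measurable
  let ?O = "\<lambda>\<omega>. \<integral>\<^sup>+u. w (X (max 0 u) \<omega>) * indicator {0<..} (X (max 0 u) \<omega>) * indicator {0<..} u \<partial>lborel"
  have "(\<integral>\<^sup>+x. w x * indicator {0<..} x \<partial>lborel) \<le> (\<integral>\<^sup>+x. ennreal (norm (indicator {a..} x *\<^sub>R (g x)\<^sup>2)) \<partial>lborel)"
    by (intro nn_integral_mono) (auto simp: w_def b_def indicator_def)
  also have "\<dots> < \<infinity>"
    using int unfolding set_integrable_def by (simp add: integrable_iff_bounded)
  finally have "ennreal (2 / \<mu>) * (\<integral>\<^sup>+x. w x * indicator {0<..} x \<partial>lborel) < \<infinity>"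
    by (simp add: ennreal_mult_less_top)
  with occupation_bound[OF \<mu> wm] have "(\<integral>\<^sup>+\<omega>. ?O \<omega> \<partial>M) < \<infinity>"
    by (rule le_less_trans)
  then have "AE \<omega> in M. ?O \<omega> \<noteq> \<infinity>"
    by (intro nn_integral_noteq_infinite) auto
  with X_tendsto_infinity[OF \<mu>] show ?thesis
    using AE_space
  proof eventually_elim
    case (elim \<omega>)
    obtain s where s: "\<And>t. s \<le> t \<Longrightarrow> b \<le> X t \<omega>"
      using elim(1) by (auto simp: filterlim_at_top eventually_at_top_linorder)
    define s0 where "s0 = max s 0"
    let ?h = "\<lambda>u. ennreal ((g (X u \<omega>))\<^sup>2)"
    have c: "continuous_on {0..s0} (\<lambda>u. (g (X u \<omega>))\<^sup>2)"
      by (intro continuous_intros comp_X_cont g elim) auto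
    have "bounded ((\<lambda>u. (g (X u \<omega>))\<^sup>2) ` {0..s0})"
      by (intro compact_imp_bounded compact_continuous_image c) auto
    then obtain C where "\<forall>u\<in>{0..s0}. norm ((g (X u \<omega>))\<^sup>2) \<le> C"
      by (auto simp: bounded_iff)
    then have C: "(g (X u \<omega>))\<^sup>2 \<le> C" if "u \<in> {0..s0}" for u
      using that by simp
    have "total_clock g X \<omega> \<le> (\<integral>\<^sup>+u. ennreal C * indicator {0..s0} u + w (X (max 0 u) \<omega>) * indicator {0<..} (X (max 0 u) \<omega>) * indicator {0<..} u \<partial>lborel)"
      unfolding total_clock_def
    proof (rule nn_integral_mono)
      fix u :: real
      show "?h u * indicator {0..} u \<le> ennreal C * indicator {0..s0} u + w (X (max 0 u) \<omega>) * indicator {0<..} (X (max 0 u) \<omega>) * indicator {0<..} u"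
      proof (cases "u \<in> {0..s0}")
        case True
        then have "?h u \<le> ennreal C" using C by (intro ennreal_leI) auto
        then show ?thesis using True by (simp add: add_increasing2)
      next
        case False
        show ?thesis
        proof (cases "0 \<le> u")
          case True
          with False have u: "s0 < u" "0 < u" by (auto simp: s0_def)
          then have "b \<le> X u \<omega>" using s[of u] by (auto simp: s0_def)
          then show ?thesis using u by (simp add: w_def b_def)
        qed simp
      qed
    qed
    also have "\<dots> = ennreal C * emeasure lborel {0..s0} + ?O \<omega>"
    proof (subst nn_integral_add)
      have "(\<lambda>u. (\<lambda>(\<omega>, u). X (max 0 u) \<omega>) (\<omega>, u)) \<in> borel_measurable lborel"
        using elim(3) by (intro measurable_compose[OF _ X_pair_measurable]) measurable
      then have [measurable]: "(\<lambda>u. X (max 0 u) \<omega>) \<in> borel_measurable lborel" by simp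
      show "(\<lambda>u. w (X (max 0 u) \<omega>) * indicator {0<..} (X (max 0 u) \<omega>) * indicator {0<..} u) \<in> borel_measurable lborel"
        by measurable
    qed (auto simp: nn_integral_cmult_indicator)
    also have "\<dots> < \<infinity>"
      using elim(2) by (simp add: s0_def ennreal_mult_less_top less_top[symmetric] ennreal_mult_eq_top_iff)
    finally show ?case .
  qed
qed

end

section \<open>The time change of a single path\<close>

text \<open>Everything here is deterministic calculus along one path. As \<open>g\<close> has no
  zero, the clock is strictly increasing, so its right-continuous inverse is a genuine continuous
  inverse.\<close>

locale clock_path =
  fixes g :: "real \<Rightarrow> real" and X :: "real \<Rightarrow> 'a \<Rightarrow> real" and \<omega> :: 'a
  assumes path_cont: "continuous_on {0..} (\<lambda>t. X t \<omega>)"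
    and g_cont: "continuous_on UNIV g"
    and g_nonzero: "g x \<noteq> 0"
begin

definition I :: "real \<Rightarrow> real" where "I s = integral {0..s} (\<lambda>u. (g (X u \<omega>))\<^sup>2)"

definition \<alpha> :: "real \<Rightarrow> real" where "\<alpha> t = enn2real (inverse_clock g X t \<omega>)"

abbreviation "\<tau> \<equiv> total_clock g X \<omega>"

lemma comp_path_cont:
  assumes "continuous_on UNIV w" "A \<subseteq> {0..}"
  shows "continuous_on A (\<lambda>u. w (X u \<omega>))"
  using continuous_on_compose2[OF assms(1) continuous_on_subset[OF path_cont assms(2)]] by simp

lemma g2_cont: "A \<subseteq> {0..} \<Longrightarrow> continuous_on A (\<lambda>u. (g (X u \<omega>))\<^sup>2)"
  by (intro continuous_intros comp_path_cont g_cont)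

lemma path_integral_deriv:
  fixes w :: "real \<Rightarrow> real"
  assumes "continuous_on UNIV w" "0 < s"
  shows "((\<lambda>s. integral {0..s} (\<lambda>u. w (X u \<omega>))) has_real_derivative w (X s \<omega>)) (at s)"
proof -
  have "((\<lambda>s. integral {0..s} (\<lambda>u. w (X u \<omega>))) has_real_derivative w (X s \<omega>)) (at s within {0..s + 1})"
    using assms by (intro integral_has_real_derivative comp_path_cont) auto
  moreover have "at s within {0..s + 1} = at s"
    using assms by (intro at_within_interior) auto
  ultimately show ?thesis by simp
qed

lemma path_integral_cont:
  fixes w :: "real \<Rightarrow> real"
  assumes "continuous_on UNIV w"
  shows "continuous_on {0..} (\<lambda>s. integral {0..s} (\<lambda>u. w (X u \<omega>)))"
  by (rule continuous_on_atLeastI)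
     (intro indefinite_integral_continuous_1 integrable_continuous_real comp_path_cont assms; simp)

lemma I_deriv: "0 < s \<Longrightarrow> (I has_real_derivative (g (X s \<omega>))\<^sup>2) (at s)"
  using path_integral_deriv[of "\<lambda>x. (g x)\<^sup>2" s] g_cont
  unfolding I_def[abs_def] by (auto intro!: continuous_intros)

lemma I_cont: "continuous_on {0..} I"
  using path_integral_cont[of "\<lambda>x. (g x)\<^sup>2"] g_cont
  unfolding I_def[abs_def] by (auto intro!: continuous_intros)

lemma I_0: "I 0 = 0" by (simp add: I_def)

lemma I_strict_mono:
  assumes "0 \<le> s" "s < t" shows "I s < I t"
proof (rule DERIV_pos_imp_increasing_open[OF assms(2)])
  show "\<exists>y. (I has_real_derivative y) (at x) \<and> 0 < y" if "s < x" "x < t" for x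
    using I_deriv[of x] that assms g_nonzero by auto
  show "continuous_on {s..t} I"
    using I_cont by (rule continuous_on_subset) (use assms in auto)
qed

lemma I_mono: "0 \<le> s \<Longrightarrow> s \<le> t \<Longrightarrow> I s \<le> I t"
  using I_strict_mono[of s t] by (cases "s = t") auto

lemma I_le_iff: "0 \<le> s \<Longrightarrow> 0 \<le> t \<Longrightarrow> I s \<le> I t \<longleftrightarrow> s \<le> t"
  using I_strict_mono[of t s] I_mono[of s t] by (cases "s \<le> t") auto

lemma I_nonneg: "0 \<le> s \<Longrightarrow> 0 \<le> I s"
  using I_mono[of 0 s] I_0 by simp

lemma clock_eq: assumes "0 \<le> s" shows "clock g X s \<omega> = ennreal (I s)"
proof -
  have i: "set_integrable lborel {0..s} (\<lambda>u. (g (X u \<omega>))\<^sup>2)"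
    unfolding set_integrable_def by (intro borel_integrable_compact g2_cont) auto
  have "clock g X s \<omega> = (\<integral>\<^sup>+u. ennreal (indicator {0..s} u *\<^sub>R (g (X u \<omega>))\<^sup>2) \<partial>lborel)"
    unfolding clock_def by (intro nn_integral_cong) (auto simp: indicator_def)
  also have "\<dots> = ennreal (LINT u:{0..s}|lborel. (g (X u \<omega>))\<^sup>2)"
    unfolding set_lebesgue_integral_def
    using i by (intro nn_integral_eq_integral) (auto simp: set_integrable_def)
  also have "(LINT u:{0..s}|lborel. (g (X u \<omega>))\<^sup>2) = I s"
    unfolding I_def by (rule set_borel_integral_eq_integral(2)[OF i])
  finally show ?thesis .
qed

lemma total_clock_SUP: "\<tau> = (SUP n::nat. ennreal (I (real n)))"
proof -
  have "continuous_on UNIV (\<lambda>u. X (max 0 u) \<omega>)"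
    by (intro continuous_on_compose2[OF path_cont] continuous_intros) auto
  then have "continuous_on UNIV (\<lambda>u. (g (X (max 0 u) \<omega>))\<^sup>2)"
    by (intro continuous_intros continuous_on_compose2[OF g_cont]) auto
  then have h0: "(\<lambda>u. (g (X (max 0 u) \<omega>))\<^sup>2) \<in> borel_measurable lborel"
    by (simp add: borel_measurable_continuous_onI)
  then have h[measurable]: "(\<lambda>u. ennreal ((g (X (max 0 u) \<omega>))\<^sup>2)) \<in> borel_measurable lborel"
    by measurable
  let ?D = "density lborel (\<lambda>u. ennreal ((g (X (max 0 u) \<omega>))\<^sup>2))"
  have "(\<Union>n. {0..real n}) = {0..}" using real_arch_simple by auto
  then have "\<tau> = emeasure ?D (\<Union>n. {0..real n})"
    unfolding total_clock_def using h0
    by (subst emeasure_density) (auto intro!: nn_integral_cong simp: indicator_def)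
  also have "\<dots> = (SUP n. emeasure ?D {0..real n})"
    by (rule SUP_emeasure_incseq[symmetric]) (auto simp: incseq_def)
  also have "\<dots> = (SUP n. ennreal (I (real n)))"
  proof (intro SUP_cong refl)
    fix n
    have "emeasure ?D {0..real n} = clock g X (real n) \<omega>"
      unfolding clock_def using h0
      by (subst emeasure_density) (auto intro!: nn_integral_cong simp: indicator_def)
    then show "emeasure ?D {0..real n} = ennreal (I (real n))" by (simp add: clock_eq)
  qed
  finally show ?thesis .
qed

text \<open>The total clock is never attained at a finite time, because the clock keeps growing
  strictly. Hence the inverse clock is finite exactly below the total clock and the time-changed
  process lives on a half-open interval.\<close>

lemma I_less_total: assumes "0 \<le> s" shows "ennreal (I s) < \<tau>"
proof -
  obtain n :: nat where n: "s < real n" using reals_Archimedean2 by blast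
  have "ennreal (I s) < ennreal (I (real n))"
    using I_strict_mono[OF assms n] I_nonneg[OF assms] by (simp add: ennreal_lessI)
  also have "\<dots> \<le> \<tau>" unfolding total_clock_SUP by (rule SUP_upper) simp
  finally show ?thesis .
qed

lemma total_pos: "0 < \<tau>" using I_less_total[of 0] I_0 by simp

text \<open>By strict monotonicity the times whose clock exceeds I_s are exactly those after s; the
  infimum s is approached but not attained.\<close>

lemma inverse_clock_I:
  assumes s: "0 \<le> s" shows "inverse_clock g X (I s) \<omega> = ennreal s"
proof -
  have S: "{ennreal u | u. 0 \<le> u \<and> ennreal (I s) < clock g X u \<omega>} = {ennreal u | u. s < u}"
  proof -
    have "0 \<le> u \<and> ennreal (I s) < clock g X u \<omega> \<longleftrightarrow> s < u" for u
      using s I_le_iff[of u s] I_nonneg[OF s] by (auto simp: clock_eq ennreal_less_iff not_le[symmetric])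
    then show ?thesis by simp
  qed
  show ?thesis
    unfolding inverse_clock_def S
  proof (rule antisym)
    show "ennreal s \<le> Inf {ennreal u | u. s < u}"
      by (rule Inf_greatest) (auto intro: ennreal_leI)
    show "Inf {ennreal u | u. s < u} \<le> ennreal s"
    proof (rule ennreal_le_epsilon)
      fix e :: real assume "0 < e"
      then have "Inf {ennreal u | u. s < u} \<le> ennreal (s + e)"
        by (intro Inf_lower) auto
      then show "Inf {ennreal u | u. s < u} \<le> ennreal s + ennreal e"
        using s \<open>0 < e\<close> by (simp add: ennreal_plus)
    qed
  qed
qed

lemma \<alpha>_I: "0 \<le> s \<Longrightarrow> \<alpha> (I s) = s"
  by (simp add: \<alpha>_def inverse_clock_I)

lemma I_surj:
  assumes "0 \<le> t" "ennreal t < \<tau>" obtains s where "0 \<le> s" "I s = t"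
proof -
  obtain n :: nat where "ennreal t < ennreal (I (real n))"
    using assms(2) unfolding total_clock_SUP less_SUP_iff by auto
  then have "t \<le> I (real n)" using assms(1) by (simp add: ennreal_less_iff)
  moreover have "continuous_on {0..real n} I"
    using I_cont by (rule continuous_on_subset) auto
  ultimately show thesis
    using IVT'[of I 0 t "real n"] assms(1) I_0 that by auto
qed

lemma \<alpha>_props:
  assumes "0 \<le> t" "ennreal t < \<tau>"
  shows "0 \<le> \<alpha> t" "I (\<alpha> t) = t" "inverse_clock g X t \<omega> = ennreal (\<alpha> t)"
  using I_surj[OF assms] \<alpha>_I inverse_clock_I by metis+

lemma inverse_clock_infinite:
  assumes "\<not> ennreal t < \<tau>" shows "inverse_clock g X t \<omega> = \<infinity>"
proof -
  have e: "{ennreal s | s. 0 \<le> s \<and> ennreal t < clock g X s \<omega>} = {}"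
    using assms I_less_total by (auto simp: clock_eq dest: less_trans)
  show ?thesis unfolding inverse_clock_def e by simp
qed

lemma \<alpha>_le_iff:
  assumes "0 \<le> t" "ennreal t < \<tau>" "0 \<le> s" shows "\<alpha> t \<le> s \<longleftrightarrow> t \<le> I s"
  using I_le_iff[of "\<alpha> t" s] \<alpha>_props[OF assms(1,2)] assms(3) by simp

lemma \<alpha>_0: "\<alpha> 0 = 0" using \<alpha>_I[of 0] I_0 by simp

lemma \<alpha>_cont_I: "0 \<le> b \<Longrightarrow> continuous_on {0..I b} \<alpha>"
proof -
  assume b: "0 \<le> b"
  have c: "continuous_on {0..b} I" using I_cont by (rule continuous_on_subset) auto
  have "continuous_on (I ` {0..b}) \<alpha>"
    by (rule continuous_on_inv[OF c]) (auto simp: \<alpha>_I)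
  moreover have "{0..I b} \<subseteq> I ` {0..b}"
    using IVT'[OF _ _ b c] I_0 by force
  ultimately show ?thesis by (rule continuous_on_subset)
qed

lemma \<alpha>_cont_on: "0 \<le> t \<Longrightarrow> ennreal t < \<tau> \<Longrightarrow> continuous_on {0..t} \<alpha>"
  using \<alpha>_cont_I[of "\<alpha> t"] \<alpha>_props[of t] by simp

text \<open>The domain [0, \<tau>) is open on the right, so continuity and differentiability at t
  can be read off a compact interval reaching beyond t.\<close>

lemma above_in_domain:
  assumes "0 \<le> t" "ennreal t < \<tau>"
  obtains t' where "t < t'" "ennreal t' < \<tau>"
proof (rule that)
  show "t < I (\<alpha> t + 1)" using I_strict_mono[of "\<alpha> t" "\<alpha> t + 1"] \<alpha>_props[OF assms] by simp
  show "ennreal (I (\<alpha> t + 1)) < \<tau>" using \<alpha>_props[OF assms] by (intro I_less_total) simp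
qed

lemma \<alpha>_cont: "continuous_on {t. 0 \<le> t \<and> ennreal t < \<tau>} \<alpha>"
  unfolding continuous_on_def
proof
  fix t assume "t \<in> {t. 0 \<le> t \<and> ennreal t < \<tau>}"
  then have t: "0 \<le> t" "ennreal t < \<tau>" by auto
  obtain t' where t': "t < t'" "ennreal t' < \<tau>" using above_in_domain[OF t] .
  have dom: "ennreal u < \<tau>" if "u \<le> t'" for u
    using ennreal_leI[OF that] t'(2) by (rule le_less_trans)
  have "at t within {t. 0 \<le> t \<and> ennreal t < \<tau>} = at t within {0..t'}"
    using t' dom by (intro at_within_nhd[of t "{..<t'}"]) auto
  moreover have "continuous_on {0..t'} \<alpha>" using t t' by (intro \<alpha>_cont_on) auto
  ultimately show "(\<alpha> \<longlongrightarrow> \<alpha> t) (at t within {t. 0 \<le> t \<and> ennreal t < \<tau>})"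
    using t t' by (simp add: continuous_on_def)
qed

lemma \<alpha>_deriv:
  assumes "0 < t" "ennreal t < \<tau>"
  shows "(\<alpha> has_real_derivative inverse ((g (X (\<alpha> t) \<omega>))\<^sup>2)) (at t)"
proof -
  have t0: "0 \<le> t" using assms by simp
  obtain t' where t': "t < t'" "ennreal t' < \<tau>" using above_in_domain[OF t0 assms(2)] .
  have dom: "ennreal u < \<tau>" if "u \<le> t'" for u
    using ennreal_leI[OF that] t'(2) by (rule le_less_trans)
  have pos: "0 < \<alpha> t"
    using \<alpha>_props[OF t0 assms(2)] I_0 assms(1) by (metis less_eq_real_def less_irrefl)
  show ?thesis
  proof (rule DERIV_inverse_function[where f=I and a=0 and b=t'])
    show "(I has_real_derivative (g (X (\<alpha> t) \<omega>))\<^sup>2) (at (\<alpha> t))" using pos by (rule I_deriv)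
    show "(g (X (\<alpha> t) \<omega>))\<^sup>2 \<noteq> 0" using g_nonzero by simp
    show "I (\<alpha> y) = y" if "0 < y" "y < t'" for y using \<alpha>_props(2)[of y] dom[of y] that by simp
    have "continuous_on {0..t'} \<alpha>" using assms t' by (intro \<alpha>_cont_on) auto
    then show "isCont \<alpha> t"
      using assms t' by (intro continuous_on_interior[of "{0..t'}"]) auto
  qed (use assms t' in auto)
qed

lemma \<alpha>_tendsto_infinity:
  assumes "\<tau> = ennreal T" "0 \<le> T" shows "filterlim \<alpha> at_top (at_left T)"
  unfolding filterlim_at_top
proof
  fix c
  have T: "I (max 0 c) < T" using I_less_total[of "max 0 c"] assms I_nonneg[of "max 0 c"] by (simp add: ennreal_less_iff)
  have "eventually (\<lambda>t. t \<in> {I (max 0 c)<..<T}) (at_left T)"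
    using T by (rule eventually_at_leftI[rotated]) auto
  then show "eventually (\<lambda>t. c \<le> \<alpha> t) (at_left T)"
  proof eventually_elim
    case (elim t)
    have t: "0 \<le> t" "ennreal t < \<tau>"
      using elim I_nonneg[of "max 0 c"] assms by (auto simp: ennreal_less_iff)
    have "max 0 c \<le> \<alpha> t"
      using I_le_iff[of "max 0 c" "\<alpha> t"] \<alpha>_props[OF t] elim by simp
    then show ?case by simp
  qed
qed

text \<open>The substitution u = \<alpha>_r, whose derivative is 1 / g(X_u)^2. The fundamental
  theorem is used in its interior form, with differentiability required only inside [0, t].\<close>

lemma time_change_integral:
  fixes w :: "real \<Rightarrow> real"
  assumes w: "continuous_on UNIV w" and t: "0 \<le> t" "ennreal t < \<tau>"
  shows "set_integrable lborel {0..t} (\<lambda>r. w (X (\<alpha> r) \<omega>) / (g (X (\<alpha> r) \<omega>))\<^sup>2)"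
    and "(LINT r:{0..t}|lborel. w (X (\<alpha> r) \<omega>) / (g (X (\<alpha> r) \<omega>))\<^sup>2) = integral {0..\<alpha> t} (\<lambda>u. w (X u \<omega>))"
proof -
  have dom: "ennreal u < \<tau>" if "u \<le> t" for u
    using ennreal_leI[OF that] t(2) by (rule le_less_trans)
  have \<alpha>0: "\<alpha> ` {0..t} \<subseteq> {0..}" using \<alpha>_props(1) dom by auto
  have c: "continuous_on {0..t} (\<lambda>r. w' (X (\<alpha> r) \<omega>))" if "continuous_on UNIV w'" for w' :: "real \<Rightarrow> real"
    using continuous_on_compose2[OF comp_path_cont[OF that order_refl] \<alpha>_cont_on[OF t] \<alpha>0] .
  have cont: "continuous_on {0..t} (\<lambda>r. w (X (\<alpha> r) \<omega>) / (g (X (\<alpha> r) \<omega>))\<^sup>2)"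
    using g_nonzero by (intro continuous_intros c w g_cont) auto
  then show i: "set_integrable lborel {0..t} (\<lambda>r. w (X (\<alpha> r) \<omega>) / (g (X (\<alpha> r) \<omega>))\<^sup>2)"
    unfolding set_integrable_def by (intro borel_integrable_compact) auto
  let ?\<Phi> = "\<lambda>s. integral {0..s} (\<lambda>u. w (X u \<omega>))"
  have "((\<lambda>r. w (X (\<alpha> r) \<omega>) / (g (X (\<alpha> r) \<omega>))\<^sup>2) has_integral (?\<Phi> (\<alpha> t) - ?\<Phi> (\<alpha> 0))) {0..t}"
  proof (rule fundamental_theorem_of_calculus_interior[OF t(1)])
    show "continuous_on {0..t} (\<lambda>r. ?\<Phi> (\<alpha> r))"
      by (rule continuous_on_compose2[OF path_integral_cont[OF w] \<alpha>_cont_on[OF t] \<alpha>0])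
    fix r assume r: "r \<in> {0<..<t}"
    then have r': "0 < r" "ennreal r < \<tau>" using dom[of r] by auto
    have pos: "0 < \<alpha> r"
      using \<alpha>_props[of r] r' I_0 by (metis less_eq_real_def less_irrefl)
    have "((\<lambda>r. ?\<Phi> (\<alpha> r)) has_real_derivative w (X (\<alpha> r) \<omega>) * inverse ((g (X (\<alpha> r) \<omega>))\<^sup>2)) (at r)"
      by (rule DERIV_chain2[OF path_integral_deriv[OF w pos] \<alpha>_deriv[OF r']])
    then show "((\<lambda>r. ?\<Phi> (\<alpha> r)) has_vector_derivative w (X (\<alpha> r) \<omega>) / (g (X (\<alpha> r) \<omega>))\<^sup>2) (at r)"
      by (simp add: has_real_derivative_iff_has_vector_derivative divide_inverse)
  qed
  then have "integral {0..t} (\<lambda>r. w (X (\<alpha> r) \<omega>) / (g (X (\<alpha> r) \<omega>))\<^sup>2) = ?\<Phi> (\<alpha> t)"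
    by (simp add: \<alpha>_0 integral_unique)
  then show "(LINT r:{0..t}|lborel. w (X (\<alpha> r) \<omega>) / (g (X (\<alpha> r) \<omega>))\<^sup>2) = ?\<Phi> (\<alpha> t)"
    using set_borel_integral_eq_integral(2)[OF i] by simp
qed

end

section \<open>Independence and characteristic functions\<close>

lemma char_normal_density:
  assumes "0 < \<sigma>"
  shows "char (density lborel (normal_density 0 \<sigma>)) \<theta> = of_real (exp (- (\<theta>\<^sup>2 * \<sigma>\<^sup>2) / 2))"
proof -
  interpret std: prob_space std_normal_distribution
    by (rule prob_space_normal_density) simp
  have "distributed std_normal_distribution lborel (\<lambda>x. x) std_normal_density"
    by (auto simp: distributed_def distr_id2)
  then have "distributed std_normal_distribution lborel (\<lambda>x. 0 + \<sigma> * x) (normal_density (0 + \<sigma> * 0) (\<bar>\<sigma>\<bar> * 1))"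
    using assms by (intro std.normal_density_affine) auto
  then have "distr std_normal_distribution lborel (\<lambda>x. \<sigma> * x) = density lborel (normal_density 0 \<sigma>)"
    using assms by (simp add: distributed_def)
  then have "char (density lborel (normal_density 0 \<sigma>)) \<theta> = (CLINT x|distr std_normal_distribution lborel (\<lambda>x. \<sigma> * x). iexp (\<theta> * x))"
    by (simp add: char_def)
  also have "\<dots> = (CLINT x|std_normal_distribution. iexp (\<theta> * (\<sigma> * x)))"
    by (subst integral_distr) auto
  also have "\<dots> = char std_normal_distribution (\<theta> * \<sigma>)"
    by (simp add: char_def mult.assoc)
  finally show ?thesis
    by (simp add: char_std_normal_distribution power_mult_distrib)
qed

context prob_space
begin

text \<open>For C of positive probability the hypothesis says that the law of \<open>D\<close>
  conditioned on C has a Gaussian characteristic function; Levy uniqueness makes it the same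
  Gaussian law for all C. Taking C to be the whole space gives the law, and independence extends
  from the \<pi>-system to the \<sigma>-algebra it generates.\<close>

lemma normal_indep_of_char:
  fixes D :: "'a \<Rightarrow> real"
  assumes D[measurable]: "D \<in> borel_measurable M" and \<sigma>: "0 < \<sigma>"
    and C: "\<C> \<subseteq> events" "Int_stable \<C>" "space M \<in> \<C>"
    and char: "\<And>C \<theta>. C \<in> \<C> \<Longrightarrow>
      (\<integral>\<omega>. indicator C \<omega> * iexp (\<theta> * D \<omega>) \<partial>M) = of_real (prob C * exp (- (\<theta>\<^sup>2 * \<sigma>\<^sup>2) / 2))"
  shows "distributed M lborel D (normal_density 0 \<sigma>)"
    and "indep_set (sigma_sets (space M) \<C>) (sets (vimage_algebra (space M) D borel))"
proof -
  let ?\<nu> = "density lborel (normal_density 0 \<sigma>)"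
  interpret \<nu>: prob_space ?\<nu> by (rule prob_space_normal_density[OF \<sigma>])
  have real_\<nu>: "real_distribution ?\<nu>" by standard simp
  have law: "prob (C \<inter> (D -` S \<inter> space M)) = prob C * measure ?\<nu> S"
    if C': "C \<in> \<C>" and S: "S \<in> sets borel" for C S
  proof (cases "prob C = 0")
    case True
    have "prob (C \<inter> (D -` S \<inter> space M)) \<le> prob C"
      using C' C by (intro finite_measure_mono) auto
    then show ?thesis using True by (simp add: measure_le_0_iff)
  next
    case False
    have CM[measurable]: "C \<in> events" using C' C by auto
    have eC: "emeasure M C \<noteq> 0" "emeasure M C \<noteq> \<infinity>" using False by (auto simp: emeasure_eq_measure)
    interpret U: prob_space "uniform_measure M C" by (rule prob_space_uniform_measure[OF eC])
    have Dm: "D \<in> borel_measurable (uniform_measure M C)" by simp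
    have Ueq: "uniform_measure M C = density M (\<lambda>\<omega>. ennreal (indicator C \<omega> / prob C))"
      unfolding uniform_measure_def
      using False by (intro density_cong) (auto simp: emeasure_eq_measure indicator_def divide_ennreal[symmetric] zero_less_measure_iff)
    let ?L = "distr (uniform_measure M C) borel D"
    have real_L: "real_distribution ?L"
      using U.prob_space_distr[OF Dm] by (simp add: real_distribution_def real_distribution_axioms_def)
    have "char ?L = char ?\<nu>"
    proof
      fix \<theta>
      have "char ?L \<theta> = (CLINT \<omega>|uniform_measure M C. iexp (\<theta> * D \<omega>))"
        unfolding char_def by (subst integral_distr) auto
      also have "\<dots> = (\<integral>\<omega>. (indicator C \<omega> / prob C) *\<^sub>R iexp (\<theta> * D \<omega>) \<partial>M)"
        unfolding Ueq by (subst integral_density) (auto intro!: AE_I2)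
      also have "\<dots> = (\<integral>\<omega>. of_real (1 / prob C) * (indicator C \<omega> * iexp (\<theta> * D \<omega>)) \<partial>M)"
        by (intro Bochner_Integration.integral_cong) (auto simp: indicator_def scaleR_conv_of_real)
      also have "\<dots> = of_real (1 / prob C) * (\<integral>\<omega>. indicator C \<omega> * iexp (\<theta> * D \<omega>) \<partial>M)"
        by (rule integral_mult_right_zero)
      also have "\<dots> = char ?\<nu> \<theta>"
        unfolding char[OF C'] char_normal_density[OF \<sigma>] using False by simp
      finally show "char ?L \<theta> = char ?\<nu> \<theta>" .
    qed
    then have L: "?L = ?\<nu>" by (rule Levy_uniqueness[OF real_L real_\<nu>])
    have "measure ?\<nu> S = measure (uniform_measure M C) (D -` S \<inter> space M)"
      unfolding L[symmetric] using S by (subst measure_distr) auto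
    also have "\<dots> = prob (C \<inter> (D -` S \<inter> space M)) / prob C"
      using S eC by (subst measure_uniform_measure) auto
    finally show ?thesis using False by simp
  qed
  have "distr M lborel D = ?\<nu>"
  proof (rule measure_eqI)
    fix S assume "S \<in> sets (distr M lborel D)"
    then have S: "S \<in> sets borel" by simp
    have "space M \<inter> (D -` S \<inter> space M) = D -` S \<inter> space M" by auto
    then have "prob (D -` S \<inter> space M) = measure ?\<nu> S"
      using law[OF C(3) S] by (simp add: prob_space)
    then show "emeasure (distr M lborel D) S = emeasure ?\<nu> S"
      using S by (simp add: emeasure_distr emeasure_eq_measure \<nu>.emeasure_eq_measure)
  qed simp
  then show "distributed M lborel D (normal_density 0 \<sigma>)"
    by (simp add: distributed_def)
  have V: "sets (vimage_algebra (space M) D borel) = {D -` S \<inter> space M | S. S \<in> sets borel}"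
    by (rule sets_vimage_algebra2) simp
  have "indep_set \<C> {D -` S \<inter> space M | S. S \<in> sets borel}"
  proof (rule indep_setI)
    fix a b assume "a \<in> \<C>" "b \<in> {D -` S \<inter> space M | S. S \<in> sets borel}"
    then obtain S where S: "b = D -` S \<inter> space M" "S \<in> sets borel" and a: "a \<in> \<C>" by blast
    have "space M \<inter> b = b" using S by auto
    then have "prob b = measure ?\<nu> S" using law[OF C(3) S(2)] S by (simp add: prob_space)
    then show "prob (a \<inter> b) = prob a * prob b" using law[OF a S(2)] S by simp
  qed (use C in auto)
  from indep_set_sigma_sets[OF this C(2) Int_stable_vimage]
  have "indep_set (sigma_sets (space M) \<C>) (sigma_sets (space M) (sets (vimage_algebra (space M) D borel)))"
    unfolding V .
  then show "indep_set (sigma_sets (space M) \<C>) (sets (vimage_algebra (space M) D borel))"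
    using sets.sigma_sets_eq[of "vimage_algebra (space M) D borel"] by simp
qed

end

section \<open>The natural filtration of Brownian motion\<close>

text \<open>The \<sigma>-algebra generated by the coordinates in \<open>K\<close>, encoded as a
  preimage of the product \<sigma>-algebra, so that cylinder sets are at hand as generators. An
  index set in place of a time bound also covers the unbounded case.\<close>

definition gen_filt :: "'a set \<Rightarrow> (real \<Rightarrow> 'a \<Rightarrow> real) \<Rightarrow> real set \<Rightarrow> 'a measure" where
  "gen_filt \<Omega> W K = vimage_algebra \<Omega> (\<lambda>\<omega>. \<lambda>u\<in>K. W u \<omega>) (PiM K (\<lambda>_. borel))"

lemma space_gen_filt[simp]: "space (gen_filt \<Omega> W K) = \<Omega>"
  by (simp add: gen_filt_def)

lemma gen_filt_measurable: "u \<in> K \<Longrightarrow> W u \<in> borel_measurable (gen_filt \<Omega> W K)"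
proof -
  assume u: "u \<in> K"
  have "(\<lambda>\<omega>. \<lambda>u\<in>K. W u \<omega>) \<in> measurable (gen_filt \<Omega> W K) (PiM K (\<lambda>_. borel))"
    unfolding gen_filt_def by (rule measurable_vimage_algebra1) (auto simp: space_PiM)
  from measurable_compose[OF this measurable_component_singleton[OF u]]
  show ?thesis using u by simp
qed

lemma sets_gen_filt_subset:
  assumes "space N = \<Omega>" "\<And>u. u \<in> K \<Longrightarrow> W u \<in> borel_measurable N"
  shows "sets (gen_filt \<Omega> W K) \<subseteq> sets N"
  unfolding gen_filt_def by (rule sets_image_in_sets[OF assms(1)]) (auto intro!: measurable_restrict assms(2))

lemma sets_gen_filt_mono: "K \<subseteq> K' \<Longrightarrow> sets (gen_filt \<Omega> W K) \<subseteq> sets (gen_filt \<Omega> W K')"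
  by (rule sets_gen_filt_subset) (auto intro: gen_filt_measurable)

lemma measurable_into_gen_filt:
  assumes "\<phi> \<in> space N \<rightarrow> \<Omega>" "\<And>u. u \<in> K \<Longrightarrow> (\<lambda>x. W u (\<phi> x)) \<in> borel_measurable N"
  shows "\<phi> \<in> measurable N (gen_filt \<Omega> W K)"
  unfolding gen_filt_def
  by (rule measurable_vimage_algebra2[OF assms(1)]) (auto intro!: measurable_restrict assms(2))

text \<open>Cylinder events form a \<pi>-system, so they suffice. Such an event depends on finitely
  many increments before s, and these are independent of the increment from s to t by the
  finite-dimensional hypothesis.\<close>

lemma natural_filtration_indep:
  assumes W: "standard_brownian_motion M W" and st: "0 \<le> s" "s < t"
  shows "prob_space.indep_set M (sets (gen_filt (space M) W {0..s}))
    (sets (vimage_algebra (space M) (\<lambda>\<omega>. W t \<omega> - W s \<omega>) borel))"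
proof -
  interpret prob_space M using W by (simp add: standard_brownian_motion_def)
  have W_0: "W 0 \<omega> = 0" if "\<omega> \<in> space M" for \<omega> using W that by (simp add: standard_brownian_motion_def)
  have W_meas: "W u \<in> borel_measurable M" if "0 \<le> u" for u using W that by (simp add: standard_brownian_motion_def)
  let ?D = "\<lambda>\<omega>. W t \<omega> - W s \<omega>" and ?R = "\<lambda>\<omega>. \<lambda>u\<in>{0..s}. W u \<omega>"
  let ?PA = "prod_algebra {0..s} (\<lambda>_. borel :: real measure)"
  define GA where "GA = {?R -` A \<inter> space M | A. A \<in> ?PA}"
  have R_in: "?R \<in> space M \<rightarrow> (\<Pi>\<^sub>E i\<in>{0..s}. space (borel :: real measure))" by auto
  have G: "sets (gen_filt (space M) W {0..s}) = sigma_sets (space M) GA"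
  proof -
    have "sets (gen_filt (space M) W {0..s}) = {?R -` A \<inter> space M | A. A \<in> sets (PiM {0..s} (\<lambda>_. borel))}"
      unfolding gen_filt_def by (rule sets_vimage_algebra2) (auto simp: space_PiM)
    also have "\<dots> = sigma_sets (space M) GA"
      unfolding sets_PiM GA_def by (rule sigma_sets_vimage_commute[OF R_in])
    finally show ?thesis .
  qed
  have V: "sets (vimage_algebra (space M) ?D borel) = {?D -` S \<inter> space M | S. S \<in> sets borel}"
    by (rule sets_vimage_algebra2) simp
  have Rm: "?R \<in> measurable M (PiM {0..s} (\<lambda>_. borel))"
    by (intro measurable_restrict W_meas) auto
  have Dm: "?D \<in> borel_measurable M"
    by (rule borel_measurable_diff) (use W_meas st in auto)
  have stable: "Int_stable GA"
  proof (rule Int_stableI)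
    fix a b assume "a \<in> GA" "b \<in> GA"
    then obtain A B where AB: "A \<in> ?PA" "B \<in> ?PA" "a = ?R -` A \<inter> space M" "b = ?R -` B \<inter> space M"
      by (auto simp: GA_def)
    have "A \<inter> B \<in> ?PA" using Int_stable_prod_algebra AB by (auto simp: Int_stable_def)
    moreover have "a \<inter> b = ?R -` (A \<inter> B) \<inter> space M" using AB by auto
    ultimately show "a \<inter> b \<in> GA" unfolding GA_def by blast
  qed
  have "indep_set GA {?D -` S \<inter> space M | S. S \<in> sets borel}"
  proof (rule indep_setI)
    show "GA \<subseteq> events"
    proof
      fix a assume "a \<in> GA"
      then obtain A where "A \<in> ?PA" "a = ?R -` A \<inter> space M" by (auto simp: GA_def)
      then show "a \<in> events" using measurable_sets[OF Rm, of A] by (auto simp: sets_PiM intro: sigma_sets.Basic)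
    qed
    show "{?D -` S \<inter> space M | S. S \<in> sets borel} \<subseteq> events" using Dm by (auto intro: measurable_sets)
    fix a b assume "a \<in> GA" "b \<in> {?D -` S \<inter> space M | S. S \<in> sets borel}"
    then obtain A S where A: "A \<in> ?PA" "a = ?R -` A \<inter> space M" and S: "S \<in> sets borel" "b = ?D -` S \<inter> space M"
      by (auto simp: GA_def)
    from A(1) obtain J E where J: "A = prod_emb {0..s} (\<lambda>_. borel) J (\<Pi>\<^sub>E j\<in>J. E j)" "finite J" "J \<subseteq> {0..s}"
      and E: "\<And>i. i \<in> J \<Longrightarrow> E i \<in> sets (borel :: real measure)"
      by (rule prod_algebraE) blast
    have a_eq: "a = {\<omega>\<in>space M. \<forall>j\<in>J. W j \<omega> \<in> E j}"
      using J(3) unfolding A(2) J(1) prod_emb_def by (auto simp: PiE_iff subset_iff)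
    \<comment> \<open>The time 0 is added because W_0 = 0 makes the values partial sums of
      increments, and s because the last increment must start exactly there.\<close>
    define l where "l = sorted_list_of_set (insert 0 (insert s J))"
    have fin: "finite (insert 0 (insert s J))" using J by simp
    have l: "set l = insert 0 (insert s J)" "sorted l"
      by (simp_all only: l_def set_sorted_list_of_set[OF fin] sorted_sorted_list_of_set)
    have l0s: "0 \<le> x" "x \<le> s" if "x \<in> set l" for x using that l(1) J(3) st by auto
    define n where "n = length l - 1"
    have len: "length l = Suc n"
    proof -
      have "l \<noteq> []" using l(1) by auto
      then show ?thesis by (simp add: n_def)
    qed
    have l_0: "l ! 0 = 0"
    proof -
      obtain i where i: "i < length l" "l ! i = 0" using l(1) by (metis in_set_conv_nth insertI1)
      then have "l ! 0 \<le> 0" using sorted_nth_mono[OF l(2), of 0 i] by simp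
      moreover have "0 \<le> l ! 0" using l0s[of "l ! 0"] len by (simp add: nth_mem)
      ultimately show ?thesis by simp
    qed
    have l_n: "l ! n = s"
    proof -
      have "s \<in> set l" using l(1) by simp
      then obtain i where i: "i < length l" "l ! i = s" by (metis in_set_conv_nth)
      then have "s \<le> l ! n" using sorted_nth_mono[OF l(2), of i n] len by simp
      moreover have "l ! n \<le> s" using l0s[of "l ! n"] len by (simp add: nth_mem)
      ultimately show ?thesis by simp
    qed
    \<comment> \<open>The list supplies the times with indices 0 to n, ending at s; index n + 1 is
      t. Increments with index below n are the past, and increment n is W_t - W_s.\<close>
    define tt where "tt i = (if i \<le> n then l ! i else t)" for i
    have tt_mono: "tt i \<le> tt (Suc i)" if "i < Suc n" for i
    proof (cases "i = n")
      case True
      then show ?thesis using st l_n by (simp add: tt_def)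
    next
      case False
      then show ?thesis using that sorted_nth_mono[OF l(2), of i "Suc i"] len by (simp add: tt_def)
    qed
    let ?I = "\<lambda>i \<omega>. W (tt (Suc i)) \<omega> - W (tt i) \<omega>"
    have "indep_vars (\<lambda>_. borel) ?I {..<Suc n}"
    proof -
      have "0 \<le> tt 0" using l_0 by (simp add: tt_def)
      moreover have "\<forall>i<Suc n. tt i \<le> tt (Suc i)" using tt_mono by blast
      ultimately show ?thesis using W unfolding standard_brownian_motion_def by blast
    qed
    then have ind: "indep_var (PiM {..<n} (\<lambda>_. borel)) (\<lambda>\<omega>. \<lambda>i\<in>{..<n}. ?I i \<omega>) (PiM {n} (\<lambda>_. borel)) (\<lambda>\<omega>. \<lambda>i\<in>{n}. ?I i \<omega>)"
      by (rule indep_var_restrict) auto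
    \<comment> \<open>The cylinder event rewritten as a condition on increments, each value being
      the partial sum up to its time.\<close>
    define CA where "CA = {x\<in>space (PiM {..<n} (\<lambda>_. borel :: real measure)). \<forall>k\<in>{..n}. l ! k \<in> J \<longrightarrow> (\<Sum>i<k. x i) \<in> E (l ! k)}"
    have CA: "CA \<in> sets (PiM {..<n} (\<lambda>_. borel))"
    proof -
      have "{x\<in>space (PiM {..<n} (\<lambda>_. borel :: real measure)). l ! k \<in> J \<longrightarrow> (\<Sum>i<k. x i) \<in> E (l ! k)} \<in> sets (PiM {..<n} (\<lambda>_. borel))"
        if k: "k \<in> {..n}" for k
      proof (cases "l ! k \<in> J")
        case True
        have "(\<lambda>x. \<Sum>i<k. x i) \<in> borel_measurable (PiM {..<n} (\<lambda>_. borel :: real measure))"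
          using k by (intro borel_measurable_sum measurable_component_singleton) auto
        from measurable_sets[OF this E[OF True]] True show ?thesis
          by (simp add: vimage_def Int_def conj_commute)
      qed simp
      then show ?thesis unfolding CA_def by (intro sets.sets_Collect_finite_All) auto
    qed
    define CS where "CS = {x\<in>space (PiM {n} (\<lambda>_. borel :: real measure)). x n \<in> S}"
    have CS: "CS \<in> sets (PiM {n} (\<lambda>_. borel))"
      using measurable_sets[OF measurable_component_singleton[of n "{n}" "\<lambda>_. borel"] S(1)]
      by (simp add: CS_def vimage_def Int_def conj_commute)
    have Wl: "W (l ! k) \<omega> = (\<Sum>i<k. ?I i \<omega>)" if "\<omega> \<in> space M" "k \<le> n" for k \<omega>
    proof -
      have "(\<Sum>i<k. ?I i \<omega>) = W (tt k) \<omega> - W (tt 0) \<omega>" by (rule sum_lessThan_telescope)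
      then show ?thesis using that l_0 W_0 by (simp add: tt_def)
    qed
    have JE: "(\<forall>j\<in>J. P j) \<longleftrightarrow> (\<forall>k\<in>{..n}. l ! k \<in> J \<longrightarrow> P (l ! k))" for P
    proof
      assume r: "\<forall>k\<in>{..n}. l ! k \<in> J \<longrightarrow> P (l ! k)"
      show "\<forall>j\<in>J. P j"
      proof
        fix j assume j: "j \<in> J"
        then have "j \<in> set l" using l(1) by simp
        then obtain k where "k < length l" "l ! k = j" by (metis in_set_conv_nth)
        then show "P j" using r j len by auto
      qed
    qed auto
    have aC: "a = (\<lambda>\<omega>. \<lambda>i\<in>{..<n}. ?I i \<omega>) -` CA \<inter> space M"
    proof -
      have "(\<Sum>i<k. (\<lambda>i\<in>{..<n}. ?I i \<omega>) i) = W (l ! k) \<omega>" if "\<omega> \<in> space M" "k \<le> n" for k \<omega>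
        unfolding Wl[OF that] using that by (intro sum.cong) auto
      then show ?thesis
        unfolding a_eq JE CA_def by (auto simp: space_PiM)
    qed
    have bC: "b = (\<lambda>\<omega>. \<lambda>i\<in>{n}. ?I i \<omega>) -` CS \<inter> space M"
      unfolding S(2) CS_def using l_n by (auto simp: space_PiM tt_def)
    have "prob (a \<inter> b) = prob ((\<lambda>\<omega>. (\<lambda>i\<in>{..<n}. ?I i \<omega>, \<lambda>i\<in>{n}. ?I i \<omega>)) -` (CA \<times> CS) \<inter> space M)"
      unfolding aC bC by (rule arg_cong[where f=prob]) auto
    also have "\<dots> = prob a * prob b"
      unfolding aC bC by (rule indep_varD[OF ind CA CS])
    finally show "prob (a \<inter> b) = prob a * prob b" .
  qed
  from indep_set_sigma_sets[OF this stable Int_stable_vimage]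
  show ?thesis
    unfolding G V[symmetric] using sets.sigma_sets_eq[of "vimage_algebra (space M) ?D borel"] by simp
qed

text \<open>Paths are modified on null sets below, which must therefore belong to the filtration.\<close>

definition completed :: "'a measure \<Rightarrow> 'a measure \<Rightarrow> 'a measure" where
  "completed M F = sigma (space M) {A\<in>sets M. \<exists>A0\<in>sets F. AE \<omega> in M. \<omega> \<in> A \<longleftrightarrow> \<omega> \<in> A0}"

lemma space_completed[simp]: "space (completed M F) = space M"
  unfolding completed_def using sets.sets_into_space by (intro space_measure_of) auto

text \<open>Almost sure equality respects complements and countable unions, so the generating family
  is already a \<sigma>-algebra and membership can be tested directly.\<close>

lemma sets_completed:
  assumes F: "space F = space M"
  shows "sets (completed M F) = {A\<in>sets M. \<exists>A0\<in>sets F. AE \<omega> in M. \<omega> \<in> A \<longleftrightarrow> \<omega> \<in> A0}" (is "_ = ?S")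
proof -
  have "sigma_algebra (space M) ?S"
    unfolding sigma_algebra_iff2
  proof (intro conjI ballI allI impI)
    show "?S \<subseteq> Pow (space M)" using sets.sets_into_space by auto
    show "{} \<in> ?S" by (auto intro!: bexI[of _ "{}"])
    fix A assume "A \<in> ?S"
    then obtain A0 where A: "A \<in> sets M" "A0 \<in> sets F" "AE \<omega> in M. \<omega> \<in> A \<longleftrightarrow> \<omega> \<in> A0" by auto
    have "AE \<omega> in M. \<omega> \<in> space M - A \<longleftrightarrow> \<omega> \<in> space F - A0"
      using A(3) by eventually_elim (simp add: F)
    then show "space M - A \<in> ?S" using A by blast
  next
    fix A :: "nat \<Rightarrow> 'a set" assume "range A \<subseteq> ?S"
    then have A: "A i \<in> sets M" "\<exists>A0\<in>sets F. AE \<omega> in M. \<omega> \<in> A i \<longleftrightarrow> \<omega> \<in> A0" for i by auto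
    have "\<forall>i. \<exists>A0. A0 \<in> sets F \<and> (AE \<omega> in M. \<omega> \<in> A i \<longleftrightarrow> \<omega> \<in> A0)" using A(2) by blast
    from choice[OF this] obtain A0 where A0: "\<And>i. A0 i \<in> sets F" "\<And>i. AE \<omega> in M. \<omega> \<in> A i \<longleftrightarrow> \<omega> \<in> A0 i"
      by blast
    have "AE \<omega> in M. \<forall>i. \<omega> \<in> A i \<longleftrightarrow> \<omega> \<in> A0 i" using A0(2) by (simp add: AE_all_countable)
    then have "AE \<omega> in M. \<omega> \<in> (\<Union>i. A i) \<longleftrightarrow> \<omega> \<in> (\<Union>i. A0 i)" by eventually_elim auto
    moreover have "(\<Union>i. A0 i) \<in> sets F" using A0(1) by auto
    ultimately show "(\<Union>i. A i) \<in> ?S" using A(1) by blast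
  qed
  then show ?thesis
    unfolding completed_def by (rule sigma_algebra.sets_measure_of_eq)
qed

text \<open>Replacing an event by an almost surely equal one changes neither side of the product
  formula, so independence of the increments survives the completion.\<close>

lemma (in prob_space) brownian_filtration_completed:
  assumes B: "standard_brownian_motion M B"
  shows "brownian_filtration M (\<lambda>s. completed M (gen_filt (space M) B {0..s})) B"
proof
  let ?g = "\<lambda>s. gen_filt (space M) B {0..s}"
  have B_meas: "B u \<in> borel_measurable M" if "0 \<le> u" for u using B that by (simp add: standard_brownian_motion_def)
  have sub: "sets (?g s) \<subseteq> sets M" for s
    by (rule sets_gen_filt_subset) (auto intro: B_meas)
  note sets = sets_completed[of "gen_filt (space M) B {0..s}" M for s, OF space_gen_filt]
  show "space (completed M (?g t)) = space M" for t by simp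
  show "sets (completed M (?g t)) \<subseteq> sets M" for t unfolding sets by auto
  show "sets (completed M (?g s)) \<subseteq> sets (completed M (?g t))" if "s \<le> t" for s t
    using sets_gen_filt_mono[of "{0..s}" "{0..t}" "space M" B] that unfolding sets by auto
  show "B 0 \<omega> = 0" if "\<omega> \<in> space M" for \<omega> using B that by (simp add: standard_brownian_motion_def)
  show "continuous_on {0..} (\<lambda>t. B t \<omega>)" if "\<omega> \<in> space M" for \<omega> using B that by (simp add: standard_brownian_motion_def)
  show "B s \<in> borel_measurable (completed M (?g s))" if "0 \<le> s" for s
  proof -
    have "B s \<in> borel_measurable (?g s)" using that by (intro gen_filt_measurable) auto
    moreover have "sets (?g s) \<subseteq> sets (completed M (?g s))"
    proof
      fix A assume "A \<in> sets (?g s)"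
      then show "A \<in> sets (completed M (?g s))"
        unfolding sets using sub[of s] by (intro CollectI conjI bexI[of _ A]) auto
    qed
    then have "subalgebra (completed M (?g s)) (?g s)" by (simp add: subalgebra_def)
    ultimately show ?thesis by (rule measurable_from_subalg[rotated])
  qed
  fix s t :: real assume st: "0 \<le> s" "s < t"
  show "distributed M lborel (\<lambda>\<omega>. B t \<omega> - B s \<omega>) (normal_density 0 (sqrt (t - s)))"
    using B st unfolding standard_brownian_motion_def by blast
  note ind = natural_filtration_indep[OF B st]
  show "indep_set (sets (completed M (?g s))) (sets (vimage_algebra (space M) (\<lambda>\<omega>. B t \<omega> - B s \<omega>) borel))"
  proof (rule indep_setI)
    show V: "sets (vimage_algebra (space M) (\<lambda>\<omega>. B t \<omega> - B s \<omega>) borel) \<subseteq> events"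
      using indep_setD_ev2[OF ind] .
    fix a b assume a: "a \<in> sets (completed M (?g s))" and b: "b \<in> sets (vimage_algebra (space M) (\<lambda>\<omega>. B t \<omega> - B s \<omega>) borel)"
    obtain A0 where A0: "a \<in> events" "A0 \<in> sets (?g s)" "AE \<omega> in M. \<omega> \<in> a \<longleftrightarrow> \<omega> \<in> A0"
      using a unfolding sets by blast
    have A0': "A0 \<in> events" using A0 sub by blast
    have "prob (a \<inter> b) = prob (A0 \<inter> b)"
      using A0 A0' b V by (intro finite_measure_eq_AE) auto
    moreover have "prob a = prob A0" using A0 A0' by (intro finite_measure_eq_AE) auto
    ultimately show "prob (a \<inter> b) = prob a * prob b" using indep_setD[OF ind A0(2) b] by simp
  qed (auto simp: sets)
qed

section \<open>The time-changed martingale\<close>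

locale time_change = brownian_filtration M \<G> B \<mu> for M :: "'a measure" and \<G> B \<mu> +
  fixes f f' f'' :: "real \<Rightarrow> real"
  assumes f': "\<And>x. (f has_real_derivative f' x) (at x)"
    and f'': "\<And>x. (f' has_real_derivative f'' x) (at x)"
    and cont_f'': "continuous_on UNIV f''"
    and f'_nonzero: "\<And>x. f' x \<noteq> 0"
    and complete: "\<And>N s. N \<in> null_sets M \<Longrightarrow> N \<in> sets (\<G> s)"
    and clock_finite: "AE \<omega> in M. total_clock f' X \<omega> < \<infinity>"
begin

lemmas C2 = f' f'' cont_f''

abbreviation "mm \<equiv> mart f f' f''"
abbreviation "qq \<equiv> qvar f'"
abbreviation "\<tau> \<equiv> total_clock f' X"

text \<open>Where the inverse clock is infinite, \<open>enn2real\<close> yields the default value 0;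
  statements about \<open>al t\<close> are therefore guarded by t < \<tau>.\<close>

definition al :: "real \<Rightarrow> 'a \<Rightarrow> real" where "al t \<omega> = enn2real (inverse_clock f' X t \<omega>)"

lemma path: "\<omega> \<in> space M \<Longrightarrow> clock_path f' X \<omega>"
  by (simp add: clock_path_def X_cont f'_cont[OF C2] f'_nonzero)

lemma path_I: "\<omega> \<in> space M \<Longrightarrow> clock_path.I f' X \<omega> = (\<lambda>s. qq s \<omega>)"
  by (simp add: fun_eq_iff clock_path.I_def[OF path] qvar_def[OF C2] afun_def)

lemma path_\<alpha>: "\<omega> \<in> space M \<Longrightarrow> clock_path.\<alpha> f' X \<omega> = (\<lambda>t. al t \<omega>)"
  by (simp add: fun_eq_iff clock_path.\<alpha>_def[OF path] al_def)

lemma q_props: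
  assumes "\<omega> \<in> space M"
  shows "0 \<le> s \<Longrightarrow> clock f' X s \<omega> = ennreal (qq s \<omega>)"
    and "0 \<le> s \<Longrightarrow> ennreal (qq s \<omega>) < \<tau> \<omega>"
    and "0 \<le> s \<Longrightarrow> 0 \<le> t \<Longrightarrow> qq s \<omega> \<le> qq t \<omega> \<longleftrightarrow> s \<le> t"
    and "0 \<le> s \<Longrightarrow> 0 \<le> qq s \<omega>"
    and "0 < \<tau> \<omega>"
  using clock_path.clock_eq[OF path[OF assms]] clock_path.I_less_total[OF path[OF assms]]
    clock_path.I_le_iff[OF path[OF assms]] clock_path.I_nonneg[OF path[OF assms]]
    clock_path.total_pos[OF path[OF assms]]
  unfolding path_I[OF assms] by blast+

lemma al_props:
  assumes "\<omega> \<in> space M" "0 \<le> t" "ennreal t < \<tau> \<omega>"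
  shows "0 \<le> al t \<omega>" "qq (al t \<omega>) \<omega> = t" "inverse_clock f' X t \<omega> = ennreal (al t \<omega>)"
    "0 \<le> s \<Longrightarrow> al t \<omega> \<le> s \<longleftrightarrow> t \<le> qq s \<omega>"
  using clock_path.\<alpha>_props[OF path[OF assms(1)] assms(2,3)] clock_path.\<alpha>_le_iff[OF path[OF assms(1)] assms(2,3)]
  unfolding path_I[OF assms(1)] path_\<alpha>[OF assms(1)] by blast+

lemma \<tau>_SUP: "\<omega> \<in> space M \<Longrightarrow> \<tau> \<omega> = (SUP n::nat. ennreal (qq (real n) \<omega>))"
  using clock_path.total_clock_SUP[OF path] by (simp add: path_I)

lemma q_meas: "0 \<le> s \<Longrightarrow> qq s \<in> borel_measurable (\<G> s)"
  by (rule qvar_adapted[OF C2])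

lemma \<tau>_meas: "\<tau> \<in> borel_measurable M"
proof -
  have [measurable]: "qq (real n) \<in> borel_measurable M" for n
    using measurable_G_M[OF q_meas] by simp
  have "(\<lambda>\<omega>. SUP n::nat. ennreal (qq (real n) \<omega>)) \<in> borel_measurable M" by measurable
  then show ?thesis by (rule measurable_cong[THEN iffD1, rotated]) (simp add: \<tau>_SUP)
qed

lemma clock_le_sets: "0 \<le> s \<Longrightarrow> {\<omega>\<in>space M. t \<le> clock f' X s \<omega>} \<in> sets (\<G> s)"
proof -
  assume s: "0 \<le> s"
  have "{\<omega>\<in>space (\<G> s). t \<le> ennreal (qq s \<omega>)} \<in> sets (\<G> s)"
    using q_meas[OF s] by measurable
  also have "{\<omega>\<in>space (\<G> s). t \<le> ennreal (qq s \<omega>)} = {\<omega>\<in>space M. t \<le> clock f' X s \<omega>}"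
    using s by (auto simp: space_G q_props(1))
  finally show ?thesis .
qed

text \<open>The filtration at the stopping times \<open>\<alpha>\<^sub>t\<close>: as \<open>\<alpha>\<^sub>t \<le> s\<close> means that the clock has reached \<open>t\<close> by
  time \<open>s\<close>, this covers the case \<open>\<alpha>\<^sub>t = \<infinity>\<close> as well.\<close>

definition F :: "ennreal \<Rightarrow> 'a measure" where
  "F t = sigma (space M) {A\<in>sets M. \<forall>s\<ge>0. A \<inter> {\<omega>\<in>space M. t \<le> clock f' X s \<omega>} \<in> sets (\<G> s)}"

lemma space_F[simp]: "space (F t) = space M"
  unfolding F_def using sets.sets_into_space by (intro space_measure_of) auto

lemma sets_F: "sets (F t) = {A\<in>sets M. \<forall>s\<ge>0. A \<inter> {\<omega>\<in>space M. t \<le> clock f' X s \<omega>} \<in> sets (\<G> s)}" (is "_ = ?S")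
proof -
  let ?C = "\<lambda>s. {\<omega>\<in>space M. t \<le> clock f' X s \<omega>}"
  have "sigma_algebra (space M) ?S"
    unfolding sigma_algebra_iff2
  proof (intro conjI ballI allI impI)
    show "?S \<subseteq> Pow (space M)" using sets.sets_into_space by auto
    show "{} \<in> ?S" by simp
    fix A assume A: "A \<in> ?S"
    have "(space M - A) \<inter> ?C s = ?C s - (A \<inter> ?C s)" for s by auto
    then show "space M - A \<in> ?S" using A by (auto intro!: sets.Diff clock_le_sets)
  next
    fix A :: "nat \<Rightarrow> 'a set" assume A: "range A \<subseteq> ?S"
    have "(\<Union>i. A i) \<inter> ?C s = (\<Union>i. A i \<inter> ?C s)" for s by auto
    moreover have "(\<Union>i. A i \<inter> ?C s) \<in> sets (\<G> s)" if "0 \<le> s" for s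
      using A that by (intro sets.countable_UN) auto
    ultimately show "(\<Union>i. A i) \<in> ?S" using A by auto
  qed
  then show ?thesis unfolding F_def by (rule sigma_algebra.sets_measure_of_eq)
qed

lemma F_sub: "sets (F t) \<subseteq> sets M"
  by (auto simp: sets_F)

lemma F_mono: "t \<le> u \<Longrightarrow> sets (F t) \<subseteq> sets (F u)"
proof
  fix A assume tu: "t \<le> u" and A: "A \<in> sets (F t)"
  have eq: "A \<inter> {\<omega>\<in>space M. u \<le> clock f' X s \<omega>} = (A \<inter> {\<omega>\<in>space M. t \<le> clock f' X s \<omega>}) \<inter> {\<omega>\<in>space M. u \<le> clock f' X s \<omega>}" for s
    using tu by auto
  have "A \<inter> {\<omega>\<in>space M. u \<le> clock f' X s \<omega>} \<in> sets (\<G> s)" if s: "0 \<le> s" for s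
  proof (subst eq, rule sets.Int)
    show "A \<inter> {\<omega>\<in>space M. t \<le> clock f' X s \<omega>} \<in> sets (\<G> s)"
      using A s by (simp add: sets_F)
  qed (rule clock_le_sets[OF s])
  moreover have "A \<in> sets M" using A F_sub by blast
  ultimately show "A \<in> sets (F u)" by (simp add: sets_F)
qed

lemma filtration_F: "filtration_on M F"
  unfolding filtration_on_def filtration_def subalgebra_def
  using F_mono F_sub by simp

text \<open>On the event \<tau> \<le> t the clock never reaches t, so every condition defining
  \<open>F t\<close> is about the empty set. From \<tau> on, everything is known, in particular the
  limit of \<open>m\<close>.\<close>

lemma F_after:
  assumes "A \<in> sets M" shows "A \<inter> {\<omega>\<in>space M. \<tau> \<omega> \<le> t} \<in> sets (F t)"
proof -
  have "{\<omega>\<in>space M. \<tau> \<omega> \<le> t} \<in> sets M" using \<tau>_meas by measurable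
  moreover have "A \<inter> {\<omega>\<in>space M. \<tau> \<omega> \<le> t} \<inter> {\<omega>\<in>space M. t \<le> clock f' X s \<omega>} = {}" if "0 \<le> s" for s
    using q_props(1,2)[OF _ that] by (fastforce simp: not_le[symmetric])
  ultimately show ?thesis using assms by (auto simp: sets_F)
qed

lemma \<tau>_le_F: "{\<omega>\<in>space M. \<tau> \<omega> \<le> t} \<in> sets (F t)"
  using F_after[OF sets.top] by (simp add: Int_absorb1)

lemma stopping_\<tau>: "stopping_time F \<tau>"
  unfolding stopping_time_def pred_def using \<tau>_le_F by simp

lemma null_F: "N \<in> null_sets M \<Longrightarrow> N \<in> sets (F t)"
  unfolding sets_F using complete clock_le_sets by (auto intro!: sets.Int)

text \<open>If the clock has reached t by time s, then \<alpha>_t is at most s, and \<open>Y\<close>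
  at that time is determined by the path up to s.\<close>

lemma at_inverse_clock_sets:
  fixes Y :: "real \<Rightarrow> 'a \<Rightarrow> real"
  assumes t: "0 \<le> t" and Y: "\<And>s. 0 \<le> s \<Longrightarrow> Y s \<in> borel_measurable (\<G> s)"
    and cont: "\<And>\<omega>. \<omega> \<in> space M \<Longrightarrow> continuous_on {0..} (\<lambda>s. Y s \<omega>)"
    and S: "S \<in> sets borel"
  shows "{\<omega>\<in>space M. ennreal t < \<tau> \<omega> \<and> Y (al t \<omega>) \<omega> \<in> S} \<in> sets (F (ennreal t))"
proof -
  \<comment> \<open>A version of min (\<alpha>_t, s) with default s. For x < s the event that it is
    at most x says that the clock has reached t by time x, which is known at time x.\<close>
  define R where "R s \<omega> = (if ennreal t < \<tau> \<omega> then min (al t \<omega>) s else s)" for s \<omega>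
  have R: "R s \<in> borel_measurable (\<G> s)" if s: "0 \<le> s" for s
  proof (rule borel_measurableI_le)
    fix x
    consider "x < 0" | "s \<le> x" | "0 \<le> x" "x < s" by linarith
    then show "{\<omega>\<in>space (\<G> s). R s \<omega> \<le> x} \<in> sets (\<G> s)"
    proof cases
      case 1
      have "0 \<le> R s \<omega>" if "\<omega> \<in> space M" for \<omega>
        using al_props(1)[OF that t] s by (auto simp: R_def)
      then have "{\<omega>\<in>space (\<G> s). R s \<omega> \<le> x} = {}"
        using 1 by (force simp: space_G)
      then show ?thesis by (metis sets.empty_sets)
    next
      case 2
      then have "{\<omega>\<in>space (\<G> s). R s \<omega> \<le> x} = space (\<G> s)"
        by (auto simp: R_def min_le_iff_disj)
      then show ?thesis by (metis sets.top)
    next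
      case 3
      have "R s \<omega> \<le> x \<longleftrightarrow> ennreal t \<le> clock f' X x \<omega>" if \<omega>: "\<omega> \<in> space M" for \<omega>
      proof (cases "ennreal t < \<tau> \<omega>")
        case True
        then show ?thesis
          using 3 t al_props(4)[OF \<omega> t True 3(1)] q_props(4)[OF \<omega> 3(1)]
          by (auto simp: R_def min_le_iff_disj q_props(1)[OF \<omega> 3(1)])
      next
        case False
        then show ?thesis
          using 3 q_props(1,2)[OF \<omega> 3(1)] by (auto simp: R_def)
      qed
      then have "{\<omega>\<in>space (\<G> s). R s \<omega> \<le> x} = {\<omega>\<in>space M. ennreal t \<le> clock f' X x \<omega>}"
        by (auto simp: space_G)
      then show ?thesis using clock_le_sets[OF 3(1), of "ennreal t"] sets_G_mono[of x s] 3 by auto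
    qed
  qed
  have YR: "(\<lambda>\<omega>. Y (R s \<omega>) \<omega>) \<in> borel_measurable (\<G> s)" if s: "0 \<le> s" for s
  proof (rule borel_measurable_at_random_time[OF s _ _ R[OF s]])
    show "Y u \<in> borel_measurable (\<G> s)" if "0 \<le> u" "u \<le> s" for u
      using measurable_G_mono[OF Y] that by blast
    show "continuous_on {0..s} (\<lambda>u. Y u \<omega>)" if "\<omega> \<in> space (\<G> s)" for \<omega>
      using cont[of \<omega>] that by (auto simp: space_G intro: continuous_on_subset)
    show "R s \<omega> \<in> {0..s}" if "\<omega> \<in> space (\<G> s)" for \<omega>
      using that s al_props(1)[of \<omega> t] t by (auto simp: space_G R_def)
  qed
  define A where "A = {\<omega>\<in>space M. ennreal t < \<tau> \<omega> \<and> Y (al t \<omega>) \<omega> \<in> S}"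
  have AC: "A \<inter> {\<omega>\<in>space M. ennreal t \<le> clock f' X s \<omega>} \<in> sets (\<G> s)" if s: "0 \<le> s" for s
  proof -
    have "A \<inter> {\<omega>\<in>space M. ennreal t \<le> clock f' X s \<omega>} =
      ((\<lambda>\<omega>. Y (R s \<omega>) \<omega>) -` S \<inter> space (\<G> s)) \<inter> {\<omega>\<in>space M. ennreal t \<le> clock f' X s \<omega>}"
    proof -
      have "ennreal t < \<tau> \<omega> \<and> R s \<omega> = al t \<omega>" if \<omega>: "\<omega> \<in> space M" and c: "ennreal t \<le> clock f' X s \<omega>" for \<omega>
      proof -
        have lt: "ennreal t < \<tau> \<omega>" using c q_props(1,2)[OF \<omega> s] by (simp add: le_less_trans)
        have "t \<le> qq s \<omega>" using c q_props(1)[OF \<omega> s] q_props(4)[OF \<omega> s] by simp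
        then have "al t \<omega> \<le> s" using al_props(4)[OF \<omega> t lt s] by simp
        then show ?thesis using lt by (simp add: R_def)
      qed
      then show ?thesis by (auto simp: A_def space_G)
    qed
    also have "\<dots> \<in> sets (\<G> s)"
      by (intro sets.Int measurable_sets[OF YR[OF s] S] clock_le_sets s)
    finally show ?thesis .
  qed
  \<comment> \<open>Membership in \<open>F\<close> also demands measurability in \<open>M\<close>.
    It follows because a clock that exceeds t at all does so at some integer time.\<close>
  have "A = (\<Union>n::nat. A \<inter> {\<omega>\<in>space M. ennreal t \<le> clock f' X (real n) \<omega>})"
  proof (intro equalityI subsetI)
    fix \<omega> assume A: "\<omega> \<in> A"
    then have \<omega>: "\<omega> \<in> space M" and "ennreal t < (SUP n::nat. ennreal (qq (real n) \<omega>))"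
      by (auto simp: A_def \<tau>_SUP)
    then obtain n :: nat where "ennreal t < ennreal (qq (real n) \<omega>)" by (auto simp: less_SUP_iff)
    then show "\<omega> \<in> (\<Union>n::nat. A \<inter> {\<omega>\<in>space M. ennreal t \<le> clock f' X (real n) \<omega>})"
      using A \<omega> q_props(1)[OF \<omega>, of "real n"] by (intro UN_I[of n]) auto
  qed auto
  also have "\<dots> \<in> sets M"
  proof (rule sets.countable_UN, rule image_subsetI)
    fix n :: nat
    have "0 \<le> real n" by simp
    from subsetD[OF sets_G AC[OF this]]
    show "A \<inter> {\<omega>\<in>space M. ennreal t \<le> clock f' X (real n) \<omega>} \<in> sets M" .
  qed
  finally have "A \<in> sets M" .
  then show ?thesis using AC unfolding sets_F A_def[symmetric] by auto
qed

lemma adapted_at_inverse_clock: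
  fixes Y :: "real \<Rightarrow> 'a \<Rightarrow> real"
  assumes Y: "\<And>s. 0 \<le> s \<Longrightarrow> Y s \<in> borel_measurable (\<G> s)"
    and cont: "\<And>\<omega>. \<omega> \<in> space M \<Longrightarrow> continuous_on {0..} (\<lambda>s. Y s \<omega>)"
  shows "adapted_until F \<tau> (\<lambda>t \<omega>. Y (al t \<omega>) \<omega>)"
  unfolding adapted_until_def
proof (intro allI impI)
  fix t :: real assume t: "0 \<le> t"
  let ?A = "{\<omega>\<in>space (F (ennreal t)). ennreal t < \<tau> \<omega>}"
  have sub: "?A \<in> sets (F (ennreal t))"
    using at_inverse_clock_sets[OF t Y cont, of UNIV] by simp
  have "?A \<inter> space (F (ennreal t)) = ?A" by auto
  then have sub2: "?A \<inter> space (F (ennreal t)) \<in> sets (F (ennreal t))" using sub by simp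
  show "(\<lambda>\<omega>. Y (al t \<omega>) \<omega>) \<in> borel_measurable (restrict_space (F (ennreal t)) ?A)"
  proof (rule measurableI)
    fix S :: "real set" assume S: "S \<in> sets borel"
    have "(\<lambda>\<omega>. Y (al t \<omega>) \<omega>) -` S \<inter> space (restrict_space (F (ennreal t)) ?A) =
      {\<omega>\<in>space M. ennreal t < \<tau> \<omega> \<and> Y (al t \<omega>) \<omega> \<in> S}"
      by (auto simp: space_restrict_space)
    then show "(\<lambda>\<omega>. Y (al t \<omega>) \<omega>) -` S \<inter> space (restrict_space (F (ennreal t)) ?A) \<in> sets (restrict_space (F (ennreal t)) ?A)"
      using at_inverse_clock_sets[OF t Y cont S] sub2
      by (subst sets_restrict_space_iff) auto
  qed simp
qed

section \<open>The exponential identity for the time-changed martingale\<close>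

text \<open>The limit along integers is measurable as it stands; for \<open>good\<close> paths it is
  the limit along all real times.\<close>

definition m_inf :: "'a \<Rightarrow> real" where "m_inf \<omega> = lim (\<lambda>n. mm (real n) \<omega>)"

definition T :: "'a \<Rightarrow> real" where "T \<omega> = enn2real (\<tau> \<omega>)"

text \<open>The candidate for the driving Brownian motion, frozen from \<tau> on at its
  limit.\<close>

definition mart_tc :: "real \<Rightarrow> 'a \<Rightarrow> real" where
  "mart_tc t \<omega> = (if ennreal t < \<tau> \<omega> then mm (al t \<omega>) \<omega> else m_inf \<omega>)"

definition good :: "'a \<Rightarrow> bool" where
  "good \<omega> \<longleftrightarrow> \<tau> \<omega> < \<infinity> \<and> ((\<lambda>s. mm s \<omega>) \<longlongrightarrow> m_inf \<omega>) at_top"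

lemma T_nonneg: "0 \<le> T \<omega>" by (simp add: T_def)

lemma \<tau>_T: "good \<omega> \<Longrightarrow> \<tau> \<omega> = ennreal (T \<omega>)"
  by (auto simp: good_def T_def less_top)

lemma less_\<tau>_iff: "good \<omega> \<Longrightarrow> 0 \<le> t \<Longrightarrow> ennreal t < \<tau> \<omega> \<longleftrightarrow> t < T \<omega>"
  by (simp add: \<tau>_T ennreal_less_iff)

lemma q_less_T: "\<omega> \<in> space M \<Longrightarrow> good \<omega> \<Longrightarrow> 0 \<le> s \<Longrightarrow> qq s \<omega> < T \<omega>"
  using q_props(2,4)[of \<omega> s] less_\<tau>_iff[of \<omega> "qq s \<omega>"] by simp

lemma AE_good: "AE \<omega> in M. good \<omega>"
  using mart_converges[OF C2] clock_finite AE_space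
proof eventually_elim
  case (elim \<omega>)
  then have \<omega>: "\<omega> \<in> space M" by simp
  have \<tau>: "\<tau> \<omega> = ennreal (T \<omega>)" using elim(2) by (auto simp: T_def less_top)
  have "qq s \<omega> \<le> T \<omega>" if "0 \<le> s" for s
    using q_props(2,4)[OF \<omega> that] T_nonneg[of \<omega>] unfolding \<tau> by (simp add: ennreal_less_iff)
  then obtain l where l: "((\<lambda>s. mm s \<omega>) \<longlongrightarrow> l) at_top" using elim(1) by blast
  then have "(\<lambda>n. mm (real n) \<omega>) \<longlonglongrightarrow> l"
    using filterlim_compose[OF l filterlim_real_sequentially] by simp
  then have "m_inf \<omega> = l" unfolding m_inf_def by (rule limI)
  then show ?case using l elim(2) by (simp add: good_def)
qed

lemma m_inf_meas: "m_inf \<in> borel_measurable M"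
proof -
  have [measurable]: "mm (real n) \<in> borel_measurable M" for n
    using measurable_G_M[OF mart_adapted[OF C2]] by simp
  show ?thesis unfolding m_inf_def by measurable
qed

lemma T_meas: "T \<in> borel_measurable M"
  unfolding T_def using \<tau>_meas by measurable

lemma mart_tc_meas_F: assumes "0 \<le> t" shows "mart_tc t \<in> borel_measurable (F (ennreal t))"
proof (rule measurableI)
  fix S :: "real set" assume S: "S \<in> sets borel"
  have "mart_tc t -` S \<inter> space (F (ennreal t)) = {\<omega>\<in>space M. ennreal t < \<tau> \<omega> \<and> mm (al t \<omega>) \<omega> \<in> S} \<union>
    ((m_inf -` S \<inter> space M) \<inter> {\<omega>\<in>space M. \<tau> \<omega> \<le> ennreal t})"
    by (auto simp: mart_tc_def split: if_splits)
  also have "\<dots> \<in> sets (F (ennreal t))"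
    using S by (intro sets.Un F_after at_inverse_clock_sets assms mart_adapted[OF C2] mart_cont[OF C2]
      measurable_sets[OF m_inf_meas])
  finally show "mart_tc t -` S \<inter> space (F (ennreal t)) \<in> sets (F (ennreal t))" .
qed simp

lemma mart_tc_meas: "0 \<le> t \<Longrightarrow> mart_tc t \<in> borel_measurable M"
  by (rule measurable_from_subalg[OF _ mart_tc_meas_F]) (simp_all add: subalgebra_def F_sub)

text \<open>The bounded stopping times \<open>\<rho> t k\<close> localise \<open>\<alpha>\<^sub>t\<close>: for large \<open>k\<close> they equal \<open>\<alpha>\<^sub>t\<close> if it is finite,
  and they tend to \<open>\<infinity>\<close> otherwise.\<close>

definition N :: "real \<Rightarrow> nat \<Rightarrow> real \<Rightarrow> 'a \<Rightarrow> real" where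
  "N t k u \<omega> = max (max (\<bar>X u \<omega>\<bar> - real (Suc k)) (u - real (Suc k))) (qq u \<omega> - t)"

definition \<rho> :: "real \<Rightarrow> nat \<Rightarrow> 'a \<Rightarrow> real" where "\<rho> t k = hit (N t k)"

lemma N_cont: "\<omega> \<in> space M \<Longrightarrow> continuous_on {0..} (\<lambda>u. N t k u \<omega>)"
  unfolding N_def by (intro continuous_intros X_cont qvar_cont[OF C2])

lemma N_K: "0 \<le> real (Suc k)" "0 \<le> N t k (real (Suc k)) \<omega>"
  by (auto simp: N_def le_max_iff_disj)

lemma \<rho>_stopping: "stopping (\<rho> t k)"
  unfolding \<rho>_def
proof (rule stopping_hit[OF N_cont N_K])
  show "N t k s \<in> borel_measurable (\<G> s)" if "0 \<le> s" for s
    using X_adapted[OF that] q_meas[OF that] unfolding N_def by measurable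
qed

lemma \<rho>_bounds:
  assumes "\<omega> \<in> space M"
  shows "0 \<le> \<rho> t k \<omega>" "\<rho> t k \<omega> \<le> real (Suc k)" "0 \<le> N t k (\<rho> t k \<omega>) \<omega>"
  unfolding \<rho>_def using hit_bounds[where N="N t k" and K="real (Suc k)", OF N_cont N_K assms] by simp_all

lemma \<rho>_le_iff:
  assumes "\<omega> \<in> space M" "0 \<le> s" shows "\<rho> t k \<omega> \<le> s \<longleftrightarrow> (\<exists>u. 0 \<le> u \<and> u \<le> s \<and> 0 \<le> N t k u \<omega>)"
  unfolding \<rho>_def by (rule hit_le_iff[where N="N t k" and K="real (Suc k)", OF N_cont N_K assms])

lemma before_\<rho>:
  assumes "\<omega> \<in> space M" "0 \<le> t" "0 \<le> u" "u \<le> \<rho> t k \<omega>"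
  shows "\<bar>X u \<omega>\<bar> \<le> real (Suc k)" "qq u \<omega> \<le> t"
proof -
  have N0: "N t k 0 \<omega> \<le> 0"
    using assms(2) X_0[OF assms(1)] by (simp add: N_def qvar_0[OF C2])
  have le: "u \<le> hit (N t k) \<omega>" using assms(4) by (simp add: \<rho>_def)
  have "N t k u \<omega> \<le> 0"
    by (rule hit_nonpos[OF assms(1) N_cont[OF assms(1)] N_K N0 assms(3) le])
  then show "\<bar>X u \<omega>\<bar> \<le> real (Suc k)" "qq u \<omega> \<le> t" by (auto simp: N_def)
qed

lemma \<rho>_mono: "\<omega> \<in> space M \<Longrightarrow> t \<le> t' \<Longrightarrow> \<rho> t k \<omega> \<le> \<rho> t' k \<omega>"
proof (subst \<rho>_le_iff)
  assume \<omega>: "\<omega> \<in> space M" and tt: "t \<le> t'"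
  have "N t' k (\<rho> t' k \<omega>) \<omega> \<le> N t k (\<rho> t' k \<omega>) \<omega>" using tt by (auto simp: N_def)
  then show "\<exists>u. 0 \<le> u \<and> u \<le> \<rho> t' k \<omega> \<and> 0 \<le> N t k u \<omega>"
    using \<rho>_bounds[OF \<omega>, of t' k] by (intro exI[of _ "\<rho> t' k \<omega>"]) auto
qed (simp_all add: \<rho>_bounds)

lemma eventually_bounded:
  assumes "\<omega> \<in> space M"
  shows "eventually (\<lambda>k. \<forall>u. 0 \<le> u \<longrightarrow> u \<le> c \<longrightarrow> \<bar>X u \<omega>\<bar> < real (Suc k) \<and> u < real (Suc k)) sequentially"
proof -
  have "bounded ((\<lambda>u. X u \<omega>) ` {0..c})"
    by (intro compact_imp_bounded compact_continuous_image X_cont_on assms) auto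
  then obtain b where b: "\<forall>u\<in>{0..c}. \<bar>X u \<omega>\<bar> \<le> b" by (auto simp: bounded_iff)
  obtain n :: nat where n: "max b c < real n" using reals_Archimedean2 by blast
  show ?thesis
  proof (rule eventually_sequentiallyI[of n], intro allI impI)
    fix k u assume "n \<le> k" "0 \<le> u" "u \<le> c"
    moreover then have "real n < real (Suc k)" by simp
    ultimately show "\<bar>X u \<omega>\<bar> < real (Suc k) \<and> u < real (Suc k)" using b[rule_format, of u] n by auto
  qed
qed

text \<open>Once k exceeds the range of the path and the time up to \<alpha>_t, the only condition
  left that can stop is that the clock reaches t.\<close>

lemma \<rho>_eventually_al:
  assumes \<omega>: "\<omega> \<in> space M" and t: "0 \<le> t" "ennreal t < \<tau> \<omega>"
  shows "eventually (\<lambda>k. \<rho> t k \<omega> = al t \<omega>) sequentially"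
  using eventually_bounded[OF \<omega>, of "al t \<omega>"]
proof eventually_elim
  case (elim k)
  note al = al_props[OF \<omega> t]
  have le: "\<rho> t k \<omega> \<le> al t \<omega>"
    unfolding \<rho>_le_iff[OF \<omega> al(1)] using al by (intro exI[of _ "al t \<omega>"]) (auto simp: N_def)
  have "0 \<le> qq (\<rho> t k \<omega>) \<omega> - t"
    using \<rho>_bounds[OF \<omega>, of t k] elim[rule_format, of "\<rho> t k \<omega>"] le by (auto simp: N_def le_max_iff_disj)
  then have "al t \<omega> \<le> \<rho> t k \<omega>" using al(4)[OF \<rho>_bounds(1)[OF \<omega>]] by simp
  with le show ?case by simp
qed

text \<open>If the clock never reaches t, stopping before c requires the path or the time to leave
  its bound, which is excluded on [0, c] for large k.\<close>

lemma \<rho>_tendsto_infinity: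
  assumes \<omega>: "\<omega> \<in> space M" and t: "\<not> ennreal t < \<tau> \<omega>"
  shows "filterlim (\<lambda>k. \<rho> t k \<omega>) at_top sequentially"
  unfolding filterlim_at_top
proof
  fix c
  show "eventually (\<lambda>k. c \<le> \<rho> t k \<omega>) sequentially"
    using eventually_bounded[OF \<omega>, of "max 0 c"]
  proof eventually_elim
    case (elim k)
    have "\<not> \<rho> t k \<omega> \<le> max 0 c"
    proof
      assume "\<rho> t k \<omega> \<le> max 0 c"
      then obtain u where u: "0 \<le> u" "u \<le> max 0 c" "0 \<le> N t k u \<omega>" using \<rho>_le_iff[OF \<omega>, of "max 0 c"] by auto
      then have "t \<le> qq u \<omega>" using elim[rule_format, of u] by (auto simp: N_def le_max_iff_disj)
      then have "ennreal t \<le> ennreal (qq u \<omega>)" by (rule ennreal_leI)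
      also have "\<dots> < \<tau> \<omega>" by (rule q_props(2)[OF \<omega> u(1)])
      finally show False using t by simp
    qed
    then show ?case by simp
  qed
qed

lemma at_\<rho>_meas:
  shows "(\<lambda>\<omega>. mm (\<rho> t k \<omega>) \<omega>) \<in> borel_measurable M" "(\<lambda>\<omega>. qq (\<rho> t k \<omega>) \<omega>) \<in> borel_measurable M"
proof -
  have *: "(\<lambda>\<omega>. mm (min (\<rho> t k \<omega>) (real (Suc k))) \<omega>) \<in> borel_measurable M"
    "(\<lambda>\<omega>. qq (min (\<rho> t k \<omega>) (real (Suc k))) \<omega>) \<in> borel_measurable M"
    using measurable_G_M[OF stopped_measurable[OF \<rho>_stopping N_K(1) mart_adapted[OF C2] mart_cont[OF C2]]]
      measurable_G_M[OF stopped_measurable[OF \<rho>_stopping N_K(1) qvar_adapted[OF C2] qvar_cont[OF C2]]]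
    by blast+
  have e: "min (\<rho> t k \<omega>) (real (Suc k)) = \<rho> t k \<omega>" if "\<omega> \<in> space M" for \<omega>
    using \<rho>_bounds(2)[OF that] by (rule min_absorb1)
  show "(\<lambda>\<omega>. mm (\<rho> t k \<omega>) \<omega>) \<in> borel_measurable M"
    by (rule measurable_cong[THEN iffD1, OF _ *(1)]) (simp only: e)
  show "(\<lambda>\<omega>. qq (\<rho> t k \<omega>) \<omega>) \<in> borel_measurable M"
    by (rule measurable_cong[THEN iffD1, OF _ *(2)]) (simp only: e)
qed

text \<open>The stopped exponential identity between the localised times, followed by k
  \<rightarrow> \<infinity>. For t1 < \<tau> the lower time settles at \<alpha>_(t1), whereas the
  upper one may settle or run off to infinity.\<close>

lemma exp_identity_before:
  assumes t: "0 \<le> t1" "t1 \<le> t2" and A: "A \<in> sets (F (ennreal t1))" and lt: "\<And>\<omega>. \<omega> \<in> A \<Longrightarrow> ennreal t1 < \<tau> \<omega>"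
  shows "(\<integral>\<omega>. indicator A \<omega> * exp (\<i> * of_real (\<theta> * (mart_tc t2 \<omega> - mart_tc t1 \<omega>)) +
      of_real (\<theta>\<^sup>2 * (min t2 (T \<omega>) - min t1 (T \<omega>)) / 2)) \<partial>M) = complex_of_real (prob A)"
proof -
  have t2: "0 \<le> t2" using t by simp
  have A_M: "A \<in> sets M" using A F_sub by blast
  \<comment> \<open>On this part of \<open>A\<close> the first stopping is due to the clock having
    reached t1. The restriction makes it an event of the past of \<open>\<rho> t1 k\<close>, since
    membership in \<open>F\<close> speaks only about paths whose clock has reached t1.\<close>
  define Ak where "Ak k = A \<inter> {\<omega>\<in>space M. t1 \<le> qq (\<rho> t1 k \<omega>) \<omega>}" for k
  have Ak_M: "Ak k \<in> sets M" for k
    unfolding Ak_def by (intro sets.Int A_M borel_measurable_le borel_measurable_const at_\<rho>_meas)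
  have Ak_S: "Ak k \<inter> {\<omega>\<in>space M. \<rho> t1 k \<omega> \<le> s} \<in> sets (\<G> s)" if s: "0 \<le> s" for k s
  proof -
    have "Ak k \<inter> {\<omega>\<in>space M. \<rho> t1 k \<omega> \<le> s} = (A \<inter> {\<omega>\<in>space M. ennreal t1 \<le> clock f' X s \<omega>}) \<inter>
      ({\<omega>\<in>space (\<G> s). t1 \<le> qq (min (\<rho> t1 k \<omega>) s) \<omega>} \<inter> {\<omega>\<in>space M. \<rho> t1 k \<omega> \<le> s})"
    proof (intro equalityI subsetI)
      fix \<omega> assume "\<omega> \<in> Ak k \<inter> {\<omega>\<in>space M. \<rho> t1 k \<omega> \<le> s}"
      then have \<omega>: "\<omega> \<in> space M" "\<omega> \<in> A" "t1 \<le> qq (\<rho> t1 k \<omega>) \<omega>" "\<rho> t1 k \<omega> \<le> s" by (auto simp: Ak_def)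
      have "qq (\<rho> t1 k \<omega>) \<omega> \<le> qq s \<omega>"
        using q_props(3)[OF \<omega>(1) \<rho>_bounds(1)[OF \<omega>(1)] s] \<omega>(4) by simp
      then have "ennreal t1 \<le> clock f' X s \<omega>"
        using \<omega>(3) unfolding q_props(1)[OF \<omega>(1) s] by (intro ennreal_leI) simp
      then show "\<omega> \<in> (A \<inter> {\<omega>\<in>space M. ennreal t1 \<le> clock f' X s \<omega>}) \<inter>
        ({\<omega>\<in>space (\<G> s). t1 \<le> qq (min (\<rho> t1 k \<omega>) s) \<omega>} \<inter> {\<omega>\<in>space M. \<rho> t1 k \<omega> \<le> s})"
        using \<omega> by (simp add: space_G min_absorb1)
    qed (auto simp: Ak_def min_absorb1)
    also have "\<dots> \<in> sets (\<G> s)"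
    proof (rule sets.Int[OF _ sets.Int])
      show "A \<inter> {\<omega>\<in>space M. ennreal t1 \<le> clock f' X s \<omega>} \<in> sets (\<G> s)" using A s by (simp add: sets_F)
      show "{\<omega>\<in>space (\<G> s). t1 \<le> qq (min (\<rho> t1 k \<omega>) s) \<omega>} \<in> sets (\<G> s)"
        using stopped_measurable[OF \<rho>_stopping s qvar_adapted[OF C2] qvar_cont[OF C2], of t1 k] by measurable
    qed (rule stopping_le_sets[OF \<rho>_stopping order_refl])
    finally show ?thesis .
  qed
  let ?Z = "\<lambda>k \<omega>. exp (\<i> * of_real (\<theta> * (mm (\<rho> t2 k \<omega>) \<omega> - mm (\<rho> t1 k \<omega>) \<omega>)) +
      of_real (\<theta>\<^sup>2 * (qq (\<rho> t2 k \<omega>) \<omega> - qq (\<rho> t1 k \<omega>) \<omega>) / 2))"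
  let ?L = "\<lambda>\<omega>. exp (\<i> * of_real (\<theta> * (mart_tc t2 \<omega> - mart_tc t1 \<omega>)) +
      of_real (\<theta>\<^sup>2 * (min t2 (T \<omega>) - min t1 (T \<omega>)) / 2))"
  have step: "(\<integral>\<omega>. indicator (Ak k) \<omega> * ?Z k \<omega> \<partial>M) = complex_of_real (prob (Ak k))" for k
  proof -
    note C2' = scaled_C2[OF C2, of \<theta>]
    \<comment> \<open>The frequency \<theta> enters by using the function \<theta> f in place of
      \<open>f\<close>.\<close>
    note * = stopped_exponential_martingale[OF C2' \<rho>_stopping[of t1 k] \<rho>_stopping[of t2 k] \<rho>_mono[OF _ t(2)] _ \<rho>_bounds(2)
      N_K(1) before_\<rho>(1)[OF _ t2] Ak_M Ak_S]
    show ?thesis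
      using * unfolding scaled_mart[OF C2] right_diff_distrib[symmetric] by simp
  qed
  have conv: "AE \<omega> in M. (\<lambda>k. indicator (Ak k) \<omega> * ?Z k \<omega>) \<longlonglongrightarrow> indicator A \<omega> * ?L \<omega>"
    and conv': "AE \<omega> in M. (\<lambda>k. indicator (Ak k) \<omega> :: complex) \<longlonglongrightarrow> indicator A \<omega>"
  proof -
    have "AE \<omega> in M. ((\<lambda>k. indicator (Ak k) \<omega> * ?Z k \<omega>) \<longlonglongrightarrow> indicator A \<omega> * ?L \<omega>) \<and>
      ((\<lambda>k. indicator (Ak k) \<omega> :: complex) \<longlonglongrightarrow> indicator A \<omega>)"
      using AE_good AE_space
    proof eventually_elim
      case (elim \<omega>)
      then have \<omega>: "\<omega> \<in> space M" and g: "good \<omega>" by auto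
      show ?case
      proof (cases "\<omega> \<in> A")
        case False
        then show ?thesis by (simp add: Ak_def)
      next
        case True
        note lt1 = lt[OF True]
        have t1T: "t1 < T \<omega>" using lt1 less_\<tau>_iff[OF g t(1)] by simp
        note al1 = al_props[OF \<omega> t(1) lt1]
        have ev1: "eventually (\<lambda>k. \<rho> t1 k \<omega> = al t1 \<omega>) sequentially"
          by (rule \<rho>_eventually_al[OF \<omega> t(1) lt1])
        have "eventually (\<lambda>k. indicator (Ak k) \<omega> = (1::complex)) sequentially"
          using ev1 by eventually_elim (use True \<omega> al1 in \<open>simp add: Ak_def\<close>)
        then have i: "(\<lambda>k. indicator (Ak k) \<omega> :: complex) \<longlonglongrightarrow> indicator A \<omega>"
          using True by (simp add: tendsto_eventually)
        have m1: "(\<lambda>k. mm (\<rho> t1 k \<omega>) \<omega>) \<longlonglongrightarrow> mart_tc t1 \<omega>" and q1: "(\<lambda>k. qq (\<rho> t1 k \<omega>) \<omega>) \<longlonglongrightarrow> min t1 (T \<omega>)"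
          using ev1 lt1 t1T al1 by (auto intro!: tendsto_eventually elim!: eventually_mono simp: mart_tc_def)
        \<comment> \<open>Either \<alpha>_(t2) is finite and the sequence is eventually constant, or
          the times tend to infinity, so that \<open>m\<close> tends to its limit and the clock to
          T.\<close>
        have "((\<lambda>k. mm (\<rho> t2 k \<omega>) \<omega>) \<longlonglongrightarrow> mart_tc t2 \<omega>) \<and> ((\<lambda>k. qq (\<rho> t2 k \<omega>) \<omega>) \<longlonglongrightarrow> min t2 (T \<omega>))"
        proof (cases "ennreal t2 < \<tau> \<omega>")
          case lt2: True
          have "t2 < T \<omega>" using lt2 less_\<tau>_iff[OF g t2] by simp
          then show ?thesis
            using \<rho>_eventually_al[OF \<omega> t2 lt2] lt2 al_props[OF \<omega> t2 lt2]
            by (auto intro!: tendsto_eventually elim!: eventually_mono simp: mart_tc_def)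
        next
          case ge: False
          then have Tt2: "T \<omega> \<le> t2" using less_\<tau>_iff[OF g t2] by simp
          note inf = \<rho>_tendsto_infinity[OF \<omega> ge]
          have "((\<lambda>s. mm s \<omega>) \<longlongrightarrow> m_inf \<omega>) at_top" using g by (simp add: good_def)
          from filterlim_compose[OF this inf] have 1: "(\<lambda>k. mm (\<rho> t2 k \<omega>) \<omega>) \<longlonglongrightarrow> mart_tc t2 \<omega>"
            using ge by (simp add: mart_tc_def)
          have 2: "(\<lambda>k. qq (\<rho> t2 k \<omega>) \<omega>) \<longlonglongrightarrow> T \<omega>"
          proof (rule order_tendstoI)
            fix a assume a: "a < T \<omega>"
            have am: "ennreal (max 0 a) < \<tau> \<omega>"
              using a less_\<tau>_iff[OF g, of "max 0 a"] t1T t(1) by auto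
            note al = al_props[OF \<omega> _ am, simplified]
            have "eventually (\<lambda>k. al (max 0 a) \<omega> + 1 \<le> \<rho> t2 k \<omega>) sequentially"
              using inf by (simp add: filterlim_at_top)
            then show "eventually (\<lambda>k. a < qq (\<rho> t2 k \<omega>) \<omega>) sequentially"
            proof eventually_elim
              case (elim k)
              have "\<not> qq (\<rho> t2 k \<omega>) \<omega> \<le> qq (al (max 0 a) \<omega>) \<omega>"
                using q_props(3)[OF \<omega> \<rho>_bounds(1)[OF \<omega>] al(1), of t2 k] elim by simp
              then show ?case using al(2) by simp
            qed
          next
            fix a assume "T \<omega> < a"
            then show "eventually (\<lambda>k. qq (\<rho> t2 k \<omega>) \<omega> < a) sequentially"
              using q_less_T[OF \<omega> g \<rho>_bounds(1)[OF \<omega>]] by (auto intro!: always_eventually intro: less_trans)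
          qed
          show ?thesis using 1 2 Tt2 by (simp add: min_absorb2)
        qed
        then have m2: "(\<lambda>k. mm (\<rho> t2 k \<omega>) \<omega>) \<longlonglongrightarrow> mart_tc t2 \<omega>" and q2: "(\<lambda>k. qq (\<rho> t2 k \<omega>) \<omega>) \<longlonglongrightarrow> min t2 (T \<omega>)"
          by auto
        have "(\<lambda>k. indicator (Ak k) \<omega> * ?Z k \<omega>) \<longlonglongrightarrow> indicator A \<omega> * ?L \<omega>"
          by (intro tendsto_mult i tendsto_exp tendsto_add tendsto_of_real tendsto_diff m1 m2 q1 q2 tendsto_const tendsto_divide) simp
        with i show ?thesis by simp
      qed
    qed
    then show "AE \<omega> in M. (\<lambda>k. indicator (Ak k) \<omega> * ?Z k \<omega>) \<longlonglongrightarrow> indicator A \<omega> * ?L \<omega>"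
      "AE \<omega> in M. (\<lambda>k. indicator (Ak k) \<omega> :: complex) \<longlonglongrightarrow> indicator A \<omega>" by auto
  qed
  note [measurable] = at_\<rho>_meas Ak_M A_M mart_tc_meas[OF t(1)] mart_tc_meas[OF t2] T_meas
  have "(\<lambda>k. \<integral>\<omega>. indicator (Ak k) \<omega> * ?Z k \<omega> \<partial>M) \<longlonglongrightarrow> (\<integral>\<omega>. indicator A \<omega> * ?L \<omega> \<partial>M)"
  \<comment> \<open>The dominating constant exists because the clock at \<open>\<rho> t2 k\<close>
    never exceeds t2, for any k.\<close>
  proof (rule integral_dominated_convergence[where w="\<lambda>_. exp (\<theta>\<^sup>2 * t2 / 2)", OF _ _ _ conv])
    show "AE \<omega> in M. norm (indicator (Ak k) \<omega> * ?Z k \<omega>) \<le> exp (\<theta>\<^sup>2 * t2 / 2)" for k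
    proof (rule AE_I2)
      fix \<omega> assume \<omega>: "\<omega> \<in> space M"
      have "qq (\<rho> t2 k \<omega>) \<omega> - qq (\<rho> t1 k \<omega>) \<omega> \<le> t2"
        using before_\<rho>(2)[OF \<omega> t2 \<rho>_bounds(1)[OF \<omega>] order_refl, of k]
          q_props(4)[OF \<omega> \<rho>_bounds(1)[OF \<omega>], of t1 k] by linarith
      then have "\<theta>\<^sup>2 * (qq (\<rho> t2 k \<omega>) \<omega> - qq (\<rho> t1 k \<omega>) \<omega>) / 2 \<le> \<theta>\<^sup>2 * t2 / 2"
        by (intro divide_right_mono mult_left_mono) auto
      then show "norm (indicator (Ak k) \<omega> * ?Z k \<omega>) \<le> exp (\<theta>\<^sup>2 * t2 / 2)"
        by (auto simp: indicator_def)
    qed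
  qed ((measurable)[2], simp)
  moreover have "(\<lambda>k. \<integral>\<omega>. indicator (Ak k) \<omega> * ?Z k \<omega> \<partial>M) \<longlonglongrightarrow> complex_of_real (prob A)"
  proof -
    have "(\<lambda>k. \<integral>\<omega>. (indicator (Ak k) \<omega> :: complex) \<partial>M) \<longlonglongrightarrow> (\<integral>\<omega>. indicator A \<omega> \<partial>M)"
      by (rule integral_dominated_convergence[where w="\<lambda>_. 1", OF _ _ _ conv']) (auto simp: indicator_def)
    moreover have "(\<integral>\<omega>. (indicator E \<omega> :: complex) \<partial>M) = complex_of_real (prob E)" if "E \<in> events" for E
    proof -
      have "(\<integral>\<omega>. (indicator E \<omega> :: complex) \<partial>M) = (\<integral>\<omega>. complex_of_real (indicator E \<omega>) \<partial>M)"
        by (intro Bochner_Integration.integral_cong) (auto simp: indicator_def)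
      then show ?thesis using that by simp
    qed
    ultimately show ?thesis unfolding step using Ak_M A_M by simp
  qed
  ultimately show ?thesis by (rule LIMSEQ_unique)
qed

text \<open>On the part of \<open>A\<close> where \<tau> \<le> t1, both values of
  \<open>mart_tc\<close> are the same limit and both minima equal T almost surely, so the
  exponential is 1. The other part has been treated before.\<close>

theorem exp_identity:
  assumes t: "0 \<le> t1" "t1 \<le> t2" and A: "A \<in> sets (F (ennreal t1))"
  shows "(\<integral>\<omega>. indicator A \<omega> * exp (\<i> * of_real (\<theta> * (mart_tc t2 \<omega> - mart_tc t1 \<omega>)) +
      of_real (\<theta>\<^sup>2 * (min t2 (T \<omega>) - min t1 (T \<omega>)) / 2)) \<partial>M) = complex_of_real (prob A)"
proof -
  have t2: "0 \<le> t2" using t by simp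
  let ?L = "\<lambda>\<omega>. exp (\<i> * of_real (\<theta> * (mart_tc t2 \<omega> - mart_tc t1 \<omega>)) +
      of_real (\<theta>\<^sup>2 * (min t2 (T \<omega>) - min t1 (T \<omega>)) / 2))"
  have A_M: "A \<in> sets M" using A F_sub by blast
  define A2 where "A2 = A \<inter> {\<omega>\<in>space M. \<tau> \<omega> \<le> ennreal t1}"
  define A1 where "A1 = A - A2"
  have A2F: "A2 \<in> sets (F (ennreal t1))" unfolding A2_def by (intro sets.Int A \<tau>_le_F)
  have A1F: "A1 \<in> sets (F (ennreal t1))" unfolding A1_def by (intro sets.Diff A A2F)
  have AM: "A1 \<in> events" "A2 \<in> events" using A1F A2F F_sub by blast+
  have A1_lt: "ennreal t1 < \<tau> \<omega>" if "\<omega> \<in> A1" for \<omega>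
    using that sets.sets_into_space[OF A_M] by (auto simp: A1_def A2_def)
  note [measurable] = AM mart_tc_meas[OF t(1)] mart_tc_meas[OF t2] T_meas
  have int: "integrable M (\<lambda>\<omega>. indicator C \<omega> * ?L \<omega>)" if [measurable]: "C \<in> events" for C
  proof (rule integrable_const_bound[of _ "exp (\<theta>\<^sup>2 * t2 / 2)"])
    show "AE \<omega> in M. norm (indicator C \<omega> * ?L \<omega>) \<le> exp (\<theta>\<^sup>2 * t2 / 2)"
    proof (rule AE_I2)
      fix \<omega>
      have "min t2 (T \<omega>) - min t1 (T \<omega>) \<le> t2" using t T_nonneg[of \<omega>] by auto
      then have "\<theta>\<^sup>2 * (min t2 (T \<omega>) - min t1 (T \<omega>)) / 2 \<le> \<theta>\<^sup>2 * t2 / 2"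
        by (intro divide_right_mono mult_left_mono) auto
      then show "norm (indicator C \<omega> * ?L \<omega>) \<le> exp (\<theta>\<^sup>2 * t2 / 2)" by (auto simp: indicator_def)
    qed
  qed measurable
  have "(\<integral>\<omega>. indicator A \<omega> * ?L \<omega> \<partial>M) = (\<integral>\<omega>. indicator A1 \<omega> * ?L \<omega> + indicator A2 \<omega> * ?L \<omega> \<partial>M)"
    by (intro Bochner_Integration.integral_cong) (auto simp: A1_def A2_def indicator_def)
  also have "\<dots> = (\<integral>\<omega>. indicator A1 \<omega> * ?L \<omega> \<partial>M) + (\<integral>\<omega>. indicator A2 \<omega> * ?L \<omega> \<partial>M)"
    by (intro Bochner_Integration.integral_add int AM)
  also have "(\<integral>\<omega>. indicator A1 \<omega> * ?L \<omega> \<partial>M) = complex_of_real (prob A1)"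
    by (rule exp_identity_before[OF t A1F A1_lt])
  also have "(\<integral>\<omega>. indicator A2 \<omega> * ?L \<omega> \<partial>M) = (\<integral>\<omega>. complex_of_real (indicator A2 \<omega>) \<partial>M)"
  proof (rule integral_cong_AE)
    show "AE \<omega> in M. indicator A2 \<omega> * ?L \<omega> = complex_of_real (indicator A2 \<omega>)"
      using AE_good
    proof eventually_elim
      case (elim \<omega>)
      show ?case
      proof (cases "\<omega> \<in> A2")
        case True
        then have "\<tau> \<omega> \<le> ennreal t1" by (simp add: A2_def)
        then have n: "\<not> ennreal t1 < \<tau> \<omega>" "\<not> ennreal t2 < \<tau> \<omega>"
          using ennreal_leI[OF t(2)] by auto
        then have "T \<omega> \<le> t1" "T \<omega> \<le> t2" using less_\<tau>_iff[OF elim] t(1) t2 by auto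
        then show ?thesis using True n by (simp add: mart_tc_def min_absorb2)
      qed simp
    qed
  qed measurable
  also have "\<dots> = complex_of_real (prob A2)" using AM by simp
  also have "complex_of_real (prob A1) + complex_of_real (prob A2) = complex_of_real (prob A)"
  proof -
    have "A = A1 \<union> A2" "A1 \<inter> A2 = {}" by (auto simp: A1_def A2_def)
    then show ?thesis using finite_measure_Union[OF AM] by simp
  qed
  finally show ?thesis .
qed

end

text \<open>Induction on the number of increments: those before \<open>t k\<close> are events of
  \<open>\<H> (t k)\<close>, of which the next increment is independent.\<close>

lemma (in prob_space) indep_increments:
  fixes W :: "real \<Rightarrow> 'a \<Rightarrow> real" and \<H> :: "real \<Rightarrow> 'a measure"
  assumes space: "\<And>t. space (\<H> t) = space M" and mono: "\<And>s t. s \<le> t \<Longrightarrow> sets (\<H> s) \<subseteq> sets (\<H> t)"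
    and adapted: "\<And>t. 0 \<le> t \<Longrightarrow> W t \<in> borel_measurable (\<H> t)" and meas: "\<And>t. 0 \<le> t \<Longrightarrow> W t \<in> borel_measurable M"
    and indep: "\<And>s t. 0 \<le> s \<Longrightarrow> s < t \<Longrightarrow> indep_set (sets (\<H> s)) (sets (vimage_algebra (space M) (\<lambda>\<omega>. W t \<omega> - W s \<omega>) borel))"
    and t: "0 \<le> t 0" "\<And>i. i < n \<Longrightarrow> t i \<le> t (Suc i)"
  shows "indep_vars (\<lambda>_. borel) (\<lambda>i \<omega>. W (t (Suc i)) \<omega> - W (t i) \<omega>) {..<n}"
proof (cases "n = 0")
  case True
  then show ?thesis by (simp add: indep_vars_def2 indep_sets_def)
next
  case False
  let ?I = "\<lambda>i \<omega>. W (t (Suc i)) \<omega> - W (t i) \<omega>"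
  let ?\<F> = "\<lambda>i. {?I i -` A \<inter> space M | A. A \<in> sets borel}"
  have tmono: "t i \<le> t j" if "i \<le> j" "j \<le> n" for i j
    using that
  proof (induction j rule: dec_induct)
    case (step k)
    then show ?case using t(2)[of k] by simp
  qed simp
  have t0: "0 \<le> t i" if "i \<le> n" for i using tmono[of 0 i] t(1) that by simp
  have I_meas: "?I i \<in> borel_measurable M" if "i < n" for i
    using meas[OF t0[of i]] meas[OF t0[of "Suc i"]] that by (intro borel_measurable_diff) auto
  have I_H: "?I i \<in> borel_measurable (\<H> (t j))" if "i < j" "j \<le> n" for i j
  proof -
    have m: "W (t k) \<in> borel_measurable (\<H> (t j))" if "k \<le> j" for k
    proof -
      have "subalgebra (\<H> (t j)) (\<H> (t k))"
        using mono[OF tmono[of k j]] that \<open>j \<le> n\<close> by (simp add: subalgebra_def space)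
      then show ?thesis using adapted[OF t0[of k]] that \<open>j \<le> n\<close> by (auto intro: measurable_from_subalg)
    qed
    show ?thesis using that by (intro borel_measurable_diff m) auto
  qed
  have prod: "prob (space M \<inter> (\<Inter>j\<in>{..<k}. A j)) = (\<Prod>j<k. prob (A j))"
    if A: "\<And>j. j < n \<Longrightarrow> A j \<in> ?\<F> j" and k: "k \<le> n" for A :: "nat \<Rightarrow> 'a set" and k
    using k
  proof (induction k)
    case 0
    then show ?case by (simp add: prob_space)
  next
    case (Suc k)
    define S where "S = space M \<inter> (\<Inter>j\<in>{..<k}. A j)"
    have kn: "k < n" using Suc by simp
    obtain C where C: "A k = ?I k -` C \<inter> space M" "C \<in> sets borel" using A[OF kn] by blast
    have S_H: "S \<in> sets (\<H> (t k))"
    proof -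
      have "A j \<in> sets (\<H> (t k))" if "j < k" for j
      proof -
        have "j < n" using that kn by simp
        from A[OF this] obtain C' where "A j = ?I j -` C' \<inter> space M" "C' \<in> sets borel" by blast
        then show ?thesis using measurable_sets[OF I_H[of j k], of C'] that kn by (simp add: space)
      qed
      then show ?thesis
        unfolding S_def using sets.top[of "\<H> (t k)"]
        by (cases "k = 0") (auto simp: space intro!: sets.Int sets.finite_INT)
    qed
    have "prob (S \<inter> A k) = prob S * prob (A k)"
    proof (cases "t k < t (Suc k)")
      case True
      have "A k \<in> sets (vimage_algebra (space M) (?I k) borel)"
        unfolding C(1) by (rule in_vimage_algebra[OF C(2)])
      then show ?thesis using indep_setD[OF indep[OF t0 True] S_H] kn by simp
    next
      \<comment> \<open>Equal consecutive times are allowed but lie outside \<open>indep\<close>;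
        the increment is then the constant 0, and its events are trivial.\<close>
      case False
      then have "t (Suc k) = t k" using t(2)[OF kn] by simp
      then have "A k = (if 0 \<in> C then space M else {})" using C(1) by auto
      moreover have "S \<inter> space M = S" by (auto simp: S_def)
      ultimately show ?thesis by (simp add: prob_space)
    qed
    moreover have "S \<inter> A k = space M \<inter> (\<Inter>j\<in>{..<Suc k}. A j)" by (auto simp: S_def less_Suc_eq)
    ultimately show ?case using Suc by (simp add: S_def)
  qed
  have "indep_sets ?\<F> {..<n}"
  proof (subst indep_sets_finite)
    show "\<forall>A\<in>Pi {..<n} ?\<F>. prob (\<Inter>j\<in>{..<n}. A j) = (\<Prod>j\<in>{..<n}. prob (A j))"
    proof
      fix A assume A: "A \<in> Pi {..<n} ?\<F>"
      then have A0: "A j \<in> ?\<F> j" if "j < n" for j using that by auto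
      have "A 0 \<subseteq> space M" using A0[of 0] False by auto
      then have "space M \<inter> (\<Inter>j\<in>{..<n}. A j) = (\<Inter>j\<in>{..<n}. A j)" using False by auto
      then show "prob (\<Inter>j\<in>{..<n}. A j) = (\<Prod>j\<in>{..<n}. prob (A j))" using prod[of A n, OF A0] by simp
    qed
    show "?\<F> i \<subseteq> events" if "i \<in> {..<n}" for i
      using measurable_sets[OF I_meas[of i]] that by auto
    show "space M \<in> ?\<F> i" for i by (intro CollectI exI[of _ UNIV]) auto
  qed (use False in auto)
  then show ?thesis unfolding indep_vars_def2 using I_meas by simp
qed

lemma sets_pair_measure_mono:
  assumes "space A = space A'" "space B = space B'" "sets A \<subseteq> sets A'" "sets B \<subseteq> sets B'"
  shows "sets (A \<Otimes>\<^sub>M B) \<subseteq> sets (A' \<Otimes>\<^sub>M B')"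
  unfolding sets_pair_measure assms(1,2) by (rule sigma_sets_mono') (use assms(3,4) in blast)

section \<open>Continuation by an independent Brownian path on a product space\<close>

context time_change
begin

abbreviation "path_space \<equiv> {w :: real \<Rightarrow> real. continuous_on {0..} w}"

definition path_filt :: "real set \<Rightarrow> (real \<Rightarrow> real) measure" where
  "path_filt K = gen_filt path_space (\<lambda>u w. w u) K"

text \<open>Wiener measure, obtained as the law of the given \<open>B\<close>. Its carrier consists
  of functions continuous on [0, \<infinity>), so processes built from a path are continuous for
  every path.\<close>

definition wiener :: "(real \<Rightarrow> real) measure" where
  "wiener = distr M (path_filt {0..}) (\<lambda>\<omega> u. B u \<omega>)"

definition upto :: "ennreal \<Rightarrow> real set" where "upto t = {u. 0 \<le> u \<and> ennreal u \<le> t}"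

definition H :: "ennreal \<Rightarrow> ('a \<times> (real \<Rightarrow> real)) measure" where
  "H t = F t \<Otimes>\<^sub>M path_filt (upto t)"

lemma space_path_filt[simp]: "space (path_filt K) = path_space"
  by (simp add: path_filt_def)

lemma space_wiener[simp]: "space wiener = path_space" and sets_wiener: "sets wiener = sets (path_filt {0..})"
  by (simp_all add: wiener_def)

lemma path_filt_mono: "K \<subseteq> K' \<Longrightarrow> sets (path_filt K) \<subseteq> sets (path_filt K')"
  unfolding path_filt_def by (rule sets_gen_filt_mono)

lemma path_filt_wiener: "sets (path_filt (upto t)) \<subseteq> sets wiener"
  unfolding sets_wiener by (rule path_filt_mono) (auto simp: upto_def)

lemma coord_meas: "u \<in> K \<Longrightarrow> (\<lambda>w. w u) \<in> borel_measurable (path_filt K)"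
  unfolding path_filt_def using gen_filt_measurable[of u K "\<lambda>u w. w u"] by simp

lemma paths_meas: "0 \<le> s \<Longrightarrow> K \<subseteq> {0..s} \<Longrightarrow> (\<lambda>\<omega> u. B u \<omega>) \<in> measurable (\<G> s) (path_filt K)"
  unfolding path_filt_def
  by (rule measurable_into_gen_filt)
     (use B_cont measurable_G_mono[OF B_adapted] in \<open>auto simp: space_G\<close>)

lemma paths_meas_M: "(\<lambda>\<omega> u. B u \<omega>) \<in> measurable M (path_filt {0..})"
  unfolding path_filt_def
  by (rule measurable_into_gen_filt) (use B_cont B_meas in auto)

lemma prob_space_wiener: "prob_space wiener"
  unfolding wiener_def by (rule prob_space_distr[OF paths_meas_M])

text \<open>Three times occur because the independent path comes into use at a time v between s and
  u: the event lies in the past of s, while the increment starts only at v.\<close>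

lemma wiener_char:
  assumes v: "0 \<le> s" "s \<le> v" "v \<le> u" and A: "A \<in> sets (path_filt (upto (ennreal s)))"
  shows "(\<integral>w. indicator A w * iexp (\<theta> * (w u - w v)) \<partial>wiener) = of_real (measure wiener A * exp (- (\<theta>\<^sup>2 * (u - v)) / 2))"
proof -
  let ?\<phi> = "\<lambda>\<omega> u. B u \<omega>"
  define A' where "A' = ?\<phi> -` A \<inter> space M"
  have A'G: "A' \<in> sets (\<G> v)"
  proof -
    have "upto (ennreal s) \<subseteq> {0..v}" using v by (auto simp: upto_def)
    from measurable_sets[OF paths_meas[OF _ this] A] v show ?thesis by (simp add: A'_def space_G)
  qed
  have A'M: "A' \<in> events" using A'G sets_G by blast
  have AN: "A \<in> sets wiener" using A path_filt_wiener by blast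
  have mA: "measure wiener A = prob A'"
    using AN unfolding A'_def wiener_def by (subst measure_distr[OF paths_meas_M]) simp_all
  have coords: "(\<lambda>w. w u) \<in> borel_measurable (path_filt {0..})" "(\<lambda>w. w v) \<in> borel_measurable (path_filt {0..})"
    using v by (auto intro: coord_meas)
  have m: "(\<lambda>w. indicator A w * iexp (\<theta> * (w u - w v))) \<in> borel_measurable (path_filt {0..})"
    using AN coords unfolding sets_wiener by measurable
  have "(\<integral>w. indicator A w * iexp (\<theta> * (w u - w v)) \<partial>wiener) = (\<integral>\<omega>. indicator A (?\<phi> \<omega>) * iexp (\<theta> * (B u \<omega> - B v \<omega>)) \<partial>M)"
    unfolding wiener_def by (rule integral_distr[OF paths_meas_M m])
  also have "\<dots> = (\<integral>\<omega>. indicator A' \<omega> * iexp (\<theta> * (B u \<omega> - B v \<omega>)) \<partial>M)"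
    by (intro Bochner_Integration.integral_cong) (auto simp: A'_def indicator_def)
  also have "\<dots> = of_real (prob A' * exp (- (\<theta>\<^sup>2 * (u - v)) / 2))"
  proof (cases "u = v")
    case True
    have "(\<integral>\<omega>. (indicator A' \<omega> :: complex) \<partial>M) = (\<integral>\<omega>. complex_of_real (indicator A' \<omega>) \<partial>M)"
      by (intro Bochner_Integration.integral_cong) (auto simp: indicator_def)
    then show ?thesis using True A'M by simp
  next
    case False
    then have vu: "0 \<le> v" "v < u" using v by auto
    let ?D = "\<lambda>\<omega>. B u \<omega> - B v \<omega>"
    have Dm: "?D \<in> borel_measurable M" using B_meas[of u] B_meas[of v] v by (intro borel_measurable_diff) auto
    have "(\<integral>\<omega>. indicator A' \<omega> * iexp (\<theta> * ?D \<omega>) \<partial>M) = (\<integral>\<omega>. indicator A' \<omega> \<partial>M) * (\<integral>\<omega>. iexp (\<theta> * ?D \<omega>) \<partial>M)"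
    proof (rule indep_incr_expectation(1)[OF vu, of "indicator A'" "\<lambda>x. iexp (\<theta> * x)"])
      show "indicator A' \<in> borel_measurable (\<G> v)" using A'G by simp
      show "complex_integrable M (indicator A')"
        using A'M by (intro integrable_const_bound[of _ 1]) (auto simp: indicator_def)
      show "complex_integrable M (\<lambda>\<omega>. iexp (\<theta> * ?D \<omega>))"
      proof (rule integrable_const_bound[of _ 1])
        show "(\<lambda>\<omega>. iexp (\<theta> * ?D \<omega>)) \<in> borel_measurable M" using Dm by measurable
      qed simp
    qed simp
    also have "(\<integral>\<omega>. (indicator A' \<omega> :: complex) \<partial>M) = (\<integral>\<omega>. complex_of_real (indicator A' \<omega>) \<partial>M)"
      by (intro Bochner_Integration.integral_cong) (auto simp: indicator_def)
    also have "\<dots> = of_real (prob A')" using A'M by simp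
    also have "(\<integral>\<omega>. iexp (\<theta> * ?D \<omega>) \<partial>M) = (CLINT x|distr M lborel ?D. iexp (\<theta> * x))"
      using Dm by (subst integral_distr) auto
    also have "distr M lborel ?D = density lborel (normal_density 0 (sqrt (u - v)))"
      using B_incr[OF vu] by (simp add: distributed_def)
    also have "(CLINT x|\<dots>. iexp (\<theta> * x)) = of_real (exp (- (\<theta>\<^sup>2 * (u - v)) / 2))"
      using char_normal_density[of "sqrt (u - v)" \<theta>] vu by (simp add: char_def)
    finally show ?thesis by simp
  qed
  finally show ?thesis unfolding mA .
qed

lemma mart_tc_cont:
  assumes \<omega>: "\<omega> \<in> space M" and g: "good \<omega>"
  shows "continuous_on {0..} (\<lambda>t. mart_tc t \<omega>)"
proof -
  have dom: "{t. 0 \<le> t \<and> ennreal t < \<tau> \<omega>} = {0..<T \<omega>}"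
    using less_\<tau>_iff[OF g] by auto
  have T0: "0 < T \<omega>" using q_props(5)[OF \<omega>] less_\<tau>_iff[OF g, of 0] by simp
  have al_c: "continuous_on {0..<T \<omega>} (\<lambda>t. al t \<omega>)"
    using clock_path.\<alpha>_cont[OF path[OF \<omega>]] unfolding path_\<alpha>[OF \<omega>] dom .
  have c1: "continuous_on {0..<T \<omega>} (\<lambda>t. mm (al t \<omega>) \<omega>)"
    using al_props(1)[OF \<omega>] less_\<tau>_iff[OF g]
    by (intro continuous_on_compose2[OF mart_cont[OF C2 \<omega>] al_c]) auto
  have eq: "mart_tc t \<omega> = (if t < T \<omega> then mm (al t \<omega>) \<omega> else m_inf \<omega>)" if "0 \<le> t" for t
    using less_\<tau>_iff[OF g that] by (simp add: mart_tc_def)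
  have cT: "((\<lambda>t. mart_tc t \<omega>) \<longlongrightarrow> m_inf \<omega>) (at_left (T \<omega>))"
  proof -
    have "filterlim (\<lambda>t. al t \<omega>) at_top (at_left (T \<omega>))"
      using clock_path.\<alpha>_tendsto_infinity[OF path[OF \<omega>] \<tau>_T[OF g] T_nonneg] unfolding path_\<alpha>[OF \<omega>] .
    moreover have "((\<lambda>s. mm s \<omega>) \<longlongrightarrow> m_inf \<omega>) at_top" using g by (simp add: good_def)
    ultimately have "((\<lambda>t. mm (al t \<omega>) \<omega>) \<longlongrightarrow> m_inf \<omega>) (at_left (T \<omega>))"
      by (rule filterlim_compose[rotated])
    moreover have "eventually (\<lambda>t. mm (al t \<omega>) \<omega> = mart_tc t \<omega>) (at_left (T \<omega>))"
      using T0 eq by (intro eventually_at_leftI[of 0]) auto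
    ultimately show ?thesis by (rule Lim_transform_eventually)
  qed
  have "continuous_on {0..T \<omega>} (\<lambda>t. mart_tc t \<omega>)"
    unfolding continuous_on_def
  proof
    fix t assume t: "t \<in> {0..T \<omega>}"
    show "((\<lambda>t. mart_tc t \<omega>) \<longlongrightarrow> mart_tc t \<omega>) (at t within {0..T \<omega>})"
    proof (cases "t = T \<omega>")
      case True
      then show ?thesis using cT T0 eq[of "T \<omega>"] by (simp add: at_within_Icc_at_left)
    next
      case False
      then have tT: "t < T \<omega>" using t by simp
      have "((\<lambda>t. mm (al t \<omega>) \<omega>) \<longlongrightarrow> mm (al t \<omega>) \<omega>) (at t within {0..<T \<omega>})"
        using c1 t tT by (simp add: continuous_on_def)
      moreover have "eventually (\<lambda>t. mm (al t \<omega>) \<omega> = mart_tc t \<omega>) (at t within {0..<T \<omega>})"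
        using eq by (auto simp: eventually_at_filter)
      ultimately have "((\<lambda>t. mart_tc t \<omega>) \<longlongrightarrow> mm (al t \<omega>) \<omega>) (at t within {0..<T \<omega>})"
        by (rule Lim_transform_eventually)
      moreover have "at t within {0..<T \<omega>} = at t within {0..T \<omega>}"
        using tT by (intro at_within_nhd[of t "{..<T \<omega>}"]) auto
      ultimately show ?thesis using eq[of t] t tT by simp
    qed
  qed
  moreover have "continuous_on {T \<omega>..} (\<lambda>t. mart_tc t \<omega>)"
  proof -
    have "m_inf \<omega> = mart_tc t \<omega>" if "t \<in> {T \<omega>..}" for t using eq[of t] that T0 by simp
    then show ?thesis by (rule continuous_on_eq[OF continuous_on_const])
  qed
  ultimately have "continuous_on ({0..T \<omega>} \<union> {T \<omega>..}) (\<lambda>t. mart_tc t \<omega>)"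
    by (intro continuous_on_closed_Un) auto
  moreover have "{0..T \<omega>} \<union> {T \<omega>..} = {0..}" using T0 by auto
  ultimately show ?thesis by simp
qed

text \<open>The minimum is formed in \<open>ennreal\<close> before conversion, so the value is
  correct even where \<tau> is infinite.\<close>

definition \<tau>m :: "real \<Rightarrow> 'a \<Rightarrow> real" where "\<tau>m t \<omega> = enn2real (min (ennreal t) (\<tau> \<omega>))"

lemma \<tau>m_bounds: "0 \<le> t \<Longrightarrow> 0 \<le> \<tau>m t \<omega> \<and> \<tau>m t \<omega> \<le> t"
  unfolding \<tau>m_def using enn2real_mono[of "min (ennreal t) (\<tau> \<omega>)" "ennreal t"] by auto

lemma \<tau>m_good: "good \<omega> \<Longrightarrow> 0 \<le> t \<Longrightarrow> \<tau>m t \<omega> = min t (T \<omega>)"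
  unfolding \<tau>m_def by (auto simp: \<tau>_T min_def T_nonneg)

lemma \<tau>m_meas: "0 \<le> t \<Longrightarrow> \<tau>m t \<in> borel_measurable (F (ennreal t))"
proof -
  assume t: "0 \<le> t"
  have "(\<lambda>\<omega>. min (ennreal t) (\<tau> \<omega>)) \<in> borel_measurable (F (ennreal t))"
  proof (rule borel_measurableI_le)
    fix y
    show "{\<omega>\<in>space (F (ennreal t)). min (ennreal t) (\<tau> \<omega>) \<le> y} \<in> sets (F (ennreal t))"
    proof (cases "ennreal t \<le> y")
      case True
      then have "{\<omega>\<in>space (F (ennreal t)). min (ennreal t) (\<tau> \<omega>) \<le> y} = space (F (ennreal t))" by (auto simp: min_le_iff_disj)
      then show ?thesis by (metis sets.top)
    next
      case False
      then have "{\<omega>\<in>space (F (ennreal t)). min (ennreal t) (\<tau> \<omega>) \<le> y} = {\<omega>\<in>space M. \<tau> \<omega> \<le> y}" by (auto simp: min_le_iff_disj)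
      moreover have "y \<le> ennreal t" using False by simp
      ultimately show ?thesis using subsetD[OF F_mono \<tau>_le_F] by simp
    qed
  qed
  then show ?thesis unfolding \<tau>m_def by measurable
qed

text \<open>The conditional characteristic function of an increment is computed on rectangles,
  integrating first over the independent path. The random exponents from the two factors then
  combine to a deterministic one.\<close>

lemma product_brownian_motion:
  "\<exists>W. brownian_motion_wrt (M \<Otimes>\<^sub>M wiener) H W \<and>
    (AE p in M \<Otimes>\<^sub>M wiener. \<forall>t\<ge>0. ennreal t < \<tau> (fst p) \<longrightarrow> W t p = mm (al t (fst p)) (fst p))"
proof -
  interpret wiener: prob_space wiener by (rule prob_space_wiener)
  interpret PP: pair_prob_space M wiener ..
  let ?P = "M \<Otimes>\<^sub>M wiener"
  obtain Nu where Nu: "Nu \<in> null_sets M" "{\<omega>\<in>space M. \<not> good \<omega>} \<subseteq> Nu"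
    using AE_good by (auto simp: eventually_ae_filter)
  \<comment> \<open>A measurable set of good paths that belongs to every \<open>F t\<close>, the
    null sets being included. Outside it \<open>W\<close> is set to 0, which makes every path
    continuous and keeps \<open>W\<close> adapted.\<close>
  define G0 where "G0 = space M - Nu"
  have G0_F: "G0 \<in> sets (F t)" for t
    unfolding G0_def using sets.Diff[OF sets.top[of "F t"] null_F[OF Nu(1)]] by simp
  have G0_good: "\<omega> \<in> space M \<and> good \<omega>" if "\<omega> \<in> G0" for \<omega> using that Nu by (auto simp: G0_def)
  have AE_G0: "AE \<omega> in M. \<omega> \<in> G0"
    using AE_not_in[OF Nu(1)] AE_space by eventually_elim (simp add: G0_def)
  \<comment> \<open>Up to \<open>\<tau>\<close>, \<open>W\<close> is the time-changed martingale; after \<open>\<tau>\<close> it moves with the independent path \<open>snd p\<close>.\<close>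
  define W where "W t p = indicator G0 (fst p) * (mart_tc t (fst p) + snd p t - snd p (\<tau>m t (fst p)))"
    for t :: real and p :: "'a \<times> (real \<Rightarrow> real)"
  have space_H: "space (H t) = space ?P" for t by (simp add: H_def space_pair_measure)
  have sets_H: "sets (H t) = sigma_sets (space ?P) {A \<times> A' | A A'. A \<in> sets (F t) \<and> A' \<in> sets (path_filt (upto t))}" for t
    unfolding H_def sets_pair_measure by (simp add: space_pair_measure)
  have upto_mono: "upto s \<subseteq> upto t" if "s \<le> t" for s t using that by (auto simp: upto_def)
  have H_mono: "sets (H s) \<subseteq> sets (H t)" if "s \<le> t" for s t
    unfolding H_def using F_mono[OF that] path_filt_mono[OF upto_mono[OF that]]
    by (intro sets_pair_measure_mono) simp_all
  have H_P: "sets (H t) \<subseteq> sets ?P" for t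
    unfolding H_def using F_sub path_filt_wiener by (intro sets_pair_measure_mono) simp_all
  have H_sub: "subalgebra ?P (H t)" for t using space_H H_P by (simp add: subalgebra_def)
  have W_H: "W t \<in> borel_measurable (H (ennreal t))" if t: "0 \<le> t" for t
  proof -
    have f: "fst \<in> measurable (H (ennreal t)) (F (ennreal t))" and s: "snd \<in> measurable (H (ennreal t)) (path_filt (upto (ennreal t)))"
      unfolding H_def by simp_all
    have coord: "(\<lambda>p. snd p u) \<in> borel_measurable (H (ennreal t))" if "0 \<le> u" "u \<le> t" for u
      using measurable_compose[OF s coord_meas[of u]] that t by (simp add: upto_def)
    have "(\<lambda>p. snd p (\<tau>m t (fst p))) \<in> borel_measurable (H (ennreal t))"
    proof (rule borel_measurable_at_random_time[where Y="\<lambda>u p. snd p u", OF t coord])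
      show "continuous_on {0..t} (\<lambda>u. snd p u)" if "p \<in> space (H (ennreal t))" for p
        using that by (auto simp: space_H space_pair_measure intro: continuous_on_subset)
      show "(\<lambda>p. \<tau>m t (fst p)) \<in> borel_measurable (H (ennreal t))"
        by (rule measurable_compose[OF f \<tau>m_meas[OF t]])
    qed (use \<tau>m_bounds[OF t] in auto)
    moreover have "(\<lambda>p. mart_tc t (fst p)) \<in> borel_measurable (H (ennreal t))"
      by (rule measurable_compose[OF f mart_tc_meas_F[OF t]])
    moreover have "(\<lambda>p. indicator G0 (fst p) :: real) \<in> borel_measurable (H (ennreal t))"
      using G0_F by (intro measurable_compose[OF f] borel_measurable_indicator)
    ultimately show ?thesis
      unfolding W_def using coord[OF t order_refl]
      by (intro borel_measurable_times borel_measurable_diff borel_measurable_add)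
  qed
  have W_P: "W t \<in> borel_measurable ?P" if "0 \<le> t" for t
    by (rule measurable_from_subalg[OF H_sub W_H[OF that]])
  have W_0: "W 0 p = 0" if "p \<in> space ?P" for p
  proof (cases "fst p \<in> G0")
    case True
    then have \<omega>: "fst p \<in> space M" and g: "good (fst p)" using G0_good by auto
    have "ennreal 0 < \<tau> (fst p)" using q_props(5)[OF \<omega>] by simp
    moreover have "al 0 (fst p) = 0"
      using clock_path.\<alpha>_0[OF path[OF \<omega>]] by (simp add: path_\<alpha>[OF \<omega>])
    ultimately have "mart_tc 0 (fst p) = 0" using mart_0[OF C2 \<omega>] by (simp add: mart_tc_def)
    moreover have "\<tau>m 0 (fst p) = 0" using \<tau>m_bounds[of 0 "fst p"] by simp
    ultimately show ?thesis by (simp add: W_def)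
  qed (simp add: W_def)
  have W_cont: "continuous_on {0..} (\<lambda>t. W t p)" if p: "p \<in> space ?P" for p
  proof (cases "fst p \<in> G0")
    case True
    then have \<omega>: "fst p \<in> space M" and g: "good (fst p)" using G0_good by auto
    have w: "continuous_on {0..} (snd p)" using p by (auto simp: space_pair_measure)
    have "continuous_on {0..} (\<lambda>t. mart_tc t (fst p) + snd p t - snd p (min t (T (fst p))))"
      using T_nonneg[of "fst p"]
      by (intro continuous_intros mart_tc_cont[OF \<omega> g] w continuous_on_compose2[OF w]) auto
    then show ?thesis
      by (rule continuous_on_eq) (use True \<tau>m_good[OF g] in \<open>simp add: W_def\<close>)
  qed (simp add: W_def)
  \<comment> \<open>The increment splits into one of \<open>mart_tc\<close> and one of the
    independent path, the latter starting at s, T or t, according to the position of T.\<close>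
  have G0_eq: "W t p - W s p = (mart_tc t \<omega> - mart_tc s \<omega>) + (w t - w (min t (max (T \<omega>) s)))"
    if "p = (\<omega>, w)" "\<omega> \<in> G0" "0 \<le> s" "s < t" for s t p \<omega> w
  proof -
    have g: "good \<omega>" using G0_good that by simp
    have "w t - w (min t (T \<omega>)) - (w s - w (min s (T \<omega>))) = w t - w (min t (max (T \<omega>) s))"
      using that(4) by (auto simp: min_def max_def)
    then show ?thesis using that \<tau>m_good[OF g] by (simp add: W_def)
  qed
  have char: "(\<integral>p. indicator C p * iexp (\<theta> * (W t p - W s p)) \<partial>?P) =
      of_real (measure ?P C * exp (- (\<theta>\<^sup>2 * (sqrt (t - s))\<^sup>2) / 2))"
    if st: "0 \<le> s" "s < t" and C: "C \<in> {A \<times> A' | A A'. A \<in> sets (F (ennreal s)) \<and> A' \<in> sets (path_filt (upto (ennreal s)))}"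
    for s t \<theta> C
  proof -
    obtain A A' where C_eq: "C = A \<times> A'" and A: "A \<in> sets (F (ennreal s))" and A': "A' \<in> sets (path_filt (upto (ennreal s)))"
      using C by blast
    have AM: "A \<in> events" and A'N: "A' \<in> sets wiener" using A A' F_sub path_filt_wiener by blast+
    have t0: "0 \<le> t" using st by simp
    let ?g = "\<lambda>p. indicator C p * iexp (\<theta> * (W t p - W s p))"
    let ?E = "\<lambda>\<omega>. exp (\<i> * of_real (\<theta> * (mart_tc t \<omega> - mart_tc s \<omega>)) +
      of_real (\<theta>\<^sup>2 * (min t (T \<omega>) - min s (T \<omega>)) / 2))"
    let ?c = "of_real (measure wiener A' * exp (- (\<theta>\<^sup>2 * (t - s)) / 2)) :: complex"
    have CP: "C \<in> sets ?P" unfolding C_eq using AM A'N by simp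
    have gm: "?g \<in> borel_measurable ?P"
      using CP W_P[OF t0] W_P[OF st(1)] by measurable
    have gi: "integrable ?P ?g"
      by (rule PP.P.integrable_const_bound[of _ 1, OF _ gm]) (auto simp: indicator_def)
    have inner: "(\<integral>w. ?g (\<omega>, w) \<partial>wiener) = ?c * (indicator A \<omega> * ?E \<omega>)" if \<omega>: "\<omega> \<in> G0" for \<omega>
    proof -
      \<comment> \<open>From s to v the process follows the time-changed martingale, and from v to t
        the independent path.\<close>
      define v where "v = min t (max (T \<omega>) s)"
      have v: "s \<le> v" "v \<le> t" using st by (auto simp: v_def)
      have "(\<integral>w. ?g (\<omega>, w) \<partial>wiener) = (\<integral>w. (indicator A \<omega> * iexp (\<theta> * (mart_tc t \<omega> - mart_tc s \<omega>))) *
        (indicator A' w * iexp (\<theta> * (w t - w v))) \<partial>wiener)"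
      proof (rule Bochner_Integration.integral_cong[OF refl])
        fix w
        have "iexp (\<theta> * (W t (\<omega>, w) - W s (\<omega>, w))) = iexp (\<theta> * (mart_tc t \<omega> - mart_tc s \<omega>)) * iexp (\<theta> * (w t - w v))"
          unfolding G0_eq[OF refl \<omega> st] v_def[symmetric]
          by (simp add: exp_add[symmetric] algebra_simps)
        then show "?g (\<omega>, w) = (indicator A \<omega> * iexp (\<theta> * (mart_tc t \<omega> - mart_tc s \<omega>))) * (indicator A' w * iexp (\<theta> * (w t - w v)))"
          by (simp add: C_eq indicator_times)
      qed
      also have "\<dots> = (indicator A \<omega> * iexp (\<theta> * (mart_tc t \<omega> - mart_tc s \<omega>))) * (\<integral>w. indicator A' w * iexp (\<theta> * (w t - w v)) \<partial>wiener)"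
        by (rule integral_mult_right_zero)
      also have "(\<integral>w. indicator A' w * iexp (\<theta> * (w t - w v)) \<partial>wiener) = of_real (measure wiener A' * exp (- (\<theta>\<^sup>2 * (t - v)) / 2))"
        by (rule wiener_char[OF st(1) v A'])
      \<comment> \<open>This is the cancellation: the independent path runs for exactly the part of
        t - s by which the clock did not grow, so its exponent and that of \<open>?E\<close> add up
        to - \<theta>^2 (t - s) / 2.\<close>
      also have "t - v = (t - s) - (min t (T \<omega>) - min s (T \<omega>))"
        using st by (auto simp: v_def min_def max_def)
      also have "exp (- (\<theta>\<^sup>2 * ((t - s) - (min t (T \<omega>) - min s (T \<omega>)))) / 2) =
        exp (- (\<theta>\<^sup>2 * (t - s)) / 2) * exp (\<theta>\<^sup>2 * (min t (T \<omega>) - min s (T \<omega>)) / 2)"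
        by (simp add: exp_add[symmetric] algebra_simps diff_divide_distrib add_divide_distrib)
      finally have fin: "(\<integral>w. ?g (\<omega>, w) \<partial>wiener) = indicator A \<omega> * iexp (\<theta> * (mart_tc t \<omega> - mart_tc s \<omega>)) *
        of_real (measure wiener A' * (exp (- (\<theta>\<^sup>2 * (t - s)) / 2) * exp (\<theta>\<^sup>2 * (min t (T \<omega>) - min s (T \<omega>)) / 2)))" .
      have E: "?E \<omega> = iexp (\<theta> * (mart_tc t \<omega> - mart_tc s \<omega>)) * of_real (exp (\<theta>\<^sup>2 * (min t (T \<omega>) - min s (T \<omega>)) / 2))"
        by (simp only: exp_add exp_of_real)
      show ?thesis unfolding fin E by (simp only: of_real_mult mult_ac)
    qed
    have "(\<integral>p. ?g p \<partial>?P) = (\<integral>\<omega>. (\<integral>w. ?g (\<omega>, w) \<partial>wiener) \<partial>M)"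
      by (rule PP.integral_fst'[OF gi, symmetric])
    also have "\<dots> = (\<integral>\<omega>. ?c * (indicator A \<omega> * ?E \<omega>) \<partial>M)"
    proof (rule integral_cong_AE)
      show "AE \<omega> in M. (\<integral>w. ?g (\<omega>, w) \<partial>wiener) = ?c * (indicator A \<omega> * ?E \<omega>)"
        using AE_G0 by eventually_elim (rule inner)
      show "(\<lambda>\<omega>. \<integral>w. ?g (\<omega>, w) \<partial>wiener) \<in> borel_measurable M"
        using PP.integrable_fst'[OF gi] by (rule borel_measurable_integrable)
      show "(\<lambda>\<omega>. ?c * (indicator A \<omega> * ?E \<omega>)) \<in> borel_measurable M"
        using mart_tc_meas[OF st(1)] mart_tc_meas[OF t0] T_meas AM by measurable
    qed
    also have "\<dots> = ?c * (\<integral>\<omega>. indicator A \<omega> * ?E \<omega> \<partial>M)" by (rule integral_mult_right_zero)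
    also have "\<dots> = ?c * of_real (prob A)"
      using exp_identity[OF st(1) less_imp_le[OF st(2)] A] by simp
    also have "measure ?P C = prob A * measure wiener A'"
      unfolding C_eq using wiener.emeasure_pair_measure_Times[OF AM A'N]
      by (simp add: measure_def enn2real_mult)
    then have "?c * of_real (prob A) = of_real (measure ?P C * exp (- (\<theta>\<^sup>2 * (sqrt (t - s))\<^sup>2) / 2))"
      using st by (simp add: mult_ac)
    finally show ?thesis .
  qed
  have law: "distributed ?P lborel (\<lambda>p. W t p - W s p) (normal_density 0 (sqrt (t - s)))"
    and ind: "PP.P.indep_set (sets (H (ennreal s))) (sets (vimage_algebra (space ?P) (\<lambda>p. W t p - W s p) borel))"
    if st: "0 \<le> s" "s < t" for s t
  proof -
    let ?\<C> = "{A \<times> A' | A A'. A \<in> sets (F (ennreal s)) \<and> A' \<in> sets (path_filt (upto (ennreal s)))}"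
    have D: "(\<lambda>p. W t p - W s p) \<in> borel_measurable ?P"
      using st by (intro borel_measurable_diff W_P) auto
    have pos: "0 < sqrt (t - s)" using st by simp
    have sub: "?\<C> \<subseteq> sets ?P"
      using H_P[of "ennreal s"] unfolding sets_H by (auto intro: sigma_sets.Basic)
    have top: "space ?P \<in> ?\<C>"
      using sets.top[of "F (ennreal s)"] sets.top[of "path_filt (upto (ennreal s))"]
      by (auto simp: space_pair_measure)
    note * = PP.P.normal_indep_of_char[OF D pos sub Int_stable_pair_measure_generator top char[OF st]]
    show "distributed ?P lborel (\<lambda>p. W t p - W s p) (normal_density 0 (sqrt (t - s)))" by (rule *(1))
    show "PP.P.indep_set (sets (H (ennreal s))) (sets (vimage_algebra (space ?P) (\<lambda>p. W t p - W s p) borel))"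
      unfolding sets_H by (rule *(2))
  qed
  have "standard_brownian_motion ?P W"
    unfolding standard_brownian_motion_def
  proof (intro conjI allI impI ballI)
    show "prob_space ?P" by (rule PP.P.prob_space_axioms)
    show "PP.P.indep_vars (\<lambda>_. borel) (\<lambda>i p. W (t (Suc i)) p - W (t i) p) {..<n}"
      if "0 \<le> t 0 \<and> (\<forall>i<n. t i \<le> t (Suc i))" for n :: nat and t :: "nat \<Rightarrow> real"
    proof (rule PP.P.indep_increments[where \<H>="\<lambda>t. H (ennreal t)"])
      show "sets (H (ennreal s)) \<subseteq> sets (H (ennreal u))" if "s \<le> u" for s u
        by (rule H_mono[OF ennreal_leI[OF that]])
    qed (use that in \<open>simp_all add: space_H W_H W_P ind\<close>)
  qed (use W_0 W_cont W_P law in auto)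
  moreover have "filtration_on ?P H"
    unfolding filtration_on_def filtration_def using space_H H_mono H_sub by auto
  ultimately have "brownian_motion_wrt ?P H W"
    unfolding brownian_motion_wrt_def using W_H ind by auto
  moreover have "AE p in ?P. \<forall>t\<ge>0. ennreal t < \<tau> (fst p) \<longrightarrow> W t p = mm (al t (fst p)) (fst p)"
  proof -
    have "Nu \<times> space wiener \<in> null_sets ?P"
      by (rule wiener.times_in_null_sets1[OF Nu(1) sets.top])
    from AE_not_in[OF this] show ?thesis
      using AE_space
    proof eventually_elim
      case (elim p)
      then have p: "fst p \<in> G0" by (auto simp: G0_def space_pair_measure)
      then have g: "good (fst p)" using G0_good by simp
      show ?case
      proof (intro allI impI)
        fix t :: real assume t: "0 \<le> t" "ennreal t < \<tau> (fst p)"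
        then have "t < T (fst p)" using less_\<tau>_iff[OF g] by simp
        then have "\<tau>m t (fst p) = t" using \<tau>m_good[OF g t(1)] by simp
        then show "W t p = mm (al t (fst p)) (fst p)" using p t by (simp add: W_def mart_tc_def)
      qed
    qed
  qed
  ultimately show ?thesis by blast
qed

theorem brownian_motion_until_time_changed:
  "brownian_motion_until M F \<tau> (\<lambda>t \<omega>. mm (al t \<omega>) \<omega>)"
  unfolding brownian_motion_until_def
proof (intro conjI filtration_F stopping_\<tau>)
  show "adapted_until F \<tau> (\<lambda>t \<omega>. mm (al t \<omega>) \<omega>)"
    by (rule adapted_at_inverse_clock[OF mart_adapted[OF C2] mart_cont[OF C2]])
  obtain W where W: "brownian_motion_wrt (M \<Otimes>\<^sub>M wiener) H W"
    "AE p in M \<Otimes>\<^sub>M wiener. \<forall>t\<ge>0. ennreal t < \<tau> (fst p) \<longrightarrow> W t p = mm (al t (fst p)) (fst p)"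
    using product_brownian_motion by blast
  have "\<forall>t. fst \<in> measurable (H t) (F t)" by (simp add: H_def)
  with W prob_space_wiener show "\<exists>(N :: (real \<Rightarrow> real) measure) H W. prob_space N \<and> brownian_motion_wrt (M \<Otimes>\<^sub>M N) H W \<and>
    (\<forall>t. fst \<in> measurable (H t) (F t)) \<and>
    (AE p in M \<Otimes>\<^sub>M N. \<forall>t\<ge>0. ennreal t < \<tau> (fst p) \<longrightarrow> W t p = mm (al t (fst p)) (fst p))"
    by blast
qed

end

section \<open>Hitting time of r, the stochastic equation and the final assembly\<close>

lemma inj_of_deriv_nonzero:
  fixes f f' :: "real \<Rightarrow> real"
  assumes "\<And>x. (f has_real_derivative f' x) (at x)" "\<And>x. f' x \<noteq> 0"
  shows "inj f"
proof (rule linorder_injI)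
  fix x y :: real assume "x < y"
  from MVT2[OF this assms(1)] obtain z where "f y - f x = (y - x) * f' z" by blast
  then show "f x \<noteq> f y" using \<open>x < y\<close> assms(2)[of z] by auto
qed

text \<open>A monotone function lies on one side of its limit. If it attained the limit at x, its
  value at x + 1 would be squeezed between f(x) and the limit, contradicting injectivity.\<close>

lemma limit_not_attained:
  fixes f :: "real \<Rightarrow> real"
  assumes mono: "mono f \<or> antimono f" and inj: "inj f" and lim: "(f \<longlongrightarrow> r) at_top"
  shows "f x \<noteq> r"
proof -
  have n: "f x \<noteq> f (x + 1)" using injD[OF inj] by fastforce
  show ?thesis
    using mono
  proof
    assume m: "mono f"
    have "eventually (\<lambda>y. f (x + 1) \<le> f y) at_top"
      using eventually_ge_at_top[of "x + 1"] by eventually_elim (rule monoD[OF m])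
    then have "f (x + 1) \<le> r" by (intro tendsto_lowerbound[OF lim]) simp_all
    moreover have "f x \<le> f (x + 1)" by (rule monoD[OF m]) simp
    ultimately show ?thesis using n by simp
  next
    assume m: "antimono f"
    have "eventually (\<lambda>y. f y \<le> f (x + 1)) at_top"
      using eventually_ge_at_top[of "x + 1"] by eventually_elim (rule antimonoD[OF m])
    then have "r \<le> f (x + 1)" by (intro tendsto_upperbound[OF lim]) simp_all
    moreover have "f (x + 1) \<le> f x" by (rule antimonoD[OF m]) simp
    ultimately show ?thesis using n by simp
  qed
qed

text \<open>The set in the infimum is a singleton: before \<tau> the process takes values of f, none
  of which is r, and at \<tau> it is extended by the limit of f(X) along X \<rightarrow>
  \<infinity>.\<close>

lemma (in clock_path) hitting_time_eq_total_clock: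
  assumes fin: "\<tau> < \<infinity>" and X: "filterlim (\<lambda>t. X t \<omega>) at_top at_top"
    and lim: "(f \<longlongrightarrow> r) at_top" and not_r: "\<And>x. f x \<noteq> r"
  shows "hitting_time f g X r \<omega> = \<tau>"
proof -
  define T where "T = enn2real \<tau>"
  have T: "\<tau> = ennreal T" "0 \<le> T" using fin by (simp_all add: T_def)
  have T0: "0 < T" using total_pos T by simp
  have tc: "time_changed f g X t \<omega> = f (X (\<alpha> t) \<omega>)" for t
    by (simp add: time_changed_def \<alpha>_def)
  have "((\<lambda>u. time_changed f g X u \<omega>) \<longlongrightarrow> r) (at_left T)"
    unfolding tc
    by (rule filterlim_compose[OF lim filterlim_compose[OF X \<alpha>_tendsto_infinity[OF T]]])
  \<comment> \<open>At T the inverse clock is infinite, so the extension takes the branch of the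
    left limit.\<close>
  then have ext_T: "time_changed_ext f g X T \<omega> = r"
    using inverse_clock_infinite[of T] T by (simp add: time_changed_ext_def tendsto_Lim)
  have ext: "time_changed_ext f g X t \<omega> \<noteq> r" if "0 \<le> t" "t < T" for t
    using \<alpha>_props(3)[of t] that T not_r by (simp add: time_changed_ext_def tc ennreal_less_iff)
  have "{ennreal t | t. 0 \<le> t \<and> ennreal t \<le> \<tau> \<and> time_changed_ext f g X t \<omega> = r} = {\<tau>}" (is "?L = _")
  proof
    show "?L \<subseteq> {\<tau>}"
    proof
      fix y assume "y \<in> ?L"
      then obtain t where t: "y = ennreal t" "0 \<le> t" "ennreal t \<le> \<tau>" "time_changed_ext f g X t \<omega> = r" by blast
      then have "t \<le> T" using T by simp
      then have "t = T" using ext t by force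
      then show "y \<in> {\<tau>}" using t T by simp
    qed
    show "{\<tau>} \<subseteq> ?L" using T ext_T by auto
  qed
  then show ?thesis unfolding hitting_time_def by simp
qed

text \<open>The equation is the definition of \<open>m\<close> read at time \<alpha>_t: the
  substitution changes the drift integral up to \<alpha>_t into an integral up to t, and dividing
  the drift by f'^2 produces G.\<close>

theorem (in time_change) solves_sde_until_time_changed:
  assumes G: "\<And>x. G x = 1 / (f' x)\<^sup>2 * (1 / 2 * f'' x + \<mu> * f' x)"
  shows "solves_sde_until M F \<tau> (\<lambda>t \<omega>. mm (al t \<omega>) \<omega>) (G \<circ> inv f) (f 0) (time_changed f f' X)"
proof -
  have tc: "time_changed f f' X t \<omega> = f (X (al t \<omega>) \<omega>)" for t \<omega>
    by (simp add: time_changed_def al_def)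
  have fX: "continuous_on {0..} (\<lambda>s. f (X s \<omega>))" if "\<omega> \<in> space M" for \<omega>
    by (rule continuous_on_compose2[OF f_cont[OF C2] X_cont[OF that]]) simp
  have coeff: "(G \<circ> inv f) (f x) = drift f' f'' x / (f' x)\<^sup>2" for x
    using inv_f_f[OF inj_of_deriv_nonzero[OF f' f'_nonzero]] by (simp add: G drift_def[OF C2])
  have "0 < \<tau> \<omega> \<and> time_changed f f' X 0 \<omega> = f 0 \<and>
      continuous_on {t. 0 \<le> t \<and> ennreal t < \<tau> \<omega>} (\<lambda>t. time_changed f f' X t \<omega>) \<and>
      (\<forall>t\<ge>0. ennreal t < \<tau> \<omega> \<longrightarrow>
         set_integrable lborel {0..t} (\<lambda>s. (G \<circ> inv f) (time_changed f f' X s \<omega>)) \<and>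
         time_changed f f' X t \<omega> = time_changed f f' X 0 \<omega> + mm (al t \<omega>) \<omega> +
           (LINT s:{0..t}|lborel. (G \<circ> inv f) (time_changed f f' X s \<omega>)))"
    if \<omega>: "\<omega> \<in> space M" for \<omega>
  proof (intro conjI allI impI)
    interpret p: clock_path f' X \<omega> by (rule path[OF \<omega>])
    show "0 < \<tau> \<omega>" by (rule p.total_pos)
    show Z0: "time_changed f f' X 0 \<omega> = f 0"
      using p.\<alpha>_0 X_0[OF \<omega>] by (simp add: tc path_\<alpha>[OF \<omega>])
    show "continuous_on {t. 0 \<le> t \<and> ennreal t < \<tau> \<omega>} (\<lambda>t. time_changed f f' X t \<omega>)"
      unfolding tc using al_props(1)[OF \<omega>]
      by (intro continuous_on_compose2[OF fX[OF \<omega>] p.\<alpha>_cont[unfolded path_\<alpha>[OF \<omega>]]]) auto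
    fix t :: real assume t: "0 \<le> t" "ennreal t < \<tau> \<omega>"
    note tci = p.time_change_integral[OF drift_cont[OF C2] t, unfolded path_\<alpha>[OF \<omega>]]
    show "set_integrable lborel {0..t} (\<lambda>s. (G \<circ> inv f) (time_changed f f' X s \<omega>))"
      unfolding tc coeff by (rule tci(1))
    show "time_changed f f' X t \<omega> = time_changed f f' X 0 \<omega> + mm (al t \<omega>) \<omega> +
        (LINT s:{0..t}|lborel. (G \<circ> inv f) (time_changed f f' X s \<omega>))"
      unfolding Z0 unfolding tc coeff tci(2) by (simp add: mart_def[OF C2] afun_def)
  qed
  moreover have "adapted_until F \<tau> (time_changed f f' X)"
    using adapted_at_inverse_clock[of "\<lambda>s \<omega>. f (X s \<omega>)", OF comp_X_adapted[OF f_cont[OF C2] _ order_refl] fX]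
    unfolding tc[symmetric] by simp
  ultimately show ?thesis
    unfolding solves_sde_until_def using brownian_motion_until_time_changed by blast
qed

theorem proposition2p1:
  fixes M :: "'a measure" and B X Z :: "real \<Rightarrow> 'a \<Rightarrow> real"
    and \<mu> r :: real and f f' f'' G :: "real \<Rightarrow> real"
  assumes mu: "\<mu> > 0"
    and B: "standard_brownian_motion M B"
    and X_def: "X = (\<lambda>t \<omega>. B t \<omega> + \<mu> * t)"
    and mono: "mono f \<or> antimono f"
    and f': "\<And>x. (f has_real_derivative f' x) (at x)"
    and f'': "\<And>x. (f' has_real_derivative f'' x) (at x)"
    and cont_f'': "continuous_on UNIV f''"
    and lim: "(f \<longlongrightarrow> r) at_top"
    and f'_nonzero: "\<And>x. f' x \<noteq> 0"
    and f'_int: "\<exists>a. set_integrable lborel {a..} (\<lambda>x. (f' x)\<^sup>2)"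
    and Z_def: "Z = time_changed f f' X"
    and G_def: "G = (\<lambda>x. 1 / (f' x)\<^sup>2 * (1 / 2 * f'' x + \<mu> * f' x))"
  shows "(AE \<omega> in M. total_clock f' X \<omega> < \<infinity> \<and> total_clock f' X \<omega> = hitting_time f f' X r \<omega>) \<and>
         (\<exists>F \<beta>. solves_sde_until M F (total_clock f' X) \<beta> (G \<circ> inv f) (f 0) Z)"
proof -
  interpret prob_space M using B by (simp add: standard_brownian_motion_def)
  \<comment> \<open>The natural filtration of \<open>B\<close>, enlarged by the null sets on which
    the limit of \<open>m\<close> or finiteness of the clock may fail.\<close>
  let ?G = "\<lambda>s. completed M (gen_filt (space M) B {0..s})"
  interpret bf: brownian_filtration M ?G B \<mu> by (rule brownian_filtration_completed[OF B])
  have X: "X = bf.X" by (simp add: X_def bf.X_def fun_eq_iff)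
  have f'_cont: "continuous_on UNIV f'" by (rule bf.f'_cont[OF f' f'' cont_f''])
  have finite: "AE \<omega> in M. total_clock f' bf.X \<omega> < \<infinity>"
    using f'_int bf.total_clock_finite[OF mu f'_cont] by blast
  interpret tc: time_change M ?G B \<mu> f f' f''
  proof
    fix N s assume N: "N \<in> null_sets M"
    then have "AE \<omega> in M. \<omega> \<in> N \<longleftrightarrow> \<omega> \<in> {}" using AE_not_in[OF N] by simp
    with N show "N \<in> sets (?G s)" by (subst sets_completed) (auto simp: null_setsD2)
  qed (fact f' f'' cont_f'' f'_nonzero finite)+
  have "AE \<omega> in M. total_clock f' bf.X \<omega> < \<infinity> \<and> total_clock f' bf.X \<omega> = hitting_time f f' bf.X r \<omega>"
    using finite bf.X_tendsto_infinity[OF mu] AE_space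
  proof eventually_elim
    case (elim \<omega>)
    show ?case
      using clock_path.hitting_time_eq_total_clock[OF tc.path elim(1,2) lim
          limit_not_attained[OF mono inj_of_deriv_nonzero[OF f' f'_nonzero] lim]] elim
      by simp
  qed
  moreover have "solves_sde_until M tc.F (total_clock f' bf.X) (\<lambda>t \<omega>. tc.mm (tc.al t \<omega>) \<omega>) (G \<circ> inv f) (f 0) Z"
    unfolding Z_def X by (rule tc.solves_sde_until_time_changed) (simp add: G_def)
  ultimately show ?thesis unfolding X by blast
qed

end
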